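(* Let $\lambda$ be a dominant analytically integral weight of $G$ and let $H$ be a closed subgroup of $G$. Then the Toeplitz operators $T^\lambda_f$ with $H$-invariant symbols $f\in L^1(G/L)$ all commute with each other if and only if the restriction $\sigma^\lambda|_H$ is a multiplicity-free representation of $H$.
   Context: $G$ is a compact connected Lie group with normalized Haar measure $dy$, with a fixed maximal torus $T$ and a fixed positive root system. $(\sigma^\lambda,\mathcal H_\lambda)$ is the irreducible unitary representation of $G$ with highest weight $\lambda$ (inner products linear in the first variable), $d_\lambda=\dim\mathcal H_\lambda$, $v_\lambda$ a unit highest-weight vector, and $L=\{g\in G:\sigma^\lambda(g)v_\lambda\in\mathbb C v_\lambda\}$. Functions on $G/L$ are identified with right-$L$-invariant functions on $G$. For $f\in L^1(G/L)$ the Toeplitz operator $T^\lambda_f\in\mathrm{End}(\mathcal H_\lambda)$ is given by $$\langle T^\lambda_f v,w\rangle=d_\lambda\int_G f(y)\langle v,\sigma^\lambda(y)v_\lambda\rangle\overline{\langle w,\sigma^\lambda(y)v_\lambda\rangle}\,dy .$$ A function $f$ on $G/L$ is $H$-invariant if $f(h^{-1}x)=f(x)$ for all $h\in H$ (as elements of $L^1$). *)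

theory Defs
  imports "HOL-Analysis.Analysis" "HOL-Algebra.Coset"
begin

section \<open>Lie groups\<close>

text \<open>\<open>Ck_on k f S\<close>: \<open>f\<close> is of class $C^k$ on \<open>S\<close>. It is used for open sets \<open>S\<close> in finite-dimensional
  spaces, where it suffices to require that all directional derivatives \<open>x \<mapsto> f' x v\<close> are
  of class $C^{k-1}$.\<close>

primrec Ck_on :: "nat \<Rightarrow> ('a::real_normed_vector \<Rightarrow> 'b::real_normed_vector) \<Rightarrow> 'a set \<Rightarrow> bool" where
  "Ck_on 0 f S \<longleftrightarrow> continuous_on S f"
| "Ck_on (Suc k) f S \<longleftrightarrow>
     (\<exists>f'. (\<forall>x\<in>S. (f has_derivative f' x) (at x)) \<and> (\<forall>v. Ck_on k (\<lambda>x. f' x v) S))"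

definition smooth_on :: "('a::real_normed_vector \<Rightarrow> 'b::real_normed_vector) \<Rightarrow> 'a set \<Rightarrow> bool" where
  "smooth_on f S \<longleftrightarrow> (\<forall>k. Ck_on k f S)"

text \<open>A chart is a pair of its domain and its coordinate map; \<open>param c\<close> is the inverse of the
  coordinate map.\<close>

type_synonym ('g, 'e) chart = "'g set \<times> ('g \<Rightarrow> 'e)"

definition param :: "('g, 'e) chart \<Rightarrow> 'e \<Rightarrow> 'g" where
  "param c = inv_into (fst c) (snd c)"

definition is_chart :: "'g::topological_space set \<Rightarrow> ('g, 'e::real_normed_vector) chart \<Rightarrow> bool" where
  "is_chart M c \<longleftrightarrow>
     openin (top_of_set M) (fst c) \<and> open (snd c ` fst c) \<and>
     homeomorphism (fst c) (snd c ` fst c) (snd c) (param c)"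

text \<open>The topology of \<open>G\<close> is the subspace topology on \<open>carrier G\<close>. The model space \<open>'e\<close> is an arbitrary
  finite-dimensional real normed space: unlike the class \<open>euclidean_space\<close>, whose members have
  positive dimension, this admits dimension 0, that is, discrete groups \<open>G\<close>. The sort
  \<open>heine_borel\<close> is no restriction, since every finite-dimensional normed space has that property.
  Second countability is not listed because it is automatic for compact \<open>G\<close>.\<close>

definition lie_group ::
  "('g::t2_space, 'm) monoid_scheme \<Rightarrow>
   ('g, 'e::{real_normed_vector,heine_borel}) chart set \<Rightarrow> bool" where
  "lie_group G \<A> \<longleftrightarrow>
     group G \<and>
     continuous_on (carrier G \<times> carrier G) (\<lambda>(x, y). x \<otimes>\<^bsub>G\<^esub> y) \<and>
     continuous_on (carrier G) (\<lambda>x. inv\<^bsub>G\<^esub> x) \<and>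
     (\<exists>B :: 'e set. finite B \<and> span B = UNIV) \<and>
     (\<forall>c\<in>\<A>. is_chart (carrier G) c) \<and>
     (\<Union>c\<in>\<A>. fst c) = carrier G \<and>
     (\<forall>c\<in>\<A>. \<forall>d\<in>\<A>. smooth_on (\<lambda>x. snd d (param c x)) (snd c ` (fst c \<inter> fst d))) \<and>
     (\<forall>a\<in>\<A>. \<forall>b\<in>\<A>. \<forall>c\<in>\<A>.
        smooth_on (\<lambda>(x, y). snd c (param a x \<otimes>\<^bsub>G\<^esub> param b y))
          {(x, y). x \<in> snd a ` fst a \<and> y \<in> snd b ` fst b \<and>
                   param a x \<otimes>\<^bsub>G\<^esub> param b y \<in> fst c}) \<and>
     (\<forall>a\<in>\<A>. \<forall>c\<in>\<A>.
        smooth_on (\<lambda>x. snd c (inv\<^bsub>G\<^esub> (param a x)))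
          {x \<in> snd a ` fst a. inv\<^bsub>G\<^esub> (param a x) \<in> fst c})"

text \<open>From here on \<open>c\<close> is a chart around the identity. It identifies the Lie algebra
  $\mathfrak g = T_{\mathbf 1}G$ with the model space \<open>'e\<close>. The adjoint representation is the
  derivative of conjugation at the identity.\<close>

definition Ad ::
  "('g, 'm) monoid_scheme \<Rightarrow> ('g, 'e::real_normed_vector) chart \<Rightarrow> 'g \<Rightarrow> 'e \<Rightarrow> 'e" where
  "Ad G c g = frechet_derivative (\<lambda>x. snd c (g \<otimes>\<^bsub>G\<^esub> param c x \<otimes>\<^bsub>G\<^esub> inv\<^bsub>G\<^esub> g)) (at (snd c \<one>\<^bsub>G\<^esub>))"

definition one_parameter_subgroup ::
  "('g::topological_space, 'm) monoid_scheme \<Rightarrow> 'g set \<Rightarrow> (real \<Rightarrow> 'g) \<Rightarrow> bool" where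
  "one_parameter_subgroup G S \<gamma> \<longleftrightarrow>
     continuous_on UNIV \<gamma> \<and> range \<gamma> \<subseteq> S \<and> (\<forall>s t. \<gamma> (s + t) = \<gamma> s \<otimes>\<^bsub>G\<^esub> \<gamma> t)"

text \<open>\<open>\<gamma>\<close> is $s \mapsto \exp(sX)$, and it runs in \<open>S\<close>.\<close>

definition exp_curve ::
  "('g::topological_space, 'm) monoid_scheme \<Rightarrow> ('g, 'e::real_normed_vector) chart \<Rightarrow>
   'g set \<Rightarrow> 'e \<Rightarrow> (real \<Rightarrow> 'g) \<Rightarrow> bool" where
  "exp_curve G c S X \<gamma> \<longleftrightarrow>
     one_parameter_subgroup G S \<gamma> \<and> ((\<lambda>s. snd c (\<gamma> s)) has_vector_derivative X) (at 0)"

definition lie_algebra ::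
  "('g::topological_space, 'm) monoid_scheme \<Rightarrow> ('g, 'e::real_normed_vector) chart \<Rightarrow>
   'g set \<Rightarrow> 'e set" where
  "lie_algebra G c S = {X. \<exists>\<gamma>. exp_curve G c S X \<gamma>}"


section \<open>Maximal tori, weights and roots\<close>

text \<open>Compact connected abelian subgroups of a Lie group are the same as tori.\<close>

definition torus_in :: "('g::topological_space, 'm) monoid_scheme \<Rightarrow> 'g set \<Rightarrow> bool" where
  "torus_in G T \<longleftrightarrow> subgroup T G \<and> compact T \<and> connected T \<and>
     (\<forall>s\<in>T. \<forall>t\<in>T. s \<otimes>\<^bsub>G\<^esub> t = t \<otimes>\<^bsub>G\<^esub> s)"

definition maximal_torus :: "('g::topological_space, 'm) monoid_scheme \<Rightarrow> 'g set \<Rightarrow> bool" where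
  "maximal_torus G T \<longleftrightarrow> torus_in G T \<and> (\<forall>S. torus_in G S \<and> T \<subseteq> S \<longrightarrow> S = T)"

definition torus_character ::
  "('g::topological_space, 'm) monoid_scheme \<Rightarrow> 'g set \<Rightarrow> ('g \<Rightarrow> complex) \<Rightarrow> bool" where
  "torus_character G T \<xi> \<longleftrightarrow>
     continuous_on T \<xi> \<and> (\<forall>t\<in>T. cmod (\<xi> t) = 1) \<and>
     (\<forall>s\<in>T. \<forall>t\<in>T. \<xi> (s \<otimes>\<^bsub>G\<^esub> t) = \<xi> s * \<xi> t)"

text \<open>Weights and roots are elements of $(\mathfrak t_{\mathbb C})^*$, given by their restrictions
  to $\mathfrak t$ (the Lie algebra of \<open>T\<close>) and extended by 0 to all of \<open>'e\<close> so that equal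
  functionals are equal functions.

  \<open>char_exp G c T \<nu> \<xi>\<close>: \<open>\<xi>\<close> is a character of \<open>T\<close> with differential \<open>\<nu>\<close>, equivalently
  $\xi(\exp X) = e^{\nu(X)}$ for all $X \in \mathfrak t$. As $\exp(\mathfrak t) = T$, at most one
  such \<open>\<xi>\<close> exists on \<open>T\<close>; it is the character $e^\nu$. Real-linearity of \<open>\<nu>\<close> on $\mathfrak t$
  is a consequence.\<close>

definition char_exp ::
  "('g::topological_space, 'm) monoid_scheme \<Rightarrow> ('g, 'e::real_normed_vector) chart \<Rightarrow> 'g set \<Rightarrow>
   ('e \<Rightarrow> complex) \<Rightarrow> ('g \<Rightarrow> complex) \<Rightarrow> bool" where
  "char_exp G c T \<nu> \<xi> \<longleftrightarrow>
     torus_character G T \<xi> \<and>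
     (\<forall>X. X \<notin> lie_algebra G c T \<longrightarrow> \<nu> X = 0) \<and>
     (\<forall>X \<gamma>. exp_curve G c T X \<gamma> \<longrightarrow> ((\<lambda>s. \<xi> (\<gamma> s)) has_vector_derivative \<nu> X) (at 0))"

definition analytically_integral ::
  "('g::topological_space, 'm) monoid_scheme \<Rightarrow> ('g, 'e::real_normed_vector) chart \<Rightarrow> 'g set \<Rightarrow>
   ('e \<Rightarrow> complex) \<Rightarrow> bool" where
  "analytically_integral G c T \<nu> \<longleftrightarrow> (\<exists>\<xi>. char_exp G c T \<nu> \<xi>)"

text \<open>A pair \<open>(X, Y)\<close> stands for the element $X + iY$ of the complexified Lie algebra.\<close>

definition cscale :: "complex \<Rightarrow> 'e::real_vector \<times> 'e \<Rightarrow> 'e \<times> 'e" where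
  "cscale z Z = (Re z *\<^sub>R fst Z - Im z *\<^sub>R snd Z, Im z *\<^sub>R fst Z + Re z *\<^sub>R snd Z)"

definition Ad_complex ::
  "('g, 'm) monoid_scheme \<Rightarrow> ('g, 'e::real_normed_vector) chart \<Rightarrow> 'g \<Rightarrow> 'e \<times> 'e \<Rightarrow> 'e \<times> 'e" where
  "Ad_complex G c g Z = (Ad G c g (fst Z), Ad G c g (snd Z))"

definition root_space ::
  "('g::topological_space, 'm) monoid_scheme \<Rightarrow> ('g, 'e::real_normed_vector) chart \<Rightarrow> 'g set \<Rightarrow>
   ('e \<Rightarrow> complex) \<Rightarrow> ('e \<times> 'e) set" where
  "root_space G c T \<alpha> =
     {Z. \<exists>\<xi>. char_exp G c T \<alpha> \<xi> \<and> (\<forall>t\<in>T. Ad_complex G c t Z = cscale (\<xi> t) Z)}"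

text \<open>The roots are the differentials of the nontrivial characters by which \<open>T\<close> acts on
  $\mathfrak g_{\mathbb C}$.\<close>

definition roots ::
  "('g::topological_space, 'm) monoid_scheme \<Rightarrow> ('g, 'e::real_normed_vector) chart \<Rightarrow> 'g set \<Rightarrow>
   ('e \<Rightarrow> complex) set" where
  "roots G c T =
     {\<alpha>. \<exists>\<xi>. char_exp G c T \<alpha> \<xi> \<and> (\<exists>t\<in>T. \<xi> t \<noteq> 1) \<and>
          (\<exists>Z. Z \<noteq> 0 \<and> (\<forall>t\<in>T. Ad_complex G c t Z = cscale (\<xi> t) Z))}"

definition positive_root_system ::
  "('g::topological_space, 'm) monoid_scheme \<Rightarrow> ('g, 'e::real_normed_vector) chart \<Rightarrow> 'g set \<Rightarrow>
   ('e \<Rightarrow> complex) set \<Rightarrow> bool" where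
  "positive_root_system G c T P \<longleftrightarrow>
     P \<subseteq> roots G c T \<and>
     (\<forall>\<alpha>\<in>roots G c T. \<alpha> \<in> P \<longleftrightarrow> (\<lambda>X. - \<alpha> X) \<notin> P) \<and>
     (\<forall>\<alpha>\<in>P. \<forall>\<beta>\<in>P. (\<lambda>X. \<alpha> X + \<beta> X) \<in> roots G c T \<longrightarrow> (\<lambda>X. \<alpha> X + \<beta> X) \<in> P)"

definition Ad_invariant_inner ::
  "('g, 'm) monoid_scheme \<Rightarrow> ('g, 'e::real_normed_vector) chart \<Rightarrow> ('e \<Rightarrow> 'e \<Rightarrow> real) \<Rightarrow> bool" where
  "Ad_invariant_inner G c B \<longleftrightarrow>
     bilinear B \<and> (\<forall>X Y. B X Y = B Y X) \<and> (\<forall>X. X \<noteq> 0 \<longrightarrow> B X X > 0) \<and>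
     (\<forall>g\<in>carrier G. \<forall>X Y. B (Ad G c g X) (Ad G c g Y) = B X Y)"

text \<open>\<open>\<nu>\<close> is dominant if $\langle\nu, \alpha\rangle \ge 0$ for all positive roots \<open>\<alpha>\<close>. The functionals
  take imaginary values on $\mathfrak t$; if $\alpha = i B(\cdot, A)$ with
  $A \in \mathfrak t$, then $\langle\nu, \alpha\rangle = \nu(A)/i$. The sign does not depend on the
  choice of the invariant inner product \<open>B\<close>.\<close>

definition dominant ::
  "('g::topological_space, 'm) monoid_scheme \<Rightarrow> ('g, 'e::real_normed_vector) chart \<Rightarrow> 'g set \<Rightarrow>
   ('e \<Rightarrow> complex) set \<Rightarrow> ('e \<Rightarrow> complex) \<Rightarrow> bool" where
  "dominant G c T P \<nu> \<longleftrightarrow>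
     (\<exists>B. Ad_invariant_inner G c B \<and>
       (\<forall>\<alpha>\<in>P. \<exists>A\<in>lie_algebra G c T.
          (\<forall>X\<in>lie_algebra G c T. \<alpha> X = \<i> * of_real (B X A)) \<and> Im (\<nu> A) \<ge> 0))"


section \<open>Finite-dimensional unitary representations\<close>

definition cinner :: "complex ^ 'n::finite \<Rightarrow> complex ^ 'n \<Rightarrow> complex" where
  "cinner x y = (\<Sum>i\<in>UNIV. x $ i * cnj (y $ i))"

definition unitary_rep ::
  "('g::topological_space, 'm) monoid_scheme \<Rightarrow> ('g \<Rightarrow> complex ^ 'n::finite ^ 'n) \<Rightarrow> bool" where
  "unitary_rep G \<sigma> \<longleftrightarrow>
     continuous_on (carrier G) \<sigma> \<and> \<sigma> \<one>\<^bsub>G\<^esub> = mat 1 \<and>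
     (\<forall>g\<in>carrier G. \<forall>h\<in>carrier G. \<sigma> (g \<otimes>\<^bsub>G\<^esub> h) = \<sigma> g ** \<sigma> h) \<and>
     (\<forall>g\<in>carrier G. \<forall>x y. cinner (\<sigma> g *v x) (\<sigma> g *v y) = cinner x y)"

definition invariant_subspace ::
  "'g set \<Rightarrow> ('g \<Rightarrow> complex ^ 'n::finite ^ 'n) \<Rightarrow> (complex ^ 'n) set \<Rightarrow> bool" where
  "invariant_subspace S \<sigma> V \<longleftrightarrow> vec.subspace V \<and> (\<forall>h\<in>S. \<forall>x\<in>V. \<sigma> h *v x \<in> V)"

text \<open>For a subgroup \<open>S\<close>: the restriction of \<open>\<sigma>\<close> to \<open>S\<close> acts on \<open>V\<close> as an irreducible representation.\<close>

definition irreducible_on ::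
  "'g set \<Rightarrow> ('g \<Rightarrow> complex ^ 'n::finite ^ 'n) \<Rightarrow> (complex ^ 'n) set \<Rightarrow> bool" where
  "irreducible_on S \<sigma> V \<longleftrightarrow>
     invariant_subspace S \<sigma> V \<and> V \<noteq> {0} \<and>
     (\<forall>W. invariant_subspace S \<sigma> W \<and> W \<subseteq> V \<longrightarrow> W = {0} \<or> W = V)"

text \<open>Every linear map from \<open>V\<close> to \<open>W\<close> is the restriction of some matrix.\<close>

definition equivalent_on ::
  "'g set \<Rightarrow> ('g \<Rightarrow> complex ^ 'n::finite ^ 'n) \<Rightarrow> (complex ^ 'n) set \<Rightarrow> (complex ^ 'n) set \<Rightarrow> bool" where
  "equivalent_on S \<sigma> V W \<longleftrightarrow>
     (\<exists>A :: complex ^ 'n ^ 'n. bij_betw ((*v) A) V W \<and>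
        (\<forall>h\<in>S. \<forall>x\<in>V. A *v (\<sigma> h *v x) = \<sigma> h *v (A *v x)))"

text \<open>The space is a direct sum of pairwise inequivalent irreducible subrepresentations of \<open>S\<close>.\<close>

definition multiplicity_free ::
  "'g set \<Rightarrow> ('g \<Rightarrow> complex ^ 'n::finite ^ 'n) \<Rightarrow> bool" where
  "multiplicity_free S \<sigma> \<longleftrightarrow>
     (\<exists>\<V>. finite \<V> \<and> (\<forall>V\<in>\<V>. irreducible_on S \<sigma> V) \<and>
          vec.span (\<Union>\<V>) = UNIV \<and>
          (\<forall>V\<in>\<V>. V \<inter> vec.span (\<Union>(\<V> - {V})) = {0}) \<and>
          (\<forall>V\<in>\<V>. \<forall>W\<in>\<V>. V \<noteq> W \<longrightarrow> \<not> equivalent_on S \<sigma> V W))"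

text \<open>The derived representation of $\mathfrak g$, extended complex-linearly to
  $\mathfrak g_{\mathbb C}$.\<close>

definition derived_rep ::
  "('g, 'm) monoid_scheme \<Rightarrow> ('g, 'e::real_normed_vector) chart \<Rightarrow>
   ('g \<Rightarrow> complex ^ 'n::finite ^ 'n) \<Rightarrow> 'e \<times> 'e \<Rightarrow> complex ^ 'n \<Rightarrow> complex ^ 'n" where
  "derived_rep G c \<sigma> Z v =
     (let D = frechet_derivative (\<lambda>x. \<sigma> (param c x) *v v) (at (snd c \<one>\<^bsub>G\<^esub>))
      in D (fst Z) + \<i> *s D (snd Z))"

definition highest_weight_vector ::
  "('g::topological_space, 'm) monoid_scheme \<Rightarrow> ('g, 'e::real_normed_vector) chart \<Rightarrow> 'g set \<Rightarrow>
   ('e \<Rightarrow> complex) set \<Rightarrow> ('g \<Rightarrow> complex ^ 'n::finite ^ 'n) \<Rightarrow> ('e \<Rightarrow> complex) \<Rightarrow>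
   complex ^ 'n \<Rightarrow> bool" where
  "highest_weight_vector G c T P \<sigma> \<nu> v \<longleftrightarrow>
     v \<noteq> 0 \<and>
     (\<exists>\<xi>. char_exp G c T \<nu> \<xi> \<and> (\<forall>t\<in>T. \<sigma> t *v v = \<xi> t *s v)) \<and>
     (\<forall>\<alpha>\<in>P. \<forall>Z\<in>root_space G c T \<alpha>. derived_rep G c \<sigma> Z v = 0)"


section \<open>Toeplitz operators\<close>

definition normalized_haar ::
  "('g::topological_space, 'm) monoid_scheme \<Rightarrow> 'g measure \<Rightarrow> bool" where
  "normalized_haar G \<mu> \<longleftrightarrow>
     emeasure \<mu> (space \<mu>) = 1 \<and> space \<mu> = carrier G \<and>
     sets \<mu> = sets (restrict_space borel (carrier G)) \<and>
     (\<forall>g\<in>carrier G. distr \<mu> \<mu> (\<lambda>x. g \<otimes>\<^bsub>G\<^esub> x) = \<mu>)"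

text \<open>The stabilizer \<open>L\<close> of the line through \<open>v\<close>.\<close>

definition line_stabilizer ::
  "('g, 'm) monoid_scheme \<Rightarrow> ('g \<Rightarrow> complex ^ 'n::finite ^ 'n) \<Rightarrow> complex ^ 'n \<Rightarrow> 'g set" where
  "line_stabilizer G \<sigma> v = {g \<in> carrier G. \<exists>z. \<sigma> g *v v = z *s v}"

text \<open>Representatives of the elements of $L^1(G/L)$.\<close>

definition L1_quotient ::
  "('g, 'm) monoid_scheme \<Rightarrow> 'g measure \<Rightarrow> 'g set \<Rightarrow> ('g \<Rightarrow> complex) set" where
  "L1_quotient G \<mu> L =
     {f. integrable \<mu> f \<and> (\<forall>y\<in>carrier G. \<forall>l\<in>L. f (y \<otimes>\<^bsub>G\<^esub> l) = f y)}"

definition left_invariant ::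
  "('g, 'm) monoid_scheme \<Rightarrow> 'g measure \<Rightarrow> 'g set \<Rightarrow> ('g \<Rightarrow> complex) \<Rightarrow> bool" where
  "left_invariant G \<mu> H f \<longleftrightarrow> (\<forall>h\<in>H. AE x in \<mu>. f (inv\<^bsub>G\<^esub> h \<otimes>\<^bsub>G\<^esub> x) = f x)"

definition toeplitz ::
  "'g measure \<Rightarrow> ('g \<Rightarrow> complex ^ 'n::finite ^ 'n) \<Rightarrow> complex ^ 'n \<Rightarrow> ('g \<Rightarrow> complex) \<Rightarrow>
   complex ^ 'n ^ 'n" where
  "toeplitz \<mu> \<sigma> v\<^sub>0 f =
     (THE A. \<forall>v w. cinner (A *v v) w =
        of_nat CARD('n) *
        (LINT y|\<mu>. f y * cinner v (\<sigma> y *v v\<^sub>0) * cnj (cinner w (\<sigma> y *v v\<^sub>0))))"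

lemma cinner_axis_right: "cinner x (axis i 1) = x $ i"
  by (simp add: cinner_def axis_def if_distrib cong: if_cong)

lemma cinner_axis_left: "cinner (axis i 1) x = cnj (x $ i)"
  by (simp add: cinner_def axis_def if_distrib if_distribR cong: if_cong)

text \<open>The description in \<open>toeplitz\<close> does determine a matrix.\<close>

lemma toeplitz_cinner:
  fixes \<sigma> :: "'g::topological_space \<Rightarrow> complex ^ 'n::finite ^ 'n"
  assumes rep: "unitary_rep G \<sigma>" and haar: "normalized_haar G \<mu>" and f: "integrable \<mu> f"
  shows "cinner (toeplitz \<mu> \<sigma> v\<^sub>0 f *v v) w =
        of_nat CARD('n) *
        (LINT y|\<mu>. f y * cinner v (\<sigma> y *v v\<^sub>0) * cnj (cinner w (\<sigma> y *v v\<^sub>0)))"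
proof -
  define u where "u y = \<sigma> y *v v\<^sub>0" for y
  have cont: "continuous_on (carrier G) (\<lambda>y. u y $ i)" for i
  proof -
    have "continuous_on (carrier G) \<sigma>"
      using rep by (simp add: unitary_rep_def)
    then show ?thesis
      unfolding u_def matrix_vector_mult_def
      by (auto intro!: continuous_intros)
  qed
  have sets: "sets \<mu> = sets (restrict_space borel (carrier G))" and space: "space \<mu> = carrier G"
    using haar by (auto simp: normalized_haar_def)
  have meas: "(\<lambda>y. u y $ i) \<in> borel_measurable \<mu>" for i
    using borel_measurable_continuous_on_restrict[OF cont] measurable_cong_sets[OF sets refl] by blast
  have cnj_meas: "(\<lambda>y. cnj (u y $ i)) \<in> borel_measurable \<mu>" for i
    by (rule measurable_compose[OF meas])
       (intro borel_measurable_continuous_onI continuous_intros)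
  have normsq: "complex_of_real ((norm x)\<^sup>2) = cinner x x" for x :: "complex ^ 'n"
    by (simp add: cinner_def norm_vec_def L2_set_def complex_norm_square sum_nonneg flip: of_real_power)
  have bound: "cmod (u y $ i) \<le> norm v\<^sub>0" if "y \<in> carrier G" for y i
  proof -
    have "complex_of_real ((norm (u y))\<^sup>2) = complex_of_real ((norm v\<^sub>0)\<^sup>2)"
      using rep that unfolding normsq u_def by (auto simp: unitary_rep_def)
    then have "norm (u y) = norm v\<^sub>0"
      by (simp only: of_real_eq_iff) (simp add: power2_eq_iff_nonneg)
    then show ?thesis
      using Finite_Cartesian_Product.norm_nth_le[of "u y" i] by simp
  qed
  have int: "integrable \<mu> (\<lambda>y. f y * (cnj (u y $ j) * u y $ i))" for i j
  proof (rule Bochner_Integration.integrable_bound[of \<mu> "\<lambda>y. (norm v\<^sub>0)\<^sup>2 *\<^sub>R f y"])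
    show "integrable \<mu> (\<lambda>y. (norm v\<^sub>0)\<^sup>2 *\<^sub>R f y)"
      using f by simp
    show "(\<lambda>y. f y * (cnj (u y $ j) * u y $ i)) \<in> borel_measurable \<mu>"
      using meas borel_measurable_integrable[OF f] cnj_meas
      by (intro borel_measurable_times)
    have "norm (f y * (cnj (u y $ j) * u y $ i)) \<le> norm ((norm v\<^sub>0)\<^sup>2 *\<^sub>R f y)"
      if "y \<in> carrier G" for y
    proof -
      have "cmod (u y $ j) * cmod (u y $ i) \<le> norm v\<^sub>0 * norm v\<^sub>0"
        using bound[OF that] by (intro mult_mono) auto
      then show ?thesis
        by (simp add: norm_mult power2_eq_square mult.commute[of "cmod (f y)"] mult_right_mono)
    qed
    then show "AE y in \<mu>. norm (f y * (cnj (u y $ j) * u y $ i)) \<le> norm ((norm v\<^sub>0)\<^sup>2 *\<^sub>R f y)"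
      by (intro AE_I2) (simp add: space)
  qed
  define A :: "complex ^ 'n ^ 'n"
    where "A = (\<chi> i j. of_nat CARD('n) * (LINT y|\<mu>. f y * (cnj (u y $ j) * u y $ i)))"
  have expand: "f y * cinner v (u y) * cnj (cinner w (u y)) =
      (\<Sum>i\<in>UNIV. \<Sum>j\<in>UNIV. (v $ j * cnj (w $ i)) * (f y * (cnj (u y $ j) * u y $ i)))" for v w y
    by (simp add: cinner_def sum_distrib_left sum_distrib_right mult_ac) (rule sum.swap)
  have A: "cinner (A *v v) w =
      of_nat CARD('n) * (LINT y|\<mu>. f y * cinner v (u y) * cnj (cinner w (u y)))" for v w
    using int
    by (simp add: expand Bochner_Integration.integral_sum)
       (simp add: A_def cinner_def matrix_vector_mult_def sum_distrib_left sum_distrib_right mult_ac)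
  have "toeplitz \<mu> \<sigma> v\<^sub>0 f = A"
    unfolding toeplitz_def
  proof (rule the_equality)
    fix C :: "complex ^ 'n ^ 'n"
    assume C: "\<forall>v w. cinner (C *v v) w =
      of_nat CARD('n) * (LINT y|\<mu>. f y * cinner v (\<sigma> y *v v\<^sub>0) * cnj (cinner w (\<sigma> y *v v\<^sub>0)))"
    have "cinner (C *v v) w = cinner (A *v v) w" for v w
      using C A by (simp add: u_def)
    then have "(C *v v) $ i = (A *v v) $ i" for v i
      by (metis cinner_axis_right)
    then show "C = A"
      by (simp add: matrix_eq vec_eq_iff)
  qed (use A in \<open>simp add: u_def\<close>)
  then show ?thesis
    using A by (simp add: u_def)
qed

end

theory Submission
  imports Defs
begin

text \<open>The Berezin symbol $y \mapsto \langle B\sigma(y)v, \sigma(y)v\rangle$ of a matrix \<open>B\<close> in the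
  commutant of $\sigma|_H$ is an \<open>H\<close>-invariant function on $G/L$. Used as a Toeplitz symbol, it gives
  an operator whose Hilbert--Schmidt product with \<open>B\<close> is a multiple of the squared $L^2$-norm of the
  symbol. Hence, once the Berezin symbol is known to determine \<open>B\<close>, the Toeplitz operators with
  \<open>H\<close>-invariant symbols span the commutant, and by Schur's lemma the commutant is commutative if and
  only if $\sigma|_H$ is multiplicity-free.

  The symbol is injective because \<open>v\<close> is a highest-weight vector. Let \<open>N\<close> be the space of the
  matrices with zero symbol; it is stable under commutators with $\mathfrak g_{\mathbb C}$. If \<open>Z\<close>
  is such that $\bar Z$ preserves the line of \<open>v\<close>, then $\langle Bx, v\rangle = 0$ for all
  $B \in N$ implies $\langle BZx, v\rangle = 0$ for all $B \in N$. These \<open>Z\<close> and the stabilizer of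
  the line together span $\mathfrak g_{\mathbb C}$, so that products of such \<open>Z\<close>, applied to
  \<open>v\<close>, span the whole space.\<close>

section \<open>Finite-dimensional normed spaces\<close>

text \<open>The argument lives on the Lie algebra, yet \<open>\<sigma>\<close> is only assumed
  continuous. Its differentiability has to be earned: a vector averaged against a C^1 bump on
  \<open>G\<close> is differentiable, and irreducibility spreads this to all vectors. No Lie bracket
  is defined on the model space; that the operators \<open>D X\<close> are closed under commutators
  comes from differentiating conjugation. One-parameter subgroups are constructed because maximality
  of the torus is a statement about subgroups of \<open>G\<close>: it must show that vectors fixed
  by Ad of \<open>T\<close> are tangent to \<open>T\<close>. Their uniqueness also gives characters
  of \<open>T\<close> a differential, as roots are functionals on the torus algebra. The norm of the
  model space is arbitrary, so orthogonality there refers to the Ad-invariant inner product that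
  dominance of the weight supplies. Complex eigenvectors are found by real variational arguments,
  with multiplication by i kept as an isometry \<open>J\<close>.\<close>

text \<open>The bound makes the coordinates of a convergent sequence Cauchy, and the limit is the
  combination with the limit coordinates.\<close>

lemma closed_span_if_coords_bounded:
  fixes S :: "'a::real_normed_vector set"
  assumes fin: "finite S"
    and K: "\<And>u b. b \<in> S \<Longrightarrow> \<bar>u b\<bar> \<le> K * norm (\<Sum>b\<in>S. u b *\<^sub>R b)"
  shows "closed (span S)"
  unfolding closed_sequential_limits
proof (intro allI impI, elim conjE)
  fix z l assume z: "\<forall>n. z n \<in> span S" and l: "z \<longlonglongrightarrow> l"
  have "\<forall>n. \<exists>u. z n = (\<Sum>b\<in>S. u b *\<^sub>R b)"
    using z fin by (auto simp: span_finite)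
  then obtain u where u: "\<And>n. z n = (\<Sum>b\<in>S. u n b *\<^sub>R b)" by metis
  have "\<exists>c. (\<lambda>n. u n b) \<longlonglongrightarrow> c" if b: "b \<in> S" for b
  proof -
    have "Cauchy (\<lambda>n. u n b)"
    proof (rule metric_CauchyI)
      fix e :: real assume "e > 0"
      define K' where "K' = max K 1"
      have "Cauchy z" using l LIMSEQ_imp_Cauchy by blast
      then obtain M where M: "\<And>m n. m \<ge> M \<Longrightarrow> n \<ge> M \<Longrightarrow> dist (z m) (z n) < e / K'"
        using \<open>e > 0\<close> by (metis Cauchy_def K'_def divide_pos_pos less_max_iff_disj zero_less_one)
      show "\<exists>M. \<forall>m\<ge>M. \<forall>n\<ge>M. dist (u m b) (u n b) < e"
      proof (intro exI allI impI)
        fix m n assume "m \<ge> M" "n \<ge> M"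
        have "\<bar>u m b - u n b\<bar> \<le> K * norm (\<Sum>b\<in>S. (u m b - u n b) *\<^sub>R b)"
          using K[OF b, of "\<lambda>b. u m b - u n b"] .
        also have "(\<Sum>b\<in>S. (u m b - u n b) *\<^sub>R b) = z m - z n"
          by (simp add: u scaleR_diff_left sum_subtractf)
        also have "K * norm (z m - z n) \<le> K' * norm (z m - z n)"
          by (intro mult_right_mono) (auto simp: K'_def)
        also have "\<dots> < e"
        proof -
          have "K' > 0" by (simp add: K'_def)
          then show ?thesis
            using M[OF \<open>m \<ge> M\<close> \<open>n \<ge> M\<close>] by (simp add: dist_norm field_simps)
        qed
        finally show "dist (u m b) (u n b) < e" by (simp add: dist_norm)
      qed
    qed
    then show ?thesis using Cauchy_convergent convergent_def by blast
  qed
  then obtain c where c: "\<And>b. b \<in> S \<Longrightarrow> (\<lambda>n. u n b) \<longlonglongrightarrow> c b" by metis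
  have "z \<longlonglongrightarrow> (\<Sum>b\<in>S. c b *\<^sub>R b)"
    unfolding u by (intro tendsto_intros c)
  then have "l = (\<Sum>b\<in>S. c b *\<^sub>R b)" using l LIMSEQ_unique by blast
  then show "l \<in> span S" by (simp add: span_base span_scale span_sum)
qed

text \<open>Induction. The span of the old vectors is closed, so the new vector \<open>a\<close> has
  a positive distance \<open>d\<close> from it, which bounds the coefficient of \<open>a\<close>.
  Subtracting that term leaves a combination of old vectors of controlled norm.\<close>

lemma coords_bounded:
  fixes S :: "'a::real_normed_vector set"
  assumes "finite S" "independent S"
  shows "\<exists>K>0. \<forall>u. \<forall>b\<in>S. \<bar>u b\<bar> \<le> K * norm (\<Sum>b\<in>S. u b *\<^sub>R b)"
  using assms
proof (induction S)
  case empty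
  then show ?case by (auto intro!: exI[of _ 1])
next
  case (insert a S)
  have ind: "independent S" and a: "a \<notin> span S"
    using insert.prems insert.hyps by (auto simp: independent_insert)
  obtain K where K: "K > 0" "\<And>u b. b \<in> S \<Longrightarrow> \<bar>u b\<bar> \<le> K * norm (\<Sum>b\<in>S. u b *\<^sub>R b)"
    using insert.IH[OF ind] by auto
  have cl: "closed (span S)"
    using closed_span_if_coords_bounded[OF insert.hyps(1) K(2)] .
  then have "open (- span S)" by auto
  then obtain d where d: "d > 0" "ball a d \<subseteq> - span S"
    using a by (meson ComplI open_contains_ball)
  \<comment> \<open>The first entry bounds the coefficient of \<open>a\<close>. The second bounds
    the others, because dropping the \<open>a\<close> term increases the norm by at most the factor
    \<open>1 + norm a / d\<close>.\<close>
  define K' where "K' = max (1 / d) (K * (1 + norm a / d))"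
  have "K' > 0" using d by (simp add: K'_def less_max_iff_disj)
  moreover have "\<bar>u b\<bar> \<le> K' * norm (\<Sum>b\<in>insert a S. u b *\<^sub>R b)" if b: "b \<in> insert a S" for u b
  proof -
    define s where "s = (\<Sum>b\<in>S. u b *\<^sub>R b)"
    define N where "N = norm (u a *\<^sub>R a + s)"
    have N: "norm (\<Sum>b\<in>insert a S. u b *\<^sub>R b) = N"
      using insert.hyps by (simp add: N_def s_def)
    have sS: "s \<in> span S" by (simp add: s_def span_base span_scale span_sum)
    have ua: "\<bar>u a\<bar> * d \<le> N"
    proof (cases "u a = 0")
      case True then show ?thesis by (simp add: N_def)
    next
      case False
      have "- (inverse (u a)) *\<^sub>R s \<in> span S" using sS span_scale by blast
      then have "- (inverse (u a)) *\<^sub>R s \<notin> ball a d" using d by auto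
      then have "d \<le> norm (a + inverse (u a) *\<^sub>R s)"
        by (simp add: dist_norm)
      then have "\<bar>u a\<bar> * d \<le> norm (u a *\<^sub>R (a + inverse (u a) *\<^sub>R s))"
        by (simp add: mult_left_mono)
      also have "\<dots> = N" using False by (simp add: N_def scaleR_add_right)
      finally show ?thesis .
    qed
    then have ua': "\<bar>u a\<bar> \<le> N / d" using d by (simp add: field_simps)
    have N0: "N \<ge> 0" by (simp add: N_def)
    show ?thesis
    proof (cases "b = a")
      case True
      have "N / d \<le> K' * N"
        using mult_right_mono[OF max.cobounded1[of "1/d" "K * (1 + norm a / d)"] N0]
        by (simp add: K'_def)
      with ua' True show ?thesis by (simp add: N)
    next
      case False
      then have "b \<in> S" using b by auto
      then have "\<bar>u b\<bar> \<le> K * norm s" using K(2)[of b u] by (simp add: s_def)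
      also have "norm s \<le> N + \<bar>u a\<bar> * norm a"
      proof -
        have "norm ((u a *\<^sub>R a + s) - u a *\<^sub>R a) \<le> N + norm (u a *\<^sub>R a)"
          unfolding N_def by (rule norm_triangle_ineq4)
        then show ?thesis by simp
      qed
      also have "\<dots> \<le> N + N / d * norm a"
        using ua' by (intro add_left_mono mult_right_mono) auto
      also have "K * (N + N / d * norm a) = K * (1 + norm a / d) * N"
        by (simp add: algebra_simps)
      also have "\<dots> \<le> K' * N"
        using N0 by (intro mult_right_mono) (auto simp: K'_def)
      finally show ?thesis using K by (simp add: N)
    qed
  qed
  ultimately show ?case by blast
qed

lemma finite_basis_exists:
  fixes B :: "'a::real_vector set"
  assumes "finite B" "span B = UNIV"
  obtains C :: "'a set" where "finite C" "independent C" "span C = UNIV"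
proof -
  obtain C where C: "C \<subseteq> B" "independent C" "B \<subseteq> span C"
    using maximal_independent_subset by blast
  moreover have "span C = UNIV"
    using C(3) assms(2) by (metis span_mono span_span top.extremum_uniqueI)
  ultimately show ?thesis using that finite_subset[OF C(1) assms(1)] by blast
qed

text \<open>\<open>u x b\<close> is the coefficient of \<open>x\<close> at \<open>b\<close>, a
  continuous linear choice of coordinates. Sums over a finite set also cover dimension 0.\<close>

definition coordinates :: "'a::real_normed_vector set \<Rightarrow> ('a \<Rightarrow> 'a \<Rightarrow> real) \<Rightarrow> bool" where
  "coordinates C u \<longleftrightarrow> finite C \<and> (\<forall>x. (\<Sum>b\<in>C. u x b *\<^sub>R b) = x) \<and> (\<forall>b\<in>C. bounded_linear (\<lambda>x. u x b))"

text \<open>Coefficients are chosen pointwise. The bound of \<open>coords_bounded\<close>, applied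
  to the defects of additivity and homogeneity, shows that the choice is linear.\<close>

lemma fd_coordinates:
  fixes B :: "'a::real_normed_vector set"
  assumes "finite B" "span B = UNIV"
  obtains C u where "coordinates C (u :: 'a \<Rightarrow> 'a \<Rightarrow> real)"
proof -
  obtain C :: "'a set" where C: "finite C" "independent C" "span C = UNIV"
    using finite_basis_exists[OF assms] .
  obtain K where K: "K > 0" "\<And>u b. b \<in> C \<Longrightarrow> \<bar>u b\<bar> \<le> K * norm (\<Sum>b\<in>C. u b *\<^sub>R b)"
    using coords_bounded[OF C(1,2)] by auto
  have "\<exists>u. (\<Sum>b\<in>C. u b *\<^sub>R b) = x" for x
  proof -
    have "x \<in> span C" using C(3) by simp
    then show ?thesis unfolding span_finite[OF C(1)] by auto
  qed
  then obtain u where u: "\<And>x. (\<Sum>b\<in>C. u x b *\<^sub>R b) = x" by metis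
  have lin: "bounded_linear (\<lambda>x. u x b)" if b: "b \<in> C" for b
  proof (rule bounded_linear_intro)
    fix x y :: 'a and r :: real
    have "(\<Sum>b\<in>C. (u (x + y) b - u x b - u y b) *\<^sub>R b) = 0"
      by (simp add: scaleR_diff_left sum_subtractf u)
    then show "u (x + y) b = u x b + u y b"
      using K(2)[OF b, of "\<lambda>b. u (x + y) b - u x b - u y b"] by simp
    have "(\<Sum>b\<in>C. (u (r *\<^sub>R x) b - r * u x b) *\<^sub>R b) = 0"
      by (simp add: scaleR_diff_left sum_subtractf u flip: scaleR_scaleR scaleR_sum_right)
    then show "u (r *\<^sub>R x) b = r *\<^sub>R u x b"
      using K(2)[OF b, of "\<lambda>b. u (r *\<^sub>R x) b - r * u x b"] by simp
    show "norm (u x b) \<le> norm x * K"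
      using K(2)[OF b, of "u x"] by (simp add: u mult.commute)
  qed
  show ?thesis by (rule that[of C u]) (use C u lin in \<open>auto simp: coordinates_def\<close>)
qed

lemma coordinates_linear:
  assumes "coordinates C u" "linear f"
  shows "f x = (\<Sum>b\<in>C. u x b *\<^sub>R f b)"
proof -
  have "f x = f (\<Sum>b\<in>C. u x b *\<^sub>R b)" using assms by (simp add: coordinates_def)
  then show ?thesis using assms(2) by (simp add: linear_sum linear_scale)
qed

lemma fd_linear_bounded:
  fixes f :: "'a::real_normed_vector \<Rightarrow> 'b::real_normed_vector" and B :: "'a set"
  assumes "finite B" "span B = UNIV" "linear f"
  shows "bounded_linear f"
proof -
  obtain C :: "'a set" and u where C: "coordinates C u" using fd_coordinates[OF assms(1,2)] .
  have "bounded_linear (\<lambda>x. \<Sum>b\<in>C. u x b *\<^sub>R f b)"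
    using C by (intro bounded_linear_sum bounded_linear_compose[OF bounded_linear_scaleR_left])
      (auto simp: coordinates_def)
  then show ?thesis by (simp flip: coordinates_linear[OF C assms(3)])
qed

lemma fd_closed_subspace:
  fixes U :: "'a::real_normed_vector set"
  assumes "finite B" "span B = (UNIV :: 'a set)" "subspace U"
  shows "closed U"
proof -
  obtain C where C: "C \<subseteq> U" "independent C" "U \<subseteq> span C"
    using maximal_independent_subset by blast
  have "finite C"
    using independent_span_bound[OF assms(1) C(2)] assms(2) by auto
  then obtain K where K: "\<And>u b. b \<in> C \<Longrightarrow> \<bar>u b\<bar> \<le> K * norm (\<Sum>b\<in>C. u b *\<^sub>R b)"
    using coords_bounded[OF _ C(2)] by auto
  from closed_span_if_coords_bounded[OF \<open>finite C\<close> K] have "closed (span C)" .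
  moreover have "span C = U"
    using C assms(3) by (simp add: span_minimal subset_antisym)
  ultimately show ?thesis by simp
qed

text \<open>Linear maps in one variable are bounded, and expanding the other variable in coordinates
  combines finitely many such bounds into one.\<close>

lemma fd_bilinear_bounded:
  fixes f :: "'a::real_normed_vector \<Rightarrow> 'a \<Rightarrow> 'b::real_normed_vector"
  assumes fd: "finite B" "span B = (UNIV :: 'a set)" and f: "bilinear f"
  shows "bounded_bilinear f"
proof -
  obtain C :: "'a set" and u where C: "coordinates C u" using fd_coordinates[OF fd] .
  have lin: "linear (\<lambda>x. f x y)" "linear (f y)" for y
    using f by (auto simp: bilinear_def)
  have "\<exists>M. \<forall>y. norm (f b y) \<le> M * norm y" for b
  proof -
    obtain K where "\<And>y. norm (f b y) \<le> norm y * K"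
      using bounded_linear.bounded[OF fd_linear_bounded[OF fd lin(2)]] by blast
    then show ?thesis by (intro exI[of _ K]) (simp add: mult.commute)
  qed
  then obtain M where M: "\<And>b y. norm (f b y) \<le> M b * norm y" by metis
  have "\<exists>K. \<forall>x. \<bar>u x b\<bar> \<le> K * norm x" if "b \<in> C" for b
  proof -
    have "bounded_linear (\<lambda>x. u x b)" using C that by (simp add: coordinates_def)
    then obtain K where "\<And>x. norm (u x b) \<le> norm x * K" using bounded_linear.bounded by blast
    then show ?thesis by (intro exI[of _ K]) (simp add: mult.commute)
  qed
  then obtain K where K: "\<And>b x. b \<in> C \<Longrightarrow> \<bar>u x b\<bar> \<le> K b * norm x" by metis
  have "norm (f x y) \<le> norm x * norm y * (\<Sum>b\<in>C. K b * M b)" for x y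
  proof -
    have "f x y = (\<Sum>b\<in>C. u x b *\<^sub>R f b y)"
      using coordinates_linear[OF C lin(1)] .
    also have "norm \<dots> \<le> (\<Sum>b\<in>C. norm (u x b *\<^sub>R f b y))" by (rule norm_sum)
    also have "\<dots> \<le> (\<Sum>b\<in>C. (K b * norm x) * (M b * norm y))"
    proof (intro sum_mono)
      fix b assume "b \<in> C"
      have "0 \<le> K b * norm x" using order_trans[OF abs_ge_zero K[OF \<open>b \<in> C\<close>]] .
      then show "norm (u x b *\<^sub>R f b y) \<le> (K b * norm x) * (M b * norm y)"
        unfolding norm_scaleR by (intro mult_mono K M \<open>b \<in> C\<close>) auto
    qed
    finally show ?thesis by (simp add: sum_distrib_left mult_ac)
  qed
  then show ?thesis
    using linear_add[OF lin(1)] linear_add[OF lin(2)] linear_scale[OF lin(1)] linear_scale[OF lin(2)]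
    by (intro bounded_bilinear.intro) blast+
qed

text \<open>A member of least dimension is minimal. This supplies both irreducible
  subrepresentations and the minimal invariant subspaces behind joint eigenvectors.\<close>

lemma fd_minimal_subspace:
  fixes B U :: "'a::real_vector set"
  assumes fd: "finite B" "span B = UNIV" and U: "P U" and sub: "\<And>U. P U \<Longrightarrow> subspace U"
  obtains W where "W \<subseteq> U" "P W" "\<And>V. P V \<Longrightarrow> V \<subseteq> W \<Longrightarrow> V = W"
proof -
  obtain C :: "'a set" where C: "finite C" "independent C" "span C = UNIV"
    using finite_basis_exists[OF fd] .
  interpret fd: finite_dimensional_vector_space scaleR C
    by unfold_locales (use C in \<open>auto simp: dependent_raw_def span_raw_def\<close>)
  obtain W where W: "W \<subseteq> U \<and> P W" "\<And>V. V \<subseteq> U \<and> P V \<Longrightarrow> dim W \<le> dim V"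
    using ex_has_least_nat[of "\<lambda>W. W \<subseteq> U \<and> P W" U dim] U by auto
  have "V = W" if V: "P V" "V \<subseteq> W" for V
  proof (rule fd.subspace_dim_equal[folded subspace_raw_def dim_raw_def])
    show "subspace V" "subspace W" using V W sub by auto
    show "dim W \<le> dim V" using V W by auto
  qed fact
  with W show ?thesis using that by blast
qed

lemma fd_prod:
  fixes B :: "'a::real_vector set"
  assumes "finite B" "span B = UNIV"
  obtains B2 :: "('a \<times> 'a) set" where "finite B2" "span B2 = UNIV"
proof
  let ?B = "(\<lambda>x. (x, 0)) ` B \<union> (\<lambda>x. (0, x)) ` B"
  show "finite ?B" using assms by simp
  have 1: "linear (\<lambda>x :: 'a. (x, 0 :: 'a))" "linear (\<lambda>x :: 'a. (0 :: 'a, x))" by (auto intro!: linearI)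
  have "(x, y) \<in> span ?B" for x y :: 'a
  proof -
    have "(x, 0 :: 'a) \<in> span ((\<lambda>x. (x, 0)) ` B)"
      by (subst linear_span_image[OF 1(1)]) (simp add: assms)
    moreover have "(0 :: 'a, y) \<in> span ((\<lambda>x. (0, x)) ` B)"
      by (subst linear_span_image[OF 1(2)]) (simp add: assms)
    ultimately have "(x, 0) + (0, y) \<in> span ?B"
      by (intro span_add) (auto intro: span_mono[THEN subsetD, rotated])
    then show ?thesis by simp
  qed
  then show "span ?B = UNIV" by auto
qed

section \<open>Inner products on the model space: projections and eigenvectors\<close>

text \<open>The first-order condition at a minimum: for small \<open>t\<close> a nonzero linear term
  would win against the quadratic one.\<close>

lemma quadratic_nonneg_linear_zero:
  fixes a b :: real
  assumes "\<And>t. 0 \<le> a * t + b * t\<^sup>2"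
  shows "a = 0"
proof (rule ccontr)
  assume a: "a \<noteq> 0"
  \<comment> \<open>Chosen so that \<open>b * s < 1\<close> for either sign of \<open>b\<close>; at
    \<open>t = - a * s\<close> the polynomial is then negative.\<close>
  define s where "s = 1 / (1 + \<bar>b\<bar>)"
  have s: "s > 0" "b * s < 1" "s * \<bar>b\<bar> < 1"
    by (auto simp: s_def field_simps abs_if)
  have "0 \<le> a * (- a * s) + b * (- a * s)\<^sup>2" by (rule assms)
  also have "\<dots> = a\<^sup>2 * s * (b * s - 1)" by (simp add: power2_eq_square algebra_simps)
  finally have "0 \<le> a\<^sup>2 * s * (b * s - 1)" .
  moreover have "a\<^sup>2 * s * (b * s - 1) < 0"
    using a s by (intro mult_pos_neg) auto
  ultimately show False by simp
qed

text \<open>\<open>\<beta>\<close> need not induce the norm of the type: the model space has an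
  arbitrary norm, while orthogonality is taken for the Ad-invariant form. Boundedness and coercivity
  make the two comparable.\<close>

locale inner_form =
  fixes \<beta> :: "'a::{real_normed_vector,heine_borel} \<Rightarrow> 'a \<Rightarrow> real"
  assumes bounded_bilinear_form: "bounded_bilinear \<beta>"
    and sym: "\<beta> x y = \<beta> y x"
    and pos: "x \<noteq> 0 \<Longrightarrow> \<beta> x x > 0"
begin

sublocale bb: bounded_bilinear \<beta> by (rule bounded_bilinear_form)

lemma nonneg: "\<beta> x x \<ge> 0"
  using pos[of x] by (cases "x = 0") (auto simp: bb.zero_left)

text \<open>The constant is the minimum of \<open>\<beta> x x\<close> on the unit sphere, compact by
  the Heine-Borel property. In dimension 0 the sphere is empty, hence the separate case.\<close>

lemma coercive: obtains k where "k > 0" "\<And>x. k * (norm x)\<^sup>2 \<le> \<beta> x x"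
proof (cases "\<exists>x::'a. x \<noteq> 0")
  case False
  then have "x = 0" for x :: 'a by auto
  then have "1 * (norm x)\<^sup>2 \<le> \<beta> x x" for x :: 'a
    by (metis bb.zero_left mult_1 norm_zero order_refl power_zero_numeral)
  then show ?thesis by (intro that[of 1]) auto
next
  case True
  then obtain x0 :: 'a where "x0 \<noteq> 0" by auto
  then have ne: "sphere (0::'a) 1 \<noteq> {}"
    by (auto simp: set_eq_iff intro!: exI[of _ "inverse (norm x0) *\<^sub>R x0"])
  have comp: "compact (sphere (0::'a) 1)"
  proof -
    have "closed {x::'a. norm x = 1}" by (intro closed_Collect_eq continuous_intros)
    moreover have "bounded {x::'a. norm x = 1}" by (auto simp: bounded_iff)
    ultimately show ?thesis by (simp add: compact_eq_bounded_closed sphere_def)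
  qed
  have "continuous_on (sphere 0 1) (\<lambda>x. \<beta> x x)"
    by (intro bb.continuous_on continuous_intros)
  from continuous_attains_inf[OF comp ne this]
  obtain m where m: "norm m = 1" "\<And>y. norm y = 1 \<Longrightarrow> \<beta> m m \<le> \<beta> y y" by auto
  show ?thesis
  proof (rule that[of "\<beta> m m"])
    show "\<beta> m m > 0" using m by (intro pos) auto
    fix x :: 'a
    show "\<beta> m m * (norm x)\<^sup>2 \<le> \<beta> x x"
    proof (cases "x = 0")
      case True then show ?thesis by (simp add: bb.zero_left)
    next
      case False
      have "\<beta> m m \<le> \<beta> (inverse (norm x) *\<^sub>R x) (inverse (norm x) *\<^sub>R x)"
        using False by (intro m) auto
      also have "\<dots> = \<beta> x x / (norm x)\<^sup>2"
        by (simp add: bb.scaleR_left bb.scaleR_right power2_eq_square field_simps)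
      finally show ?thesis using False by (simp add: field_simps)
    qed
  qed
qed

lemma bounded_sublevel: "bounded {x. \<beta> x x \<le> r}"
proof -
  obtain k where k: "k > 0" "\<And>x. k * (norm x)\<^sup>2 \<le> \<beta> x x" using coercive by metis
  have "norm x \<le> sqrt (r / k)" if "\<beta> x x \<le> r" for x
    using k(1) k(2)[of x] that by (intro real_le_rsqrt) (auto simp: field_simps)
  then show ?thesis unfolding bounded_iff by auto
qed

lemma expand_add: "\<beta> (x + t *\<^sub>R y) (x + t *\<^sub>R y) = \<beta> x x + 2 * t * \<beta> x y + t\<^sup>2 * \<beta> y y"
  by (simp add: bb.add_left bb.add_right bb.scaleR_left bb.scaleR_right sym[of y x] power2_eq_square algebra_simps)

text \<open>The vector is the one pointing from the nearest point of \<open>Q\<close> to a point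
  outside \<open>Q\<close>.\<close>

lemma ortho_complement_nontrivial:
  assumes Q: "closed Q" "subspace Q" "Q \<noteq> UNIV"
  obtains z where "z \<noteq> 0" "\<And>q. q \<in> Q \<Longrightarrow> \<beta> z q = 0"
proof -
  obtain z where z: "z \<notin> Q" using Q by auto
  \<comment> \<open>Only points of \<open>Q\<close> that are at least as close to \<open>z\<close>
    as \<open>0\<close> compete for the minimum, and they form a compact set.\<close>
  define S where "S = {q \<in> Q. \<beta> (z - q) (z - q) \<le> \<beta> z z}"
  have cont: "continuous_on A (\<lambda>q. \<beta> (z - q) (z - q))" for A
    by (intro bb.continuous_on continuous_intros)
  have "closed {q. \<beta> (z - q) (z - q) \<le> \<beta> z z}"
    by (intro closed_Collect_le cont continuous_intros)
  then have "closed (Q \<inter> {q. \<beta> (z - q) (z - q) \<le> \<beta> z z})"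
    using Q by (intro closed_Int)
  then have "closed S" by (simp add: S_def Collect_conj_eq)
  moreover have "bounded S"
  proof -
    have "S \<subseteq> (\<lambda>x. z - x) ` {x. \<beta> x x \<le> \<beta> z z}"
      by (auto simp: S_def image_iff intro!: exI[of _ "z - _"])
    moreover have "bounded ((\<lambda>x. z - x) ` {x. \<beta> x x \<le> \<beta> z z})"
      by (intro bounded_minus_comp[where f="\<lambda>_. z" and g="\<lambda>x. x"])
         (auto simp: bounded_sublevel intro: bounded_subset[of "{z}"])
    ultimately show ?thesis by (rule bounded_subset[rotated])
  qed
  ultimately have "compact S" by (simp add: compact_eq_bounded_closed)
  moreover have "0 \<in> S" using Q by (auto simp: S_def subspace_0)
  ultimately obtain q0 where q0: "q0 \<in> S" "\<And>q. q \<in> S \<Longrightarrow> \<beta> (z - q0) (z - q0) \<le> \<beta> (z - q) (z - q)"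
    using continuous_attains_inf[of S] cont by blast
  have q0Q: "q0 \<in> Q" using q0 by (auto simp: S_def)
  have min: "\<beta> (z - q0) (z - q0) \<le> \<beta> (z - q) (z - q)" if "q \<in> Q" for q
  proof (cases "q \<in> S")
    case False
    then show ?thesis using q0(1) that by (auto simp: S_def)
  qed (use q0 in auto)
  show ?thesis
  proof (rule that[of "z - q0"])
    show "z - q0 \<noteq> 0" using z q0Q by auto
    fix q assume q: "q \<in> Q"
    have "0 \<le> 2 * \<beta> (z - q0) q * t + \<beta> q q * t\<^sup>2" for t
    proof -
      have "q0 - t *\<^sub>R q \<in> Q" using q q0Q Q by (simp add: subspace_diff subspace_scale)
      from min[OF this] have "\<beta> (z - q0) (z - q0) \<le> \<beta> ((z - q0) + t *\<^sub>R q) ((z - q0) + t *\<^sub>R q)"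
        by (simp add: algebra_simps)
      then show ?thesis unfolding expand_add by (simp add: algebra_simps)
    qed
    from quadratic_nonneg_linear_zero[OF this] show "\<beta> (z - q0) q = 0" by simp
  qed
qed

text \<open>The maximizer of the Rayleigh quotient on \<open>U\<close> is an eigenvector.\<close>

lemma symmetric_eigenvector:
  assumes U: "closed U" "subspace U" "U \<noteq> {0}"
    and S: "bounded_linear S" "\<And>u. u \<in> U \<Longrightarrow> S u \<in> U"
    and S_sym: "\<And>u w. u \<in> U \<Longrightarrow> w \<in> U \<Longrightarrow> \<beta> (S u) w = \<beta> u (S w)"
  obtains u m where "u \<in> U" "u \<noteq> 0" "S u = m *\<^sub>R u"
proof -
  interpret S: bounded_linear S by fact
  define K where "K = {u \<in> U. \<beta> u u = 1}"
  have "closed {u. \<beta> u u = 1}"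
    by (intro closed_Collect_eq bb.continuous_on continuous_intros)
  then have "closed (U \<inter> {u. \<beta> u u = 1})" using U by (intro closed_Int)
  then have "closed K" by (simp add: K_def Collect_conj_eq)
  moreover have "bounded K"
    by (rule bounded_subset[OF bounded_sublevel[of 1]]) (auto simp: K_def)
  ultimately have "compact K" by (simp add: compact_eq_bounded_closed)
  obtain u1 where u1: "u1 \<in> U" "u1 \<noteq> 0" using U subspace_0 by blast
  have "(inverse (sqrt (\<beta> u1 u1))) *\<^sub>R u1 \<in> K"
    using u1 pos[OF u1(2)] U
    by (auto simp: K_def bb.scaleR_left bb.scaleR_right subspace_scale field_simps simp flip: real_sqrt_mult)
  then have "K \<noteq> {}" by auto
  have "continuous_on K (\<lambda>u. \<beta> (S u) u)"
    by (intro bb.continuous_on continuous_intros S.continuous_on)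
  then obtain u where u: "u \<in> K" "\<And>w. w \<in> K \<Longrightarrow> \<beta> (S w) w \<le> \<beta> (S u) u"
    using continuous_attains_sup[OF \<open>compact K\<close> \<open>K \<noteq> {}\<close>] by blast
  define m where "m = \<beta> (S u) u"
  have uU: "u \<in> U" and uu: "\<beta> u u = 1" using u by (auto simp: K_def)
  have max: "\<beta> (S w) w \<le> m * \<beta> w w" if "w \<in> U" for w
  proof (cases "w = 0")
    case True then show ?thesis by (simp add: bb.zero_left bb.zero_right)
  next
    case False
    define r where "r = inverse (sqrt (\<beta> w w))"
    have r: "r * r = inverse (\<beta> w w)" "\<beta> w w > 0"
      using pos[OF False] by (auto simp: r_def simp flip: real_sqrt_mult inverse_mult_distrib)
    have "r *\<^sub>R w \<in> K" using r that U
      by (simp add: K_def bb.scaleR_left bb.scaleR_right subspace_scale flip: mult.assoc)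
    from u(2)[OF this] show ?thesis using r
      by (simp add: S.scaleR bb.scaleR_left bb.scaleR_right m_def field_simps flip: mult.assoc)
  qed
  \<comment> \<open>The form \<open>m * \<beta> x x - \<beta> (S x) x\<close> is nonnegative on
    \<open>U\<close> and zero at \<open>u\<close>. Its linear term at \<open>u\<close> in direction
    \<open>w\<close> is \<open>- 2 * \<beta> w w\<close>, so \<open>w\<close> has to vanish.\<close>
  define w where "w = S u - m *\<^sub>R u"
  have wU: "w \<in> U" using uU S(2) U by (simp add: w_def subspace_diff subspace_scale)
  have "0 \<le> (2 * (m * \<beta> u w - \<beta> (S u) w)) * t + (m * \<beta> w w - \<beta> (S w) w) * t\<^sup>2" for t
  proof -
    have "u + t *\<^sub>R w \<in> U" using uU wU U by (simp add: subspace_add subspace_scale)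
    from max[OF this] have "\<beta> (S u + t *\<^sub>R S w) (u + t *\<^sub>R w) \<le> m * \<beta> (u + t *\<^sub>R w) (u + t *\<^sub>R w)"
      by (simp add: S.add S.scaleR)
    moreover have "\<beta> (S u + t *\<^sub>R S w) (u + t *\<^sub>R w) = m + 2 * t * \<beta> (S u) w + t\<^sup>2 * \<beta> (S w) w"
      using S_sym[OF wU uU] sym[of w "S u"]
      by (simp add: bb.add_left bb.add_right bb.scaleR_left bb.scaleR_right m_def power2_eq_square algebra_simps)
    ultimately show ?thesis unfolding expand_add uu by (simp add: algebra_simps)
  qed
  from quadratic_nonneg_linear_zero[OF this] have "\<beta> w w = 0"
    by (simp add: w_def bb.diff_left bb.scaleR_left)
  then have "w = 0" using pos[of w] by force
  then show ?thesis
    using that[of u m] uU uu by (force simp: w_def bb.zero_left)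
qed

text \<open>Complex scalars are encoded as \<open>a + b J\<close>. On a minimal invariant subspace,
  symmetric operators commuting with \<open>J\<close> and \<open>F\<close> are real scalars, and an
  isometry \<open>A\<close> with inverse \<open>A'\<close> is recovered from the symmetric operators
  \<open>A + A'\<close> and \<open>J (A - A')\<close>.\<close>

lemma joint_eigenvector:
  assumes fd: "finite B" "span B = (UNIV :: 'a set)"
    and J: "linear J" "\<And>x. J (J x) = - x" "\<And>x y. \<beta> (J x) (J y) = \<beta> x y"
    and F: "\<And>A. A \<in> F \<Longrightarrow> linear A" "\<And>A x y. A \<in> F \<Longrightarrow> \<beta> (A x) (A y) = \<beta> x y"
      "\<And>A x. A \<in> F \<Longrightarrow> A (J x) = J (A x)"
      "\<And>A A' x. A \<in> F \<Longrightarrow> A' \<in> F \<Longrightarrow> A (A' x) = A' (A x)"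
      "\<And>A. A \<in> F \<Longrightarrow> \<exists>A'\<in>F. \<forall>x. A (A' x) = x"
    and U: "subspace U" "U \<noteq> {0}" "\<And>x. x \<in> U \<Longrightarrow> J x \<in> U" "\<And>A x. A \<in> F \<Longrightarrow> x \<in> U \<Longrightarrow> A x \<in> U"
  obtains u where "u \<in> U" "u \<noteq> 0" "\<And>A. A \<in> F \<Longrightarrow> \<exists>a b. A u = a *\<^sub>R u + b *\<^sub>R J u"
proof -
  define P where "P U \<longleftrightarrow> subspace U \<and> U \<noteq> {0} \<and> (\<forall>x\<in>U. J x \<in> U) \<and> (\<forall>A\<in>F. \<forall>x\<in>U. A x \<in> U)" for U
  have "P U" using U by (auto simp: P_def)
  then obtain W where W: "W \<subseteq> U" "P W" "\<And>V. P V \<Longrightarrow> V \<subseteq> W \<Longrightarrow> V = W"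
    using fd_minimal_subspace[OF fd, of P U] by (auto simp: P_def)
  \<comment> \<open>An eigenspace of \<open>S\<close> in \<open>W\<close> is again invariant, hence
    all of \<open>W\<close> by minimality.\<close>
  have scalar: "\<exists>m. \<forall>x\<in>W. S x = m *\<^sub>R x"
    if S: "linear S" "\<And>x. x \<in> W \<Longrightarrow> S x \<in> W" "\<And>x. S (J x) = J (S x)"
      "\<And>A x. A \<in> F \<Longrightarrow> S (A x) = A (S x)" "\<And>x y. \<beta> (S x) y = \<beta> x (S y)" for S
  proof -
    have "closed W" "subspace W" "W \<noteq> {0}"
      using W fd_closed_subspace[OF fd] by (auto simp: P_def)
    then obtain u m where u: "u \<in> W" "u \<noteq> 0" "S u = m *\<^sub>R u"
      using symmetric_eigenvector[of W S] S fd_linear_bounded[OF fd] by metis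
    define V where "V = {x \<in> W. S x = m *\<^sub>R x}"
    have "P V"
      using W(2) u F(1) S J(1) unfolding P_def V_def subspace_def
      by (auto simp: linear_add linear_scale linear_0 scaleR_add_right)
    then have "V = W" using W(3) by (auto simp: V_def)
    then show ?thesis by (auto simp: V_def)
  qed
  obtain u where u: "u \<in> W" "u \<noteq> 0" using W(2) by (auto simp: P_def dest: subspace_0)
  have "\<exists>a b. A u = a *\<^sub>R u + b *\<^sub>R J u" if A: "A \<in> F" for A
  proof -
    obtain A' where A': "A' \<in> F" "\<And>x. A (A' x) = x" using F(5)[OF A] by auto
    have A'A: "A' (A x) = x" for x using A' F(4)[OF A A'(1)] by simp
    have AW: "x \<in> W \<Longrightarrow> A x \<in> W" "x \<in> W \<Longrightarrow> A' x \<in> W" "x \<in> W \<Longrightarrow> J x \<in> W" for x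
      using W(2) A A' by (auto simp: P_def)
    have sW: "subspace W" using W(2) by (auto simp: P_def)
    have adj: "\<beta> (A x) y = \<beta> x (A' y)" "\<beta> (A' x) y = \<beta> x (A y)" for x y
      using F(2)[OF A, of x "A' y"] F(2)[OF A, of "A' x" y] A' by auto
    have adjJ: "\<beta> (J x) y = - \<beta> x (J y)" for x y
      using J(3)[of x "J y"] J(2) by (simp add: bb.minus_right)
    have linA: "linear A" "linear A'" using F(1) A A' by auto
    obtain m1 where m1: "\<And>x. x \<in> W \<Longrightarrow> A x + A' x = m1 *\<^sub>R x"
    proof -
      have "\<exists>m. \<forall>x\<in>W. A x + A' x = m *\<^sub>R x"
        by (rule scalar)
           (use A A' AW sW linA J F in \<open>auto simp: linear_compose_add subspace_add linear_add bb.add_left bb.add_right adj\<close>)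
      then show ?thesis using that by blast
    qed
    obtain m2 where m2: "\<And>x. x \<in> W \<Longrightarrow> J (A x - A' x) = m2 *\<^sub>R x"
    proof -
      have "\<exists>m. \<forall>x\<in>W. J (A x - A' x) = m *\<^sub>R x"
      proof (rule scalar)
        show "linear (\<lambda>x. J (A x - A' x))"
          using linear_compose[OF linear_compose_sub[OF linA] J(1)] by (simp add: o_def)
        show "J (A (B x) - A' (B x)) = B (J (A x - A' x))" if "B \<in> F" for B x
        proof -
          have "B (J (A x - A' x)) = J (B (A x - A' x))" using F(3)[OF that] .
          also have "B (A x - A' x) = A (B x) - A' (B x)"
            using F(4)[OF that A] F(4)[OF that A'(1)] linear_diff[OF F(1)[OF that]] by simp
          finally show ?thesis by simp
        qed
        show "J (A (J x) - A' (J x)) = J (J (A x - A' x))" for x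
          by (simp add: F(3)[OF A] F(3)[OF A'(1)] linear_diff[OF J(1)])
        show "\<beta> (J (A x - A' x)) y = \<beta> x (J (A y - A' y))" for x y
          by (simp add: adjJ bb.diff_left bb.diff_right adj linear_diff[OF J(1)]
                F(3)[OF A] F(3)[OF A'(1)])
      qed (use A A' AW sW linA J F in \<open>auto simp: subspace_diff\<close>)
      then show ?thesis using that by blast
    qed
    have "A u - A' u = - m2 *\<^sub>R J u"
    proof -
      have "J (J (A u - A' u)) = J (m2 *\<^sub>R u)" using m2[OF u(1)] by simp
      then show ?thesis by (simp add: J(2) linear_scale[OF J(1)] algebra_simps)
    qed
    then have "2 *\<^sub>R A u = m1 *\<^sub>R u + (- m2) *\<^sub>R J u"
      using m1[OF u(1)] by (simp add: scaleR_2 algebra_simps)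
    then have "(1/2) *\<^sub>R (2 *\<^sub>R A u) = (1/2) *\<^sub>R (m1 *\<^sub>R u + (- m2) *\<^sub>R J u)" by simp
    then have "A u = (m1 / 2) *\<^sub>R u + (- m2 / 2) *\<^sub>R J u"
      unfolding scaleR_add_right scaleR_scaleR by simp
    then show ?thesis by blast
  qed
  then show ?thesis using that u W by blast
qed

end


section \<open>Charts and differentiation on a Lie group\<close>

text \<open>Continuity jointly in the point and the direction is what the chain rule preserves: the
  directions fed to the outer derivative move with the point.\<close>

definition C1_at :: "('a::real_normed_vector \<Rightarrow> 'b::real_normed_vector) \<Rightarrow> 'a \<Rightarrow> bool" where
  "C1_at f x \<longleftrightarrow> (\<exists>S f'. open S \<and> x \<in> S \<and> (\<forall>y\<in>S. (f has_derivative f' y) (at y)) \<and>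
     continuous_on (S \<times> UNIV) (\<lambda>(y, v). f' y v))"

lemma C1_at_differentiable: "C1_at f x \<Longrightarrow> f differentiable (at x)"
  by (auto simp: C1_at_def differentiable_def)

lemma C1_at_isCont: "C1_at f x \<Longrightarrow> isCont f x"
  using C1_at_differentiable differentiable_imp_continuous_within by blast

lemma isCont_nhds: "isCont F x \<longleftrightarrow> (F \<longlongrightarrow> F x) (nhds x)"
  by (simp add: isCont_def tendsto_at_iff_tendsto_nhds)

lemma C1_at_eventually: "C1_at f x \<Longrightarrow> \<forall>\<^sub>F y in nhds x. C1_at f y"
  unfolding C1_at_def eventually_nhds by blast

text \<open>\<open>Ck_on\<close> gives continuity of the derivative for each fixed direction;
  expanding the direction in coordinates makes it joint.\<close>

lemma C1_atI_smooth:
  fixes f :: "'a::real_normed_vector \<Rightarrow> 'b::real_normed_vector"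
  assumes fd: "finite B" "span B = (UNIV :: 'a set)"
    and f: "smooth_on f S" and S: "open S" "x \<in> S"
  shows "C1_at f x"
proof -
  have "Ck_on (Suc 0) f S" using f by (simp add: smooth_on_def del: Ck_on.simps)
  then obtain f' where f': "\<And>x. x \<in> S \<Longrightarrow> (f has_derivative f' x) (at x)"
    "\<And>v. continuous_on S (\<lambda>x. f' x v)" by auto
  obtain C :: "'a set" and u where C: "coordinates C u" using fd_coordinates[OF fd] .
  then have u: "b \<in> C \<Longrightarrow> bounded_linear (\<lambda>v. u v b)" for b by (simp add: coordinates_def)
  have eq: "f' x v = (\<Sum>b\<in>C. u v b *\<^sub>R f' x b)" if "x \<in> S" for x v
    using coordinates_linear[OF C] f'(1)[OF that] has_derivative_linear by blast
  have "continuous_on (S \<times> UNIV) (\<lambda>(x, v). \<Sum>b\<in>C. u v b *\<^sub>R f' x b)"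
    unfolding case_prod_unfold
    by (intro continuous_on_sum continuous_on_scaleR
          bounded_linear.continuous_on[OF u] continuous_on_compose2[OF f'(2)] continuous_intros) auto
  then have "continuous_on (S \<times> UNIV) (\<lambda>(x, v). f' x v)"
    by (rule continuous_on_eq) (auto simp flip: eq)
  then show ?thesis unfolding C1_at_def using f'(1) S by blast
qed

lemma C1_at_cong:
  assumes "C1_at f x" "\<forall>\<^sub>F y in nhds x. f y = g y"
  shows "C1_at g x"
proof -
  obtain S f' where S: "open S" "x \<in> S" "\<forall>y\<in>S. (f has_derivative f' y) (at y)"
    "continuous_on (S \<times> UNIV) (\<lambda>(y, v). f' y v)"
    using assms(1) unfolding C1_at_def by blast
  obtain N where N: "open N" "x \<in> N" "\<And>y. y \<in> N \<Longrightarrow> f y = g y"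
    using assms(2) unfolding eventually_nhds by blast
  have "(g has_derivative f' y) (at y)" if "y \<in> S \<inter> N" for y
    by (rule has_derivative_transform_within_open[where s="S \<inter> N" and f=f]) (use S N that in auto)
  moreover have "continuous_on ((S \<inter> N) \<times> UNIV) (\<lambda>(y, v). f' y v)"
    by (rule continuous_on_subset[OF S(4)]) auto
  ultimately show ?thesis unfolding C1_at_def
    using S N by (intro exI[of _ "S \<inter> N"] exI[of _ f']) auto
qed

lemma C1_at_compose:
  assumes "C1_at f x" "C1_at g (f x)"
  shows "C1_at (\<lambda>y. g (f y)) x"
proof -
  obtain S f' where S: "open S" "x \<in> S" "\<And>y. y \<in> S \<Longrightarrow> (f has_derivative f' y) (at y)"
    "continuous_on (S \<times> UNIV) (\<lambda>(y, v). f' y v)"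
    using assms(1) unfolding C1_at_def by blast
  obtain T g' where T: "open T" "f x \<in> T" "\<And>y. y \<in> T \<Longrightarrow> (g has_derivative g' y) (at y)"
    "continuous_on (T \<times> UNIV) (\<lambda>(y, v). g' y v)"
    using assms(2) unfolding C1_at_def by blast
  have cf: "continuous_on S f"
    by (meson S(3) continuous_at_imp_continuous_on has_derivative_continuous)
  define N where "N = S \<inter> f -` T"
  have N: "open N" "x \<in> N"
    using continuous_open_preimage[OF cf S(1) T(1)] S T by (auto simp: N_def)
  have "((\<lambda>y. g (f y)) has_derivative (\<lambda>v. g' (f y) (f' y v))) (at y)" if "y \<in> N" for y
    by (rule has_derivative_compose[OF S(3) T(3)]) (use that in \<open>auto simp: N_def\<close>)
  moreover have "continuous_on (N \<times> UNIV) (\<lambda>(y, v). g' (f y) (f' y v))"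
  proof -
    have "continuous_on (N \<times> UNIV) (\<lambda>(y, v). f' y v)"
      by (rule continuous_on_subset[OF S(4)]) (auto simp: N_def)
    then have "continuous_on (N \<times> UNIV) (\<lambda>(y, v). (f y, f' y v))"
      unfolding case_prod_unfold
      by (intro continuous_on_Pair continuous_on_compose2[OF cf] continuous_intros) (auto simp: N_def)
    then have "continuous_on (N \<times> UNIV) (\<lambda>z. (\<lambda>(y, v). g' y v) ((\<lambda>(y, v). (f y, f' y v)) z))"
      by (rule continuous_on_compose2[OF T(4)]) (auto simp: N_def)
    then show ?thesis by (simp add: case_prod_unfold)
  qed
  ultimately show ?thesis unfolding C1_at_def using N
    by (intro exI[of _ N] exI[of _ "\<lambda>y v. g' (f y) (f' y v)"]) auto
qed

lemma C1_at_bounded_linear: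
  fixes f :: "'a::real_normed_vector \<Rightarrow> 'b::real_normed_vector"
  shows "bounded_linear f \<Longrightarrow> C1_at f x"
proof -
  assume f: "bounded_linear f"
  have "continuous_on (UNIV \<times> UNIV) (\<lambda>(y :: 'a, v). f v)"
    unfolding case_prod_unfold by (intro bounded_linear.continuous_on[OF f] continuous_on_snd continuous_on_id)
  then show ?thesis
    unfolding C1_at_def using bounded_linear_imp_has_derivative[OF f]
    by (intro exI[of _ UNIV] exI[of _ "\<lambda>_. f"]) blast
qed

lemma C1_at_const [simp]: "C1_at (\<lambda>x. k) x"
  unfolding C1_at_def
  by (intro exI[of _ UNIV] exI[of _ "\<lambda>_ _. 0"]) (auto simp: case_prod_unfold)

lemma C1_at_Pair:
  assumes "C1_at f x" "C1_at g x"
  shows "C1_at (\<lambda>y. (f y, g y)) x"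
proof -
  obtain S f' where S: "open S" "x \<in> S" "\<And>y. y \<in> S \<Longrightarrow> (f has_derivative f' y) (at y)"
    "continuous_on (S \<times> UNIV) (\<lambda>(y, v). f' y v)"
    using assms(1) unfolding C1_at_def by blast
  obtain T g' where T: "open T" "x \<in> T" "\<And>y. y \<in> T \<Longrightarrow> (g has_derivative g' y) (at y)"
    "continuous_on (T \<times> UNIV) (\<lambda>(y, v). g' y v)"
    using assms(2) unfolding C1_at_def by blast
  have "continuous_on ((S \<inter> T) \<times> UNIV) (\<lambda>(y, v). f' y v)" "continuous_on ((S \<inter> T) \<times> UNIV) (\<lambda>(y, v). g' y v)"
    by (rule continuous_on_subset[OF S(4)] continuous_on_subset[OF T(4)]; force)+
  then have "continuous_on ((S \<inter> T) \<times> UNIV) (\<lambda>(y, v). (f' y v, g' y v))"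
    unfolding case_prod_unfold by (intro continuous_on_Pair)
  moreover have "((\<lambda>y. (f y, g y)) has_derivative (\<lambda>v. (f' y v, g' y v))) (at y)" if "y \<in> S \<inter> T" for y
    using S T that by (intro has_derivative_Pair) auto
  ultimately show ?thesis unfolding C1_at_def
    using S T by (intro exI[of _ "S \<inter> T"] exI[of _ "\<lambda>y v. (f' y v, g' y v)"]) auto
qed

lemma C1_at_fst [simp]: "C1_at fst x" and C1_at_snd [simp]: "C1_at snd x"
  by (auto intro: C1_at_bounded_linear bounded_linear_fst bounded_linear_snd)

lemma C1_at_frechet_continuous:
  assumes "C1_at f x"
  shows "((\<lambda>y. frechet_derivative f (at y) v) \<longlongrightarrow> frechet_derivative f (at x) v) (nhds x)"
proof -
  obtain S f' where S: "open S" "x \<in> S" "\<And>y. y \<in> S \<Longrightarrow> (f has_derivative f' y) (at y)"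
    "continuous_on (S \<times> UNIV) (\<lambda>(y, v). f' y v)"
    using assms(1) unfolding C1_at_def by blast
  have eq: "frechet_derivative f (at y) = f' y" if "y \<in> S" for y
    using frechet_derivative_at[OF S(3)[OF that]] by simp
  have "continuous_on S (\<lambda>y. (\<lambda>(y, v). f' y v) (y, v))"
    by (rule continuous_on_compose2[OF S(4)]) (auto intro!: continuous_intros)
  then have "isCont (\<lambda>y. f' y v) x" using S(1,2) by (simp add: continuous_on_eq_continuous_at)
  then have "((\<lambda>y. f' y v) \<longlongrightarrow> f' x v) (nhds x)" unfolding isCont_nhds .
  moreover have "\<forall>\<^sub>F y in nhds x. frechet_derivative f (at y) v = f' y v"
    using S(1,2) eq unfolding eventually_nhds by auto
  ultimately show ?thesis by (subst tendsto_cong) (auto simp: eq S)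
qed

section \<open>Charts of the group\<close>

locale lie_group_chart = group G for G :: "('g::t2_space, 'm) monoid_scheme" (structure) +
  fixes \<A> :: "('g, 'e::{real_normed_vector,heine_borel}) chart set" and c :: "('g, 'e) chart"
  assumes lie: "lie_group G \<A>" and c_in: "c \<in> \<A>" and one_c: "\<one> \<in> fst c"
begin

abbreviation "p \<equiv> param c"
abbreviation "c0 \<equiv> snd c \<one>"

lemma fin_dim: obtains B :: "'e set" where "finite B" "span B = UNIV"
  using lie by (auto simp: lie_group_def)

lemma mult_cont: "continuous_on (carrier G \<times> carrier G) (\<lambda>(x, y). x \<otimes> y)"
  and inv_cont: "continuous_on (carrier G) (\<lambda>x. inv x)"
  using lie by (auto simp: lie_group_def)

lemma chart: "a \<in> \<A> \<Longrightarrow> is_chart (carrier G) a"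
  using lie by (auto simp: lie_group_def)

lemma chart_cover: "g \<in> carrier G \<Longrightarrow> \<exists>a\<in>\<A>. g \<in> fst a"
  using lie by (auto simp: lie_group_def)

lemma chart_image_open: "a \<in> \<A> \<Longrightarrow> open (snd a ` fst a)"
  using chart by (auto simp: is_chart_def)

lemma chart_param [simp]: "a \<in> \<A> \<Longrightarrow> g \<in> fst a \<Longrightarrow> param a (snd a g) = g"
  using chart[of a] by (auto simp: is_chart_def homeomorphism_def)

lemma dom_open: assumes "a \<in> \<A>" obtains S where "open S" "fst a = carrier G \<inter> S"
  using chart[OF assms] by (auto simp: is_chart_def openin_open)

lemma dom_carrier: "a \<in> \<A> \<Longrightarrow> g \<in> fst a \<Longrightarrow> g \<in> carrier G"
  using chart[of a] by (auto simp: is_chart_def openin_open)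

lemma dom_c: "g \<in> fst c \<Longrightarrow> g \<in> carrier G"
  using dom_carrier c_in by blast

lemma chart_cont: "a \<in> \<A> \<Longrightarrow> continuous_on (fst a) (snd a)"
  and param_cont: "a \<in> \<A> \<Longrightarrow> continuous_on (snd a ` fst a) (param a)"
  using chart[of a] by (auto simp: is_chart_def homeomorphism_def)

lemma p_c0 [simp]: "p c0 = \<one>" and c0_in: "c0 \<in> snd c ` fst c"
  using c_in one_c by auto

lemma tendsto_mult_G:
  assumes "(f \<longlongrightarrow> x) F" "(g \<longlongrightarrow> y) F" "\<forall>\<^sub>F z in F. f z \<in> carrier G" "\<forall>\<^sub>F z in F. g z \<in> carrier G"
    "x \<in> carrier G" "y \<in> carrier G"
  shows "((\<lambda>z. f z \<otimes> g z) \<longlongrightarrow> x \<otimes> y) F"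
proof -
  have "((\<lambda>z. (\<lambda>(x, y). x \<otimes> y) (f z, g z)) \<longlongrightarrow> (\<lambda>(x, y). x \<otimes> y) (x, y)) F"
    by (rule continuous_on_tendsto_compose[OF mult_cont tendsto_Pair[OF assms(1,2)]])
       (use assms in \<open>auto simp: eventually_conj_iff\<close>)
  then show ?thesis by simp
qed

lemma tendsto_inv_G:
  assumes "(f \<longlongrightarrow> x) F" "\<forall>\<^sub>F z in F. f z \<in> carrier G" "x \<in> carrier G"
  shows "((\<lambda>z. inv (f z)) \<longlongrightarrow> inv x) F"
  by (rule continuous_on_tendsto_compose[OF inv_cont assms(1,3,2)])

lemma eventually_in_dom:
  assumes "(f \<longlongrightarrow> g) F" "\<forall>\<^sub>F z in F. f z \<in> carrier G" "a \<in> \<A>" "g \<in> fst a"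
  shows "\<forall>\<^sub>F z in F. f z \<in> fst a"
proof -
  obtain S where S: "open S" "fst a = carrier G \<inter> S" using dom_open[OF assms(3)] .
  have "\<forall>\<^sub>F z in F. f z \<in> S" using topological_tendstoD[OF assms(1) S(1)] assms(4) S by auto
  with assms(2) show ?thesis by eventually_elim (auto simp: S)
qed

lemma tendsto_chart:
  assumes "(f \<longlongrightarrow> g) F" "\<forall>\<^sub>F z in F. f z \<in> carrier G" "a \<in> \<A>" "g \<in> fst a"
  shows "((\<lambda>z. snd a (f z)) \<longlongrightarrow> snd a g) F"
  using continuous_on_tendsto_compose[OF chart_cont[OF assms(3)] assms(1,4) eventually_in_dom[OF assms]] .

lemma tendsto_param:
  assumes "(f \<longlongrightarrow> x) F" "a \<in> \<A>" "x \<in> snd a ` fst a"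
  shows "((\<lambda>z. param a (f z)) \<longlongrightarrow> param a x) F"
  using continuous_on_tendsto_compose[OF param_cont[OF assms(2)] assms(1,3)]
    topological_tendstoD[OF assms(1) chart_image_open[OF assms(2)] assms(3)] .

lemma open_preimage_dom:
  assumes "open U" "continuous_on U f" "f ` U \<subseteq> carrier G" "a \<in> \<A>"
  shows "open {x \<in> U. f x \<in> fst a}"
proof -
  obtain S where S: "open S" "fst a = carrier G \<inter> S" using dom_open[OF assms(4)] .
  have "{x \<in> U. f x \<in> fst a} = U \<inter> f -` S" using S assms(3) by auto
  then show ?thesis using continuous_open_preimage[OF assms(2,1) S(1)] by simp
qed

lemma C1_transition:
  assumes "a \<in> \<A>" "b \<in> \<A>" "g \<in> fst a" "g \<in> fst b"
  shows "C1_at (\<lambda>x. snd b (param a x)) (snd a g)"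
proof -
  obtain B :: "'e set" where B: "finite B" "span B = UNIV" using fin_dim .
  have "open {x \<in> snd a ` fst a. param a x \<in> fst b}"
    using assms by (intro open_preimage_dom chart_image_open param_cont) (auto simp: dom_carrier)
  also have "{x \<in> snd a ` fst a. param a x \<in> fst b} = snd a ` (fst a \<inter> fst b)"
    using assms by auto
  finally show ?thesis
    using lie assms by (intro C1_atI_smooth[OF B, of _ "snd a ` (fst a \<inter> fst b)"]) (auto simp: lie_group_def)
qed

lemma C1_mult:
  assumes "a \<in> \<A>" "b \<in> \<A>" "d \<in> \<A>" "g \<in> fst a" "h \<in> fst b" "g \<otimes> h \<in> fst d"
  shows "C1_at (\<lambda>(x, y). snd d (param a x \<otimes> param b y)) (snd a g, snd b h)"
proof -
  obtain B :: "'e set" where B: "finite B" "span B = UNIV" using fin_dim .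
  obtain B2 :: "('e \<times> 'e) set" where B2: "finite B2" "span B2 = UNIV" using fd_prod[OF B] .
  define U where "U = (snd a ` fst a) \<times> (snd b ` fst b)"
  \<comment> \<open>The set on which \<open>lie_group\<close> asserts smoothness of the product is
    open, by continuity of the multiplication.\<close>
  have "open {z \<in> U. (\<lambda>(x, y). param a x \<otimes> param b y) z \<in> fst d}"
  proof (rule open_preimage_dom)
    show "open U" using assms by (auto simp: U_def intro!: open_Times chart_image_open)
    have "continuous_on U (\<lambda>z. (\<lambda>(x, y). x \<otimes> y) (param a (fst z), param b (snd z)))"
      using assms
      by (intro continuous_on_compose2[OF mult_cont] continuous_on_Pair continuous_on_compose2[OF param_cont] continuous_intros)
         (auto simp: U_def dom_carrier)
    then show "continuous_on U (\<lambda>(x, y). param a x \<otimes> param b y)" by (simp add: case_prod_unfold)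
  qed (use assms in \<open>auto simp: U_def dom_carrier\<close>)
  also have "{z \<in> U. (\<lambda>(x, y). param a x \<otimes> param b y) z \<in> fst d} =
     {(x, y). x \<in> snd a ` fst a \<and> y \<in> snd b ` fst b \<and> param a x \<otimes> param b y \<in> fst d}"
    by (auto simp: U_def)
  finally have op: "open {(x, y). x \<in> snd a ` fst a \<and> y \<in> snd b ` fst b \<and> param a x \<otimes> param b y \<in> fst d}" .
  have "smooth_on (\<lambda>(x, y). snd d (param a x \<otimes> param b y))
     {(x, y). x \<in> snd a ` fst a \<and> y \<in> snd b ` fst b \<and> param a x \<otimes> param b y \<in> fst d}"
    using lie assms(1-3) unfolding lie_group_def by blast
  from C1_atI_smooth[OF B2 this op] show ?thesis
    using assms by simp
qed

lemma C1_inv: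
  assumes "a \<in> \<A>" "d \<in> \<A>" "g \<in> fst a" "inv g \<in> fst d"
  shows "C1_at (\<lambda>x. snd d (inv (param a x))) (snd a g)"
proof -
  obtain B :: "'e set" where B: "finite B" "span B = UNIV" using fin_dim .
  have "open {x \<in> snd a ` fst a. inv (param a x) \<in> fst d}"
    using assms by (intro open_preimage_dom chart_image_open continuous_on_compose2[OF inv_cont] param_cont)
      (auto simp: dom_carrier)
  then show ?thesis
    using lie assms by (intro C1_atI_smooth[OF B, of _ "{x \<in> snd a ` fst a. inv (param a x) \<in> fst d}"]) (auto simp: lie_group_def)
qed

section \<open>C^1 maps into the group\<close>

text \<open>The group lies in a larger topological type, and values are required to be in the
  carrier only near \<open>x\<close>. Continuity is a separate condition because a chart says
  nothing about values outside its domain.\<close>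

definition G_C1_at :: "('x::real_normed_vector \<Rightarrow> 'g) \<Rightarrow> 'x \<Rightarrow> bool" where
  "G_C1_at F x \<longleftrightarrow> (\<forall>\<^sub>F y in nhds x. F y \<in> carrier G) \<and> isCont F x \<and>
     (\<forall>a\<in>\<A>. F x \<in> fst a \<longrightarrow> C1_at (\<lambda>y. snd a (F y)) x)"

lemma G_C1_at_carrier: "G_C1_at F x \<Longrightarrow> F x \<in> carrier G"
  unfolding G_C1_at_def using eventually_nhds_x_imp_x by blast

lemma G_C1_at_D:
  assumes "G_C1_at F x"
  shows "(F \<longlongrightarrow> F x) (nhds x)" "\<forall>\<^sub>F y in nhds x. F y \<in> carrier G"
    "a \<in> \<A> \<Longrightarrow> F x \<in> fst a \<Longrightarrow> C1_at (\<lambda>y. snd a (F y)) x"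
    "a \<in> \<A> \<Longrightarrow> F x \<in> fst a \<Longrightarrow> \<forall>\<^sub>F y in nhds x. F y \<in> fst a"
proof -
  show 1: "(F \<longlongrightarrow> F x) (nhds x)" "\<forall>\<^sub>F y in nhds x. F y \<in> carrier G"
    using assms by (simp_all add: G_C1_at_def isCont_nhds)
  show "a \<in> \<A> \<Longrightarrow> F x \<in> fst a \<Longrightarrow> C1_at (\<lambda>y. snd a (F y)) x"
    using assms unfolding G_C1_at_def by blast
  show "a \<in> \<A> \<Longrightarrow> F x \<in> fst a \<Longrightarrow> \<forall>\<^sub>F y in nhds x. F y \<in> fst a"
    using eventually_in_dom[OF 1] by blast
qed

lemma G_C1_at_const: "g \<in> carrier G \<Longrightarrow> G_C1_at (\<lambda>_. g) x"
  by (auto simp: G_C1_at_def)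

lemma G_C1_at_param:
  assumes "a \<in> \<A>" "x \<in> snd a ` fst a"
  shows "G_C1_at (param a) x"
proof -
  obtain g where g: "g \<in> fst a" "x = snd a g" using assms by auto
  have "\<forall>\<^sub>F y in nhds x. y \<in> snd a ` fst a"
    using assms chart_image_open eventually_nhds by blast
  then have "\<forall>\<^sub>F y in nhds x. param a y \<in> carrier G"
    by eventually_elim (use assms in \<open>auto intro: dom_carrier\<close>)
  moreover have "isCont (param a) x"
    unfolding isCont_nhds using assms by (intro tendsto_param filterlim_ident)
  ultimately show ?thesis
    using assms g C1_transition by (auto simp: G_C1_at_def)
qed

lemma G_C1_at_compose:
  assumes "C1_at f x" "G_C1_at F (f x)"
  shows "G_C1_at (\<lambda>y. F (f y)) x"
proof -
  have f: "(f \<longlongrightarrow> f x) (nhds x)" using C1_at_isCont[OF assms(1)] by (simp add: isCont_nhds)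
  have "\<forall>\<^sub>F y in nhds x. F (f y) \<in> carrier G"
    using filterlim_iff[THEN iffD1, OF f] G_C1_at_D(2)[OF assms(2)] by blast
  moreover have "((\<lambda>y. F (f y)) \<longlongrightarrow> F (f x)) (nhds x)"
    using filterlim_compose[OF G_C1_at_D(1)[OF assms(2)] f] by simp
  ultimately show ?thesis
    using assms by (auto simp: G_C1_at_def isCont_nhds intro: C1_at_compose)
qed

lemma G_C1_at_mult:
  assumes F: "G_C1_at F x" and F': "G_C1_at F' x"
  shows "G_C1_at (\<lambda>y. F y \<otimes> F' y) x"
proof -
  note carr = G_C1_at_carrier[OF F] G_C1_at_carrier[OF F']
  have "C1_at (\<lambda>y. snd d (F y \<otimes> F' y)) x" if d: "d \<in> \<A>" "F x \<otimes> F' x \<in> fst d" for d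
  proof -
    obtain a b where ab: "a \<in> \<A>" "F x \<in> fst a" "b \<in> \<A>" "F' x \<in> fst b"
      using chart_cover carr by meson
    have "C1_at (\<lambda>y. (\<lambda>(x, y). snd d (param a x \<otimes> param b y)) (snd a (F y), snd b (F' y))) x"
      by (rule C1_at_compose[OF C1_at_Pair]) (use F F' ab d in \<open>auto intro: G_C1_at_D C1_mult\<close>)
    then show ?thesis
    proof (rule C1_at_cong)
      show "\<forall>\<^sub>F y in nhds x. (\<lambda>(x, y). snd d (param a x \<otimes> param b y)) (snd a (F y), snd b (F' y)) = snd d (F y \<otimes> F' y)"
        using G_C1_at_D(4)[OF F ab(1,2)] G_C1_at_D(4)[OF F' ab(3,4)]
        by eventually_elim (use ab in auto)
    qed
  qed
  moreover have "\<forall>\<^sub>F y in nhds x. F y \<otimes> F' y \<in> carrier G"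
    using G_C1_at_D(2)[OF F] G_C1_at_D(2)[OF F'] by eventually_elim auto
  moreover have "((\<lambda>y. F y \<otimes> F' y) \<longlongrightarrow> F x \<otimes> F' x) (nhds x)"
    using F F' carr by (intro tendsto_mult_G) (auto dest: G_C1_at_D)
  ultimately show ?thesis by (auto simp: G_C1_at_def isCont_nhds)
qed

lemma G_C1_at_inv:
  assumes F: "G_C1_at F x"
  shows "G_C1_at (\<lambda>y. inv (F y)) x"
proof -
  note carr = G_C1_at_carrier[OF F]
  have "C1_at (\<lambda>y. snd d (inv (F y))) x" if d: "d \<in> \<A>" "inv (F x) \<in> fst d" for d
  proof -
    obtain a where ab: "a \<in> \<A>" "F x \<in> fst a"
      using chart_cover carr by meson
    have "C1_at (\<lambda>y. (\<lambda>x. snd d (inv (param a x))) (snd a (F y))) x"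
      by (rule C1_at_compose) (use F ab d in \<open>auto intro: G_C1_at_D C1_inv\<close>)
    then show ?thesis
    proof (rule C1_at_cong)
      show "\<forall>\<^sub>F y in nhds x. (\<lambda>x. snd d (inv (param a x))) (snd a (F y)) = snd d (inv (F y))"
        using G_C1_at_D(4)[OF F ab] by eventually_elim (use ab in auto)
    qed
  qed
  moreover have "\<forall>\<^sub>F y in nhds x. inv (F y) \<in> carrier G"
    using G_C1_at_D(2)[OF F] by eventually_elim auto
  moreover have "((\<lambda>y. inv (F y)) \<longlongrightarrow> inv (F x)) (nhds x)"
    using F carr by (intro tendsto_inv_G) (auto dest: G_C1_at_D)
  ultimately show ?thesis by (auto simp: G_C1_at_def isCont_nhds)
qed

section \<open>Derivatives at the identity\<close>

text \<open>The derivative at a point that is sent to the identity, read in \<open>c\<close> and so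
  with values in the Lie algebra. Maps with other values are translated to the identity before
  differentiating.\<close>

definition G_deriv :: "('x::real_normed_vector \<Rightarrow> 'g) \<Rightarrow> 'x \<Rightarrow> ('x \<Rightarrow> 'e) \<Rightarrow> bool" where
  "G_deriv F x A \<longleftrightarrow> F x = \<one> \<and> (\<forall>\<^sub>F y in nhds x. F y \<in> carrier G) \<and> isCont F x \<and>
     ((\<lambda>y. snd c (F y)) has_derivative A) (at x)"

lemma G_deriv_D:
  assumes "G_deriv F x A"
  shows "F x = \<one>" "(F \<longlongrightarrow> \<one>) (nhds x)" "\<forall>\<^sub>F y in nhds x. F y \<in> carrier G"
    "((\<lambda>y. snd c (F y)) has_derivative A) (at x)"
    "\<forall>\<^sub>F y in nhds x. F y \<in> fst c"
proof -
  show *: "F x = \<one>" "(F \<longlongrightarrow> \<one>) (nhds x)" "\<forall>\<^sub>F y in nhds x. F y \<in> carrier G"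
    "((\<lambda>y. snd c (F y)) has_derivative A) (at x)"
    using assms by (auto simp: G_deriv_def isCont_nhds)
  show "\<forall>\<^sub>F y in nhds x. F y \<in> fst c"
    using eventually_in_dom[OF *(2,3) c_in one_c] .
qed

lemma G_deriv_p: "G_deriv p c0 (\<lambda>h. h)"
proof -
  have ev: "\<forall>\<^sub>F y in nhds c0. y \<in> snd c ` fst c"
    using c_in c0_in chart_image_open eventually_nhds by blast
  have "((\<lambda>y. snd c (p y)) has_derivative (\<lambda>h. h)) (at c0)"
    using c_in c0_in chart_image_open
    by (intro has_derivative_transform_within_open[OF has_derivative_ident, of "snd c ` fst c"]) auto
  then show ?thesis
    using G_C1_at_param[OF c_in c0_in] by (auto simp: G_deriv_def G_C1_at_def)
qed

lemma G_deriv_chain: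
  assumes F: "G_deriv F x A" and g: "((\<lambda>y. g (p y)) has_derivative D) (at c0)"
  shows "((\<lambda>y. g (F y)) has_derivative (\<lambda>h. D (A h))) (at x)"
proof -
  have "((\<lambda>y. g (p (snd c (F y)))) has_derivative (\<lambda>h. D (A h))) (at x)"
    using has_derivative_compose[OF G_deriv_D(4)[OF F], of "\<lambda>y. g (p y)" D] g G_deriv_D(1)[OF F] by simp
  moreover obtain N where "open N" "x \<in> N" "\<And>y. y \<in> N \<Longrightarrow> F y \<in> fst c"
    using G_deriv_D(5)[OF F] unfolding eventually_nhds by blast
  ultimately show ?thesis
    using c_in by (elim has_derivative_transform_within_open) auto
qed

text \<open>The derivative of the multiplication at the identity restricts to the identity map in
  each variable, the other one being held at the neutral element. By linearity it is
  addition.\<close>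

lemma G_deriv_mult:
  assumes F: "G_deriv F x A" and F': "G_deriv F' x A'"
  shows "G_deriv (\<lambda>y. F y \<otimes> F' y) x (\<lambda>h. A h + A' h)"
proof -
  let ?m = "\<lambda>(x, y). snd c (p x \<otimes> p y)"
  have "C1_at ?m (c0, c0)" using C1_mult[of c c c \<one> \<one>] c_in one_c by auto
  then obtain M where M: "(?m has_derivative M) (at (c0, c0))"
    using C1_at_differentiable by (auto simp: differentiable_def)
  interpret M: bounded_linear M using M has_derivative_bounded_linear by blast
  have carr: "\<forall>\<^sub>F y in nhds c0. p y \<in> carrier G" using G_deriv_D(3)[OF G_deriv_p] .
  have dom: "\<forall>\<^sub>F y in nhds c0. y \<in> snd c ` fst c"
    using c_in c0_in chart_image_open eventually_nhds by blast
  have ident: "((\<lambda>x. x) has_derivative D) (at c0) \<Longrightarrow> D = (\<lambda>h. h)" for D :: "'e \<Rightarrow> 'e"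
    using has_derivative_unique has_derivative_ident by blast
  \<comment> \<open>A map that fixes every point of the chart image has the identity as its
    derivative.\<close>
  have tr: "(f has_derivative D) (at c0) \<Longrightarrow> (\<And>x. x \<in> snd c ` fst c \<Longrightarrow> f x = x) \<Longrightarrow> D = (\<lambda>h. h)" for f D
    by (rule ident, rule has_derivative_transform_within_open[where s="snd c ` fst c" and f=f])
       (use c_in c0_in chart_image_open in auto)
  have "((\<lambda>x. ?m (x, c0)) has_derivative (\<lambda>h. M (h, 0))) (at c0)"
    by (rule has_derivative_compose[where f="\<lambda>x. (x, c0)", OF _ M]) (auto intro!: derivative_eq_intros)
  then have M1: "(\<lambda>h. M (h, 0)) = (\<lambda>h. h)"
    by (rule tr) (use c_in dom_c in auto)
  have "((\<lambda>x. ?m (c0, x)) has_derivative (\<lambda>h. M (0, h))) (at c0)"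
    by (rule has_derivative_compose[where f="\<lambda>x. (c0, x)", OF _ M]) (auto intro!: derivative_eq_intros)
  then have M2: "(\<lambda>h. M (0, h)) = (\<lambda>h. h)"
    by (rule tr) (use c_in dom_c in auto)
  have MM: "M (h, k) = h + k" for h k
    using M.add[of "(h, 0)" "(0, k)"] fun_cong[OF M1, of h] fun_cong[OF M2, of k] by simp
  have "((\<lambda>y. ?m (snd c (F y), snd c (F' y))) has_derivative (\<lambda>h. M (A h, A' h))) (at x)"
    by (rule has_derivative_compose[OF has_derivative_Pair[OF G_deriv_D(4)[OF F] G_deriv_D(4)[OF F']]])
       (use M G_deriv_D(1)[OF F] G_deriv_D(1)[OF F'] in simp)
  moreover obtain N where "open N" "x \<in> N" "\<And>y. y \<in> N \<Longrightarrow> F y \<in> fst c \<and> F' y \<in> fst c"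
    using eventually_conj[OF G_deriv_D(5)[OF F] G_deriv_D(5)[OF F']] unfolding eventually_nhds by blast
  ultimately have "((\<lambda>y. snd c (F y \<otimes> F' y)) has_derivative (\<lambda>h. M (A h, A' h))) (at x)"
    using c_in by (elim has_derivative_transform_within_open) auto
  moreover have "((\<lambda>y. F y \<otimes> F' y) \<longlongrightarrow> \<one> \<otimes> \<one>) (nhds x)"
    using F F' by (intro tendsto_mult_G) (auto dest: G_deriv_D)
  moreover have "\<forall>\<^sub>F y in nhds x. F y \<otimes> F' y \<in> carrier G"
    using G_deriv_D(3)[OF F] G_deriv_D(3)[OF F'] by eventually_elim auto
  ultimately show ?thesis
    using G_deriv_D(1)[OF F] G_deriv_D(1)[OF F'] by (auto simp: G_deriv_def MM isCont_nhds)
qed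

lemma G_deriv_transform:
  assumes "G_deriv F x A" "\<forall>\<^sub>F y in nhds x. F y = F' y"
  shows "G_deriv F' x A"
proof -
  obtain N where N: "open N" "x \<in> N" "\<And>y. y \<in> N \<Longrightarrow> F y = F' y"
    using assms(2) unfolding eventually_nhds by blast
  have "F' x = \<one>" using N G_deriv_D(1)[OF assms(1)] by metis
  moreover have "(F' \<longlongrightarrow> \<one>) (nhds x)"
    using G_deriv_D(2)[OF assms(1)] assms(2) tendsto_cong by blast
  moreover have "\<forall>\<^sub>F y in nhds x. F' y \<in> carrier G"
    using G_deriv_D(3)[OF assms(1)] assms(2) by eventually_elim auto
  moreover have "((\<lambda>y. snd c (F' y)) has_derivative A) (at x)"
    by (rule has_derivative_transform_within_open[OF G_deriv_D(4)[OF assms(1)] N(1,2)]) (auto simp: N)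
  ultimately show ?thesis by (auto simp: G_deriv_def isCont_nhds)
qed

lemma G_deriv_unique: "G_deriv F x A \<Longrightarrow> G_deriv F x B \<Longrightarrow> A = B"
  unfolding G_deriv_def using has_derivative_unique by blast

lemma G_deriv_compose:
  assumes F: "G_deriv F x A" and H: "G_deriv H c0 D"
  shows "G_deriv (\<lambda>y. H (snd c (F y))) x (\<lambda>h. D (A h))"
proof -
  have t: "((\<lambda>y. snd c (F y)) \<longlongrightarrow> c0) (nhds x)"
    using tendsto_chart[OF G_deriv_D(2,3)[OF F] c_in one_c] .
  have "((\<lambda>y. snd c (H (snd c (F y)))) has_derivative (\<lambda>h. D (A h))) (at x)"
    using has_derivative_compose[OF G_deriv_D(4)[OF F], of "\<lambda>y. snd c (H y)" D] G_deriv_D(4)[OF H] G_deriv_D(1)[OF F] by simp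
  moreover have "((\<lambda>y. H (snd c (F y))) \<longlongrightarrow> \<one>) (nhds x)"
    using filterlim_compose[OF G_deriv_D(2)[OF H] t] .
  moreover have "\<forall>\<^sub>F y in nhds x. H (snd c (F y)) \<in> carrier G"
    using filterlim_iff[THEN iffD1, OF t] G_deriv_D(3)[OF H] by blast
  ultimately show ?thesis
    using G_deriv_D(1)[OF F] G_deriv_D(1)[OF H] by (auto simp: G_deriv_def isCont_nhds)
qed

lemma G_deriv_C1:
  assumes "G_C1_at F x" "F x = \<one>"
  obtains A where "G_deriv F x A"
proof -
  have "(\<lambda>y. snd c (F y)) differentiable (at x)"
    using G_C1_at_D(3)[OF assms(1) c_in] assms(2) one_c C1_at_differentiable by auto
  then show ?thesis
    using that assms by (auto simp: G_deriv_def differentiable_def G_C1_at_def)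
qed

lemma G_deriv_const: "G_deriv (\<lambda>_. \<one>) x (\<lambda>_. 0)"
  by (auto simp: G_deriv_def)

text \<open>Smoothness of inversion gives some derivative \<open>I\<close>; differentiating
  \<open>F y \<otimes> inv (F y) = \<one>\<close> identifies it.\<close>

lemma G_deriv_inv:
  assumes F: "G_deriv F x A"
  shows "G_deriv (\<lambda>y. inv (F y)) x (\<lambda>h. - A h)"
proof -
  obtain I where I: "G_deriv (\<lambda>y. inv (p y)) c0 I"
    using G_deriv_C1[OF G_C1_at_inv[OF G_C1_at_param[OF c_in c0_in]]] by auto
  have "G_deriv (\<lambda>y. inv (p (snd c (F y)))) x (\<lambda>h. I (A h))"
    using G_deriv_compose[OF F I] .
  then have *: "G_deriv (\<lambda>y. inv (F y)) x (\<lambda>h. I (A h))"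
  proof (rule G_deriv_transform)
    show "\<forall>\<^sub>F y in nhds x. inv p (snd c (F y)) = inv F y"
      using G_deriv_D(5)[OF F] by eventually_elim (use c_in in auto)
  qed
  have "G_deriv (\<lambda>y. F y \<otimes> inv (F y)) x (\<lambda>h. A h + I (A h))"
    using G_deriv_mult[OF F *] .
  then have "G_deriv (\<lambda>y. \<one>) x (\<lambda>h. A h + I (A h))"
  proof (rule G_deriv_transform)
    show "\<forall>\<^sub>F y in nhds x. F y \<otimes> inv (F y) = \<one>"
      using G_deriv_D(3)[OF F] by eventually_elim auto
  qed
  from fun_cong[OF G_deriv_unique[OF this G_deriv_const]] have "A h + I (A h) = 0" for h by simp
  then have "I (A h) = - A h" for h by (simp add: add_eq_0_iff)
  then show ?thesis using * by simp
qed

section \<open>The adjoint representation\<close>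

lemma G_deriv_conj_p:
  assumes g: "g \<in> carrier G"
  shows "G_deriv (\<lambda>x. g \<otimes> p x \<otimes> inv g) c0 (Ad G c g)"
proof -
  have "G_C1_at (\<lambda>x. g \<otimes> p x \<otimes> inv g) c0"
    using g by (intro G_C1_at_mult G_C1_at_const G_C1_at_param c_in c0_in) auto
  then obtain A where A: "G_deriv (\<lambda>x. g \<otimes> p x \<otimes> inv g) c0 A"
    by (rule G_deriv_C1) (use g in simp)
  then have "A = Ad G c g"
    unfolding Ad_def using frechet_derivative_at[OF G_deriv_D(4)[OF A]] by simp
  then show ?thesis using A by simp
qed

lemma G_deriv_conj:
  assumes F: "G_deriv F x A" and g: "g \<in> carrier G"
  shows "G_deriv (\<lambda>y. g \<otimes> F y \<otimes> inv g) x (\<lambda>h. Ad G c g (A h))"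
  using G_deriv_compose[OF F G_deriv_conj_p[OF g]]
proof (rule G_deriv_transform)
  show "\<forall>\<^sub>F y in nhds x. g \<otimes> p (snd c (F y)) \<otimes> inv g = g \<otimes> F y \<otimes> inv g"
    using G_deriv_D(5)[OF F] by eventually_elim (use c_in in auto)
qed

lemma Ad_linear: "g \<in> carrier G \<Longrightarrow> bounded_linear (Ad G c g)"
  using G_deriv_conj_p has_derivative_bounded_linear by (auto simp: G_deriv_def)

lemma Ad_mult:
  assumes g: "g \<in> carrier G" and h: "h \<in> carrier G"
  shows "Ad G c (g \<otimes> h) X = Ad G c g (Ad G c h X)"
proof -
  have "G_deriv (\<lambda>x. g \<otimes> (h \<otimes> p x \<otimes> inv h) \<otimes> inv g) c0 (\<lambda>X. Ad G c g (Ad G c h X))"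
    using G_deriv_conj[OF G_deriv_conj_p[OF h] g] .
  then have "G_deriv (\<lambda>x. (g \<otimes> h) \<otimes> p x \<otimes> inv (g \<otimes> h)) c0 (\<lambda>X. Ad G c g (Ad G c h X))"
  proof (rule G_deriv_transform)
    show "\<forall>\<^sub>F y in nhds c0. g \<otimes> (h \<otimes> p y \<otimes> inv h) \<otimes> inv g = (g \<otimes> h) \<otimes> p y \<otimes> inv (g \<otimes> h)"
      using G_deriv_D(3)[OF G_deriv_p] by eventually_elim (use g h in \<open>simp add: m_assoc inv_mult_group\<close>)
  qed
  from fun_cong[OF G_deriv_unique[OF this G_deriv_conj_p[OF m_closed[OF g h]]]] show ?thesis by simp
qed

lemma Ad_one: "Ad G c \<one> X = X"
proof -
  have "G_deriv p c0 (Ad G c \<one>)"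
    using G_deriv_conj_p[OF one_closed]
  proof (rule G_deriv_transform)
    show "\<forall>\<^sub>F y in nhds c0. \<one> \<otimes> p y \<otimes> inv \<one> = p y"
      using G_deriv_D(3)[OF G_deriv_p] by eventually_elim simp
  qed
  from fun_cong[OF G_deriv_unique[OF this G_deriv_p]] show ?thesis by simp
qed

text \<open>\<open>Ad G c g X\<close> is a partial derivative of conjugation as a function of both
  the conjugating and the conjugated element, which is C^1 in charts at \<open>g\<close> and at the
  identity.\<close>

lemma Ad_cont: "continuous_on (carrier G) (\<lambda>g. Ad G c g X)"
  unfolding continuous_on_def
proof
  fix g assume g: "g \<in> carrier G"
  obtain a where a: "a \<in> \<A>" "g \<in> fst a" using chart_cover[OF g] by auto
  let ?F = "\<lambda>z. param a (fst z) \<otimes> p (snd z) \<otimes> inv (param a (fst z))"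
  have 1: "G_C1_at (\<lambda>z. param a (fst z)) (snd a g, c0)"
    by (rule G_C1_at_compose[OF C1_at_fst G_C1_at_param]) (use a in auto)
  have 2: "G_C1_at (\<lambda>z. p (snd z)) (snd a g, c0)"
    by (rule G_C1_at_compose[OF C1_at_snd G_C1_at_param]) (use c_in c0_in in auto)
  have "G_C1_at ?F (snd a g, c0)"
    by (intro G_C1_at_mult G_C1_at_inv 1 2)
  then have C1: "C1_at (\<lambda>z. snd c (?F z)) (snd a g, c0)"
    by (rule G_C1_at_D(3)[OF _ c_in]) (use a g one_c in auto)
  \<comment> \<open>In the direction \<open>(0, X)\<close> only the conjugated element
    moves.\<close>
  have Ad: "frechet_derivative (\<lambda>z. snd c (?F z)) (at (y, c0)) (0, X) = Ad G c (param a y) X"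
    if y: "y \<in> snd a ` fst a" and d: "C1_at (\<lambda>z. snd c (?F z)) (y, c0)" for y
  proof -
    have "((\<lambda>z. snd c (?F z)) has_derivative frechet_derivative (\<lambda>z. snd c (?F z)) (at (y, c0))) (at (y, c0))"
      using C1_at_differentiable[OF d] frechet_derivative_works by blast
    from has_derivative_compose[OF has_derivative_Pair[OF has_derivative_const has_derivative_ident] this]
    have "((\<lambda>x. snd c (?F (y, x))) has_derivative (\<lambda>h. frechet_derivative (\<lambda>z. snd c (?F z)) (at (y, c0)) (0, h))) (at c0)" .
    then have *: "((\<lambda>x. snd c (param a y \<otimes> p x \<otimes> inv (param a y))) has_derivative
        (\<lambda>h. frechet_derivative (\<lambda>z. snd c (?F z)) (at (y, c0)) (0, h))) (at c0)" by simp
    have "param a y \<in> carrier G" using y a dom_carrier[OF a(1)] by auto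
    from fun_cong[OF has_derivative_unique[OF * G_deriv_D(4)[OF G_deriv_conj_p[OF this]]]]
    show ?thesis .
  qed
  have evc: "\<forall>\<^sub>F h in at g within carrier G. h \<in> carrier G"
    by (simp add: eventually_at_filter)
  have lim: "((\<lambda>h. (snd a h, c0)) \<longlongrightarrow> (snd a g, c0)) (at g within carrier G)"
    by (rule tendsto_Pair[OF tendsto_chart[OF tendsto_ident_at evc a] tendsto_const])
  have ev: "\<forall>\<^sub>F h in at g within carrier G. h \<in> fst a"
    by (rule eventually_in_dom[OF tendsto_ident_at evc a])
  have ev2: "\<forall>\<^sub>F h in at g within carrier G. C1_at (\<lambda>z. snd c (?F z)) (snd a h, c0)"
    using filterlim_iff[THEN iffD1, OF lim] C1_at_eventually[OF C1] by blast
  have "((\<lambda>h. frechet_derivative (\<lambda>z. snd c (?F z)) (at (snd a h, c0)) (0, X)) \<longlongrightarrow>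
      frechet_derivative (\<lambda>z. snd c (?F z)) (at (snd a g, c0)) (0, X)) (at g within carrier G)"
    using filterlim_compose[OF C1_at_frechet_continuous[OF C1] lim] .
  moreover have "frechet_derivative (\<lambda>z. snd c (?F z)) (at (snd a g, c0)) (0, X) = Ad G c g X"
    using Ad[OF _ C1] a by auto
  moreover have "\<forall>\<^sub>F h in at g within carrier G. frechet_derivative (\<lambda>z. snd c (?F z)) (at (snd a h, c0)) (0, X) = Ad G c h X"
    using ev ev2 by eventually_elim (use a Ad in auto)
  ultimately show "((\<lambda>g. Ad G c g X) \<longlongrightarrow> Ad G c g X) (at g within carrier G)"
    using Lim_transform_eventually by force
qed

lemma differentiable_translate:
  assumes g: "g \<in> carrier G" and h: "h \<in> carrier G" and a: "a \<in> \<A>" "g \<otimes> h \<in> fst a"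
  shows "(\<lambda>x. snd a (g \<otimes> p x \<otimes> h)) differentiable (at c0)"
proof -
  have "G_C1_at (\<lambda>x. g \<otimes> p x \<otimes> h) c0"
    using g h by (intro G_C1_at_mult G_C1_at_const G_C1_at_param c_in c0_in)
  then have "C1_at (\<lambda>x. snd a (g \<otimes> p x \<otimes> h)) c0"
    by (rule G_C1_at_D(3)) (use g h a in auto)
  then show ?thesis by (rule C1_at_differentiable)
qed

text \<open>Left translation carries every point to the identity, so the hypothesis makes all
  derivatives vanish. Then \<open>F\<close> is constant on translates of a coordinate ball, hence on
  the connected group.\<close>

lemma zero_derivative_constant:
  fixes F :: "'g \<Rightarrow> 'b::real_normed_vector"
  assumes conn: "connected (carrier G)"
    and d: "\<And>g. g \<in> carrier G \<Longrightarrow> ((\<lambda>x. F (g \<otimes> p x)) has_derivative (\<lambda>_. 0)) (at c0)"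
    and gh: "g \<in> carrier G" "h \<in> carrier G"
  shows "F g = F h"
proof (rule connected_local_const[OF conn gh], rule ballI)
  fix g assume g: "g \<in> carrier G"
  obtain r where r: "r > 0" "ball c0 r \<subseteq> snd c ` fst c"
    using chart_image_open[OF c_in] c0_in open_contains_ball by blast
  have "((\<lambda>x. F (g \<otimes> p x)) has_derivative (\<lambda>_. 0)) (at y within ball c0 r)" if y: "y \<in> ball c0 r" for y
  proof -
    have py: "p y \<in> carrier G" using r y c_in dom_c by auto
    \<comment> \<open>\<open>p x\<close> is \<open>p y\<close> times an element that is the identity
      at \<open>x = y\<close>, so that the hypothesis at \<open>g \<otimes> p y\<close> gives the
      derivative at \<open>y\<close>.\<close>
    have "G_C1_at (\<lambda>x. inv (p y) \<otimes> p x) y"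
      using py r y by (intro G_C1_at_mult G_C1_at_const G_C1_at_param c_in) auto
    then obtain A where A: "G_deriv (\<lambda>x. inv (p y) \<otimes> p x) y A"
      by (rule G_deriv_C1) (use py in auto)
    have "((\<lambda>x. F ((g \<otimes> p y) \<otimes> (inv (p y) \<otimes> p x))) has_derivative (\<lambda>_. 0)) (at y)"
      using G_deriv_chain[OF A, of "\<lambda>k. F ((g \<otimes> p y) \<otimes> k)" "\<lambda>_. 0"] d[of "g \<otimes> p y"] g py by simp
    then have "((\<lambda>x. F (g \<otimes> p x)) has_derivative (\<lambda>_. 0)) (at y)"
    proof (rule has_derivative_transform_within_open[OF _ open_ball y])
      fix x assume x: "x \<in> ball c0 r"
      then have "p x \<in> carrier G" using r c_in dom_c by auto
      then have "(g \<otimes> p y) \<otimes> (inv (p y) \<otimes> p x) = g \<otimes> p x"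
        using g py by (metis inv_closed inv_solve_left m_assoc m_closed)
      then show "F (g \<otimes> p y \<otimes> (inv p y \<otimes> p x)) = F (g \<otimes> p x)" by simp
    qed
    then show ?thesis by (rule has_derivative_at_withinI)
  qed
  from has_derivative_zero_constant[OF convex_ball this]
  obtain k where k: "\<And>x. x \<in> ball c0 r \<Longrightarrow> F (g \<otimes> p x) = k" by blast
  then have "F g = k" using r g k[of c0] by simp
  have "((\<lambda>h. inv g \<otimes> h) \<longlongrightarrow> inv g \<otimes> g) (at g within carrier G)"
    using g by (intro tendsto_mult_G tendsto_const tendsto_ident_at) (auto simp: eventually_at_filter)
  then have lim: "((\<lambda>h. inv g \<otimes> h) \<longlongrightarrow> \<one>) (at g within carrier G)" using g by simp
  have carr: "\<forall>\<^sub>F h in at g within carrier G. inv g \<otimes> h \<in> carrier G"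
    using g by (auto simp: eventually_at_filter)
  have carr2: "\<forall>\<^sub>F h in at g within carrier G. h \<in> carrier G"
    using g by (auto simp: eventually_at_filter)
  have "\<forall>\<^sub>F h in at g within carrier G. snd c (inv g \<otimes> h) \<in> ball c0 r"
    using topological_tendstoD[OF tendsto_chart[OF lim carr c_in one_c] open_ball, of c0 r] r by auto
  then show "\<forall>\<^sub>F h in at g within carrier G. F g = F h"
    using eventually_in_dom[OF lim carr c_in one_c] carr2
  proof eventually_elim
    case (elim h)
    then have "F (g \<otimes> p (snd c (inv g \<otimes> h))) = k" using k by blast
    moreover have "g \<otimes> p (snd c (inv g \<otimes> h)) = h"
      using elim c_in g by (metis chart_param inv_closed inv_solve_left m_closed)
    ultimately show ?case using \<open>F g = k\<close> by simp
  qed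
qed

end


section \<open>One-parameter subgroups\<close>

text \<open>Tychonoff's theorem yields a cluster point in the product of copies of \<open>K\<close>.
  The index set may be uncountable, where a convergent subsequence need not exist; convergence is
  therefore along a filter finer than \<open>sequentially\<close>.\<close>

lemma pointwise_cluster_filter:
  fixes \<Gamma> :: "nat \<Rightarrow> 'i \<Rightarrow> 'b::topological_space"
  assumes K: "compact K" "\<And>n t. \<Gamma> n t \<in> K"
  obtains F \<gamma> where "F \<noteq> bot" "F \<le> sequentially" "\<And>t. \<gamma> t \<in> K" "\<And>t. ((\<lambda>n. \<Gamma> n t) \<longlongrightarrow> \<gamma> t) F"
proof -
  have "compactin (product_topology (\<lambda>_. euclidean) UNIV) (PiE UNIV (\<lambda>_::'i. K))"
    using K(1) by (simp add: compactin_PiE)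
  then have comp: "compact (PiE UNIV (\<lambda>_::'i. K))" by (simp add: euclidean_product_topology)
  have "\<forall>\<^sub>F f in filtermap \<Gamma> sequentially. f \<in> PiE UNIV (\<lambda>_::'i. K)"
    using K(2) by (simp add: eventually_filtermap PiE_iff)
  then obtain \<gamma> where \<gamma>: "\<gamma> \<in> PiE UNIV (\<lambda>_::'i. K)" "inf (nhds \<gamma>) (filtermap \<Gamma> sequentially) \<noteq> bot"
    using comp[unfolded compact_filter, rule_format, of "filtermap \<Gamma> sequentially"]
    by (auto simp: filtermap_bot_iff)
  \<comment> \<open>The neighbourhoods of the cluster point, pulled back to the indices; clustering
    makes the filter proper.\<close>
  define F where "F = inf sequentially (filtercomap \<Gamma> (nhds \<gamma>))"
  have "F \<noteq> bot"
  proof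
    assume "F = bot"
    then have "eventually (\<lambda>_. False) F" by simp
    then obtain P Q where P: "eventually P sequentially" and Q: "eventually Q (filtercomap \<Gamma> (nhds \<gamma>))"
      and PQ: "\<And>n. P n \<Longrightarrow> Q n \<Longrightarrow> False"
      unfolding F_def eventually_inf by blast
    from Q obtain R where R: "eventually R (nhds \<gamma>)" "\<And>n. R (\<Gamma> n) \<Longrightarrow> Q n"
      unfolding eventually_filtercomap by blast
    have "eventually (\<lambda>f. \<not> R f) (filtermap \<Gamma> sequentially)"
      unfolding eventually_filtermap using P by (rule eventually_mono) (use PQ R(2) in blast)
    with R(1) have "eventually (\<lambda>_. False) (inf (nhds \<gamma>) (filtermap \<Gamma> sequentially))"
      unfolding eventually_inf by blast
    with \<gamma>(2) show False by (simp add: eventually_False)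
  qed
  moreover have "F \<le> sequentially" by (simp add: F_def)
  moreover have "\<gamma> t \<in> K" for t using \<gamma>(1) by (auto simp: PiE_iff)
  moreover have "((\<lambda>n. \<Gamma> n t) \<longlongrightarrow> \<gamma> t) F" for t
  proof -
    have "filterlim \<Gamma> (nhds \<gamma>) F"
      unfolding filterlim_def F_def
      by (meson filtermap_filtercomap filtermap_mono inf_le2 order_trans)
    moreover have "((\<lambda>f. f t) \<longlongrightarrow> \<gamma> t) (nhds \<gamma>)"
    proof -
      have "continuous_on UNIV (\<lambda>f :: 'i \<Rightarrow> 'b. f t)" by (rule continuous_on_product_coordinates)
      then have "open ((\<lambda>f :: 'i \<Rightarrow> 'b. f t) -` U)" if "open U" for U
        using that open_vimage by blast
      then show ?thesis
        by (intro topological_tendstoI) (auto simp: eventually_nhds intro!: exI[of _ "(\<lambda>f. f t) -` _"])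
    qed
    ultimately show ?thesis using filterlim_compose by blast
  qed
  ultimately show ?thesis using that by blast
qed

context lie_group_chart
begin

lemma exp_curve_cont: "exp_curve G c S X \<gamma> \<Longrightarrow> continuous_on UNIV \<gamma>"
  and exp_curve_in: "exp_curve G c S X \<gamma> \<Longrightarrow> \<gamma> s \<in> S"
  and exp_curve_add: "exp_curve G c S X \<gamma> \<Longrightarrow> \<gamma> (s + t) = \<gamma> s \<otimes> \<gamma> t"
  by (auto simp: exp_curve_def one_parameter_subgroup_def)

lemma exp_curve_0:
  assumes "exp_curve G c S X \<gamma>" "S \<subseteq> carrier G"
  shows "\<gamma> 0 = \<one>"
proof -
  have "\<gamma> 0 \<in> carrier G" using assms exp_curve_in by blast
  moreover have "\<gamma> 0 = \<gamma> 0 \<otimes> \<gamma> 0" using exp_curve_add[OF assms(1), of 0 0] by simp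
  ultimately show ?thesis by (metis r_cancel_one)
qed

lemma exp_curve_minus:
  assumes "exp_curve G c S X \<gamma>" "S \<subseteq> carrier G"
  shows "\<gamma> (- s) = inv (\<gamma> s)"
proof -
  have "\<gamma> s \<in> carrier G" "\<gamma> (- s) \<in> carrier G" using assms exp_curve_in by blast+
  moreover have "\<gamma> (- s) \<otimes> \<gamma> s = \<one>"
    using exp_curve_add[OF assms(1), of "- s" s] exp_curve_0[OF assms] by simp
  ultimately show ?thesis by (simp add: inv_equality)
qed

lemma exp_curve_G_deriv:
  assumes "exp_curve G c S X \<gamma>" "S \<subseteq> carrier G"
  shows "G_deriv \<gamma> 0 (\<lambda>h. h *\<^sub>R X)"
proof -
  have "isCont \<gamma> 0" using exp_curve_cont[OF assms(1)] by (simp add: continuous_on_eq_continuous_at)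
  moreover have "\<gamma> s \<in> carrier G" for s using assms exp_curve_in by blast
  ultimately show ?thesis
    using assms exp_curve_0[OF assms] by (simp add: G_deriv_def exp_curve_def has_vector_derivative_def)
qed

text \<open>The quotient \<open>\<gamma>1 s \<otimes> inv (\<gamma>2 s)\<close> has zero derivative
  at \<open>0\<close>, and its values near any \<open>s\<close> are two-sided translates of those
  near \<open>0\<close>. It is therefore locally constant.\<close>

lemma exp_curve_unique:
  assumes 1: "exp_curve G c S X \<gamma>1" "S \<subseteq> carrier G" and 2: "exp_curve G c S' X \<gamma>2" "S' \<subseteq> carrier G"
  shows "\<gamma>1 = \<gamma>2"
proof -
  have carr [simp]: "\<gamma>1 s \<in> carrier G" "\<gamma>2 s \<in> carrier G" for s
    using 1 2 exp_curve_in by blast+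
  define \<delta> where "\<delta> s = \<gamma>1 s \<otimes> inv (\<gamma>2 s)" for s
  have \<delta>c: "\<delta> s \<in> carrier G" for s by (simp add: \<delta>_def)
  have \<delta>0: "\<delta> 0 = \<one>" using exp_curve_0[OF 1] exp_curve_0[OF 2] by (simp add: \<delta>_def)
  have \<delta>d: "G_deriv \<delta> 0 (\<lambda>_. 0)"
    using G_deriv_mult[OF exp_curve_G_deriv[OF 1] G_deriv_inv[OF exp_curve_G_deriv[OF 2]]]
    by (simp add: \<delta>_def[abs_def])
  have \<delta>add: "\<delta> (s + h) = \<gamma>1 s \<otimes> \<delta> h \<otimes> inv (\<gamma>2 s)" for s h
    by (simp add: \<delta>_def exp_curve_add[OF 1(1)] exp_curve_add[OF 2(1)] inv_mult_group m_assoc)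
  have \<delta>lim: "(\<delta> \<longlongrightarrow> \<delta> s) (nhds s)" for s
    unfolding \<delta>_def
    using exp_curve_cont[OF 1(1)] exp_curve_cont[OF 2(1)]
    by (intro tendsto_mult_G tendsto_inv_G) (auto simp: continuous_on_eq_continuous_at isCont_nhds)
  have zero: "((\<lambda>r. snd a (\<delta> r)) has_derivative (\<lambda>_. 0)) (at s)" if a: "a \<in> \<A>" "\<delta> s \<in> fst a" for a s
  proof -
    obtain D where D: "((\<lambda>x. snd a (\<gamma>1 s \<otimes> p x \<otimes> inv (\<gamma>2 s))) has_derivative D) (at c0)"
      using differentiable_translate[of "\<gamma>1 s" "inv (\<gamma>2 s)" a] a by (auto simp: \<delta>_def differentiable_def)
    have "((\<lambda>h. snd a (\<delta> (s + h))) has_derivative (\<lambda>h. D 0)) (at 0)"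
      unfolding \<delta>add by (rule G_deriv_chain[OF \<delta>d, of "\<lambda>k. snd a (\<gamma>1 s \<otimes> k \<otimes> inv (\<gamma>2 s))", OF D])
    moreover have "D 0 = 0" using D by (simp add: has_derivative_bounded_linear linear_simps)
    ultimately have *: "((\<lambda>h. snd a (\<delta> (s + h))) has_derivative (\<lambda>h. 0)) (at (s - s))" by simp
    have "((\<lambda>r. r - s) has_derivative (\<lambda>h. h)) (at s)" by (auto intro!: derivative_eq_intros)
    from has_derivative_compose[OF this *] show ?thesis by simp
  qed
  have "\<delta> s = \<delta> 0" for s
  proof (rule connected_local_const[where f=\<delta> and A=UNIV])
    show "\<forall>a\<in>UNIV. \<forall>\<^sub>F b in at a. \<delta> a = \<delta> b"
    proof
      fix s
      obtain a where a: "a \<in> \<A>" "\<delta> s \<in> fst a" using chart_cover[OF \<delta>c] by blast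
      have "\<forall>\<^sub>F r in nhds s. \<delta> r \<in> fst a"
        using eventually_in_dom[OF \<delta>lim _ a] \<delta>c by simp
      then obtain e where e: "e > 0" "\<And>r. dist r s < e \<Longrightarrow> \<delta> r \<in> fst a"
        unfolding eventually_nhds_metric by blast
      have "((\<lambda>r. snd a (\<delta> r)) has_derivative (\<lambda>_. 0)) (at r within ball s e)" if "r \<in> ball s e" for r
        using zero[OF a(1), of r] e(2)[of r] that by (auto simp: dist_commute intro: has_derivative_at_withinI)
      from has_derivative_zero_constant[OF convex_ball this]
      obtain k where k: "\<And>r. r \<in> ball s e \<Longrightarrow> snd a (\<delta> r) = k" by blast
      have "\<delta> s = \<delta> r" if "r \<in> ball s e" for r
        using k[OF that] k[of s] e that a chart_param[OF a(1)] by (metis centre_in_ball dist_commute mem_ball)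
      then show "\<forall>\<^sub>F b in at s. \<delta> s = \<delta> b"
        unfolding eventually_at using e(1) by (intro exI[of _ e]) (auto simp: dist_commute)
    qed
  qed auto
  then have "\<gamma>1 s \<otimes> inv (\<gamma>2 s) = \<one>" for s using \<delta>0 by (simp add: \<delta>_def)
  then have "\<gamma>1 s = \<gamma>2 s" for s by (metis carr inv_closed inv_equality inv_inv)
  then show ?thesis by blast
qed

section \<open>Existence of one-parameter subgroups\<close>

text \<open>One step of an Euler scheme. Near the identity the derivative of the product in its
  second factor, in direction \<open>X\<close>, is within \<open>\<epsilon>\<close> of
  \<open>X\<close>; the mean value inequality along the segment gives the error
  \<open>\<epsilon> * s\<close>.\<close>

lemma small_step_estimate:
  assumes "\<epsilon> > 0"
  obtains \<delta> where "\<delta> > 0"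
    "\<And>x s. norm (x - c0) < \<delta> \<Longrightarrow> 0 \<le> s \<Longrightarrow> s < \<delta> \<Longrightarrow>
       x \<in> snd c ` fst c \<and> c0 + s *\<^sub>R X \<in> snd c ` fst c \<and> p x \<otimes> p (c0 + s *\<^sub>R X) \<in> fst c \<and>
       norm (snd c (p x \<otimes> p (c0 + s *\<^sub>R X)) - x - s *\<^sub>R X) \<le> \<epsilon> * s"
proof -
  let ?m = "\<lambda>(x, y). snd c (p x \<otimes> p y)" and ?I = "snd c ` fst c"
  have C1: "C1_at ?m (c0, c0)" using C1_mult[of c c c \<one> \<one>] c_in one_c by auto
  then obtain S f' where S: "open S" "(c0, c0) \<in> S" "\<And>y. y \<in> S \<Longrightarrow> (?m has_derivative f' y) (at y)"
    "continuous_on (S \<times> UNIV) (\<lambda>(y, v). f' y v)"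
    unfolding C1_at_def by blast
  have "((\<lambda>y. ?m (c0, y)) has_derivative (\<lambda>h. f' (c0, c0) (0, h))) (at c0)"
    by (rule has_derivative_compose[OF has_derivative_Pair[OF has_derivative_const has_derivative_ident] S(3)[OF S(2)]])
  then have "((\<lambda>y. y) has_derivative (\<lambda>h. f' (c0, c0) (0, h))) (at c0)"
    by (rule has_derivative_transform_within_open[OF _ chart_image_open[OF c_in] c0_in])
       (use c_in dom_c in auto)
  from fun_cong[OF has_derivative_unique[OF this has_derivative_ident]]
  have fX: "f' (c0, c0) (0, X) = X" .
  have "continuous_on S (\<lambda>y. (\<lambda>(y, v). f' y v) (y, (0, X)))"
    by (rule continuous_on_compose2[OF S(4)]) (auto intro!: continuous_on_Pair continuous_on_id continuous_on_const)
  then have "isCont (\<lambda>y. f' y (0, X)) (c0, c0)"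
    using S(1,2) by (simp add: continuous_on_eq_continuous_at)
  then have lim: "((\<lambda>y. f' y (0, X)) \<longlongrightarrow> X) (nhds (c0, c0))" by (simp add: isCont_nhds fX)
  have ev1: "\<forall>\<^sub>F z in nhds (c0, c0). norm (f' z (0, X) - X) < \<epsilon>"
    using tendstoD[OF lim assms] by (simp add: dist_norm)
  have ev2: "\<forall>\<^sub>F z in nhds (c0, c0). z \<in> S \<inter> ?I \<times> ?I"
    using S(1,2) c0_in chart_image_open[OF c_in] by (intro eventually_nhds_in_open open_Int open_Times) auto
  have "G_C1_at (\<lambda>z. p (fst z) \<otimes> p (snd z)) (c0, c0)"
    by (intro G_C1_at_mult G_C1_at_compose[OF C1_at_fst G_C1_at_param] G_C1_at_compose[OF C1_at_snd G_C1_at_param])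
       (use c_in c0_in in auto)
  from G_C1_at_D(4)[OF this c_in]
  have ev3: "\<forall>\<^sub>F z in nhds (c0, c0). p (fst z) \<otimes> p (snd z) \<in> fst c" using one_c by simp
  obtain d where d: "d > 0" "\<And>z. dist z (c0, c0) < d \<Longrightarrow>
      norm (f' z (0, X) - X) < \<epsilon> \<and> z \<in> S \<inter> ?I \<times> ?I \<and> p (fst z) \<otimes> p (snd z) \<in> fst c"
    using eventually_conj[OF ev1 eventually_conj[OF ev2 ev3]] unfolding eventually_nhds_metric by blast
  \<comment> \<open>Small enough that \<open>x\<close> and \<open>c0 + s *\<^sub>R X\<close>
    together stay within \<open>d\<close> of \<open>(c0, c0)\<close>.\<close>
  define \<delta> where "\<delta> = d / 2 / (1 + norm X)"
  have pos: "1 + norm X > 0" by (simp add: add_pos_nonneg)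
  have \<delta>0: "\<delta> > 0" using d(1) pos by (simp add: \<delta>_def)
  have near: "dist (x, c0 + s *\<^sub>R X) (c0, c0) < d" if "norm (x - c0) < \<delta>" "0 \<le> s" "s < \<delta>" for x s
  proof -
    have "dist (x, c0 + s *\<^sub>R X) (c0, c0) \<le> norm (x - c0) + norm (s *\<^sub>R X)"
      using norm_Pair_le[of "x - c0" "s *\<^sub>R X"] by (simp add: dist_norm)
    also have "\<dots> \<le> norm (x - c0) + s * norm X" using that by simp
    also have "\<dots> < \<delta> + \<delta> * (1 + norm X)"
      using that \<delta>0 by (intro add_less_le_mono mult_mono) auto
    also have "\<dots> \<le> \<delta> * (1 + norm X) + \<delta> * (1 + norm X)"
      using \<delta>0 by (intro add_right_mono) (simp add: algebra_simps)
    also have "\<delta> * (1 + norm X) = d / 2"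
      using pos \<delta>_def nonzero_eq_divide_eq[of "1 + norm X" \<delta> "d / 2"] by linarith
    also have "d / 2 + d / 2 = d" by simp
    finally show ?thesis .
  qed
  show ?thesis
  proof (rule that[OF \<delta>0])
    fix x s assume x: "norm (x - c0) < \<delta>" and s: "0 \<le> s" "s < \<delta>"
    note z = d(2)[OF near[OF x s]]
    \<comment> \<open>The deviation of the product from linear motion; its derivative is bounded by
      \<open>\<epsilon>\<close>.\<close>
    define \<phi> where "\<phi> r = ?m (x, c0 + r *\<^sub>R X) - r *\<^sub>R X" for r
    have "norm (\<phi> s - \<phi> 0) \<le> \<epsilon> * norm (s - 0)"
    proof (rule differentiable_bound[where S="{0..s}"])
      fix r assume r: "r \<in> {0..s}"
      have zr: "norm (f' (x, c0 + r *\<^sub>R X) (0, X) - X) < \<epsilon>" "(x, c0 + r *\<^sub>R X) \<in> S"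
        using d(2)[OF near[OF x, of r]] r s by auto
      have *: "((\<lambda>r. (x, c0 + r *\<^sub>R X)) has_derivative (\<lambda>h. (0, h *\<^sub>R X))) (at r within {0..s})"
        by (auto intro!: derivative_eq_intros)
      interpret f': bounded_linear "f' (x, c0 + r *\<^sub>R X)"
        using S(3)[OF zr(2)] has_derivative_bounded_linear by blast
      have "f' (x, c0 + r *\<^sub>R X) (0, h *\<^sub>R X) = h *\<^sub>R f' (x, c0 + r *\<^sub>R X) (0, X)" for h
        using f'.scaleR[of h "(0, X)"] by simp
      moreover have "((\<lambda>r. r *\<^sub>R X) has_derivative (\<lambda>h. h *\<^sub>R X)) (at r within {0..s})"
        by (auto intro!: derivative_eq_intros)
      ultimately show "(\<phi> has_derivative (\<lambda>h. h *\<^sub>R (f' (x, c0 + r *\<^sub>R X) (0, X) - X))) (at r within {0..s})"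
        using has_derivative_diff[OF has_derivative_compose[OF * S(3)[OF zr(2)]]]
        unfolding \<phi>_def[abs_def] by (simp add: scaleR_diff_right)
      show "onorm (\<lambda>h. h *\<^sub>R (f' (x, c0 + r *\<^sub>R X) (0, X) - X)) \<le> \<epsilon>"
      proof (rule onorm_le)
        show "norm (h *\<^sub>R (f' (x, c0 + r *\<^sub>R X) (0, X) - X)) \<le> \<epsilon> * norm h" for h
          using mult_left_mono[of "norm (f' (x, c0 + r *\<^sub>R X) (0, X) - X)" \<epsilon> "\<bar>h\<bar>"] zr(1)
          by (simp add: mult.commute)
      qed
    qed (use s in auto)
    moreover have "\<phi> 0 = x" using z c_in dom_c by (auto simp: \<phi>_def)
    moreover have "\<phi> s - x = snd c (p x \<otimes> p (c0 + s *\<^sub>R X)) - x - s *\<^sub>R X" by (simp add: \<phi>_def)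
    ultimately show "x \<in> ?I \<and> c0 + s *\<^sub>R X \<in> ?I \<and> p x \<otimes> p (c0 + s *\<^sub>R X) \<in> fst c \<and>
       norm (snd c (p x \<otimes> p (c0 + s *\<^sub>R X)) - x - s *\<^sub>R X) \<le> \<epsilon> * s"
      using z s by simp
  qed
qed

text \<open>The one-step errors \<open>\<epsilon> / n\<close> add up to
  \<open>\<epsilon> * (j / n)\<close> over \<open>j\<close> steps, as long as the powers stay where
  the one-step estimate applies.\<close>

lemma power_estimate:
  assumes "\<epsilon> > 0"
  obtains \<tau> N where "\<tau> > 0" "N > 0"
    "\<And>n j. n \<ge> N \<Longrightarrow> real j / real n < \<tau> \<Longrightarrow>
       c0 + (1 / real n) *\<^sub>R X \<in> snd c ` fst c \<and> p (c0 + (1 / real n) *\<^sub>R X) [^] j \<in> fst c \<and>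
       norm (snd c (p (c0 + (1 / real n) *\<^sub>R X) [^] j) - c0 - (real j / real n) *\<^sub>R X) \<le> \<epsilon> * (real j / real n)"
proof -
  obtain \<delta> where \<delta>: "\<delta> > 0"
    "\<And>x s. norm (x - c0) < \<delta> \<Longrightarrow> 0 \<le> s \<Longrightarrow> s < \<delta> \<Longrightarrow>
       x \<in> snd c ` fst c \<and> c0 + s *\<^sub>R X \<in> snd c ` fst c \<and> p x \<otimes> p (c0 + s *\<^sub>R X) \<in> fst c \<and>
       norm (snd c (p x \<otimes> p (c0 + s *\<^sub>R X)) - x - s *\<^sub>R X) \<le> \<epsilon> * s"
    using small_step_estimate[OF assms, of X thesis] by blast
  \<comment> \<open>After \<open>j\<close> steps the distance from \<open>c0\<close> is at most
    \<open>(norm X + \<epsilon>) * (j / n)\<close>, which \<open>j / n < \<tau>\<close> keeps below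
    \<open>\<delta>\<close>.\<close>
  define \<tau> where "\<tau> = \<delta> / (norm X + \<epsilon>)"
  have pos: "norm X + \<epsilon> > 0" using assms by (simp add: add_nonneg_pos)
  obtain m where m: "inverse (real (Suc m)) < \<delta>" using reals_Archimedean[OF \<delta>(1)] by blast
  define N where "N = Suc m"
  have N: "N > 0" "1 / real N < \<delta>" using m by (simp_all only: N_def inverse_eq_divide zero_less_Suc)
  show ?thesis
  proof (rule that[of \<tau> N])
    show "\<tau> > 0" using \<delta>(1) pos by (simp add: \<tau>_def)
    fix n j assume n: "n \<ge> N" and j: "real j / real n < \<tau>"
    define g where "g = p (c0 + (1 / real n) *\<^sub>R X)"
    have n0: "n > 0" using N n by simp
    have n\<delta>: "1 / real n < \<delta>"
    proof -
      have "1 / real n \<le> 1 / real N" using N(1) n by (intro divide_left_mono) auto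
      with N(2) show ?thesis by simp
    qed
    have X1: "c0 + (1 / real n) *\<^sub>R X \<in> snd c ` fst c"
      using \<delta>(2)[of c0 "1 / real n"] \<delta>(1) n\<delta> by simp
    have g: "g \<in> carrier G" using X1 c_in dom_c by (auto simp: g_def)
    have "g [^] j \<in> fst c \<and> norm (snd c (g [^] j) - c0 - (real j / real n) *\<^sub>R X) \<le> \<epsilon> * (real j / real n)"
      using j
    proof (induction j)
      case 0
      then show ?case using one_c by simp
    next
      case (Suc j)
      have le: "real j / real n \<le> real (Suc j) / real n" by (simp add: divide_right_mono)
      then have IH: "g [^] j \<in> fst c" "norm (snd c (g [^] j) - c0 - (real j / real n) *\<^sub>R X) \<le> \<epsilon> * (real j / real n)"
        using Suc by auto
      define y where "y = snd c (g [^] j)"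
      have "norm (y - c0) \<le> norm (y - c0 - (real j / real n) *\<^sub>R X) + norm ((real j / real n) *\<^sub>R X)"
        using norm_triangle_ineq[of "y - c0 - (real j / real n) *\<^sub>R X" "(real j / real n) *\<^sub>R X"] by simp
      also have "\<dots> \<le> \<epsilon> * (real j / real n) + norm X * (real j / real n)"
        using IH(2) unfolding y_def norm_scaleR by (intro add_mono) (simp_all add: mult.commute)
      also have "\<dots> = (norm X + \<epsilon>) * (real j / real n)" by (simp only: distrib_right add.commute)
      also have "\<dots> < (norm X + \<epsilon>) * \<tau>"
        using pos le Suc.prems by (intro mult_strict_left_mono) auto
      also have "\<dots> = \<delta>" using pos by (simp add: \<tau>_def)
      finally have y: "norm (y - c0) < \<delta>" .
      have py: "p y = g [^] j" using IH(1) c_in by (simp add: y_def)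
      note E = \<delta>(2)[OF y, of "1 / real n"]
      have step: "g [^] Suc j = p y \<otimes> p (c0 + (1 / real n) *\<^sub>R X)" by (simp add: py g_def[symmetric])
      have E': "g [^] Suc j \<in> fst c" "norm (snd c (g [^] Suc j) - y - (1 / real n) *\<^sub>R X) \<le> \<epsilon> * (1 / real n)"
        unfolding step using E n\<delta> by simp_all
      have "snd c (g [^] Suc j) - c0 - (real (Suc j) / real n) *\<^sub>R X =
          (snd c (g [^] Suc j) - y - (1 / real n) *\<^sub>R X) + (y - c0 - (real j / real n) *\<^sub>R X)"
        by (simp add: add_divide_distrib scaleR_add_left)
      also have "norm \<dots> \<le> \<epsilon> * (1 / real n) + \<epsilon> * (real j / real n)"
        by (rule order_trans[OF norm_triangle_ineq add_mono[OF E'(2) IH(2)[folded y_def]]])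
      also have "\<dots> = \<epsilon> * (real (Suc j) / real n)"
        by (simp add: add_divide_distrib distrib_left)
      finally show ?case using E'(1) by simp
    qed
    then show "c0 + (1 / real n) *\<^sub>R X \<in> snd c ` fst c \<and> p (c0 + (1 / real n) *\<^sub>R X) [^] j \<in> fst c \<and>
       norm (snd c (p (c0 + (1 / real n) *\<^sub>R X) [^] j) - c0 - (real j / real n) *\<^sub>R X) \<le> \<epsilon> * (real j / real n)"
      using X1 by (simp add: g_def)
  qed (use N in auto)
qed

text \<open>A pointwise cluster point of the curves $t \mapsto g_n^{\lfloor nt\rfloor}$, where $g_n$ has
  coordinate $X/n$, is a one-parameter subgroup.\<close>

lemma exp_curve_exists:
  assumes comp: "compact (carrier G)"
  obtains \<gamma> where "exp_curve G c (carrier G) X \<gamma>"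
proof -
  define q where "q n = c0 + (1 / real n) *\<^sub>R X" for n
  \<comment> \<open>For small \<open>n\<close> the point \<open>q n\<close> may lie outside the
    chart; the default makes \<open>g n\<close> a group element for every \<open>n\<close>.\<close>
  define g where "g n = (if q n \<in> snd c ` fst c then p (q n) else \<one>)" for n
  have gc [simp]: "g n \<in> carrier G" for n using c_in dom_c by (auto simp: g_def)
  define \<Gamma> where "\<Gamma> n t = g n [^] \<lfloor>real n * t\<rfloor>" for n and t :: real
  obtain F \<gamma> where F: "F \<noteq> bot" "F \<le> sequentially" and \<gamma>c: "\<And>t. \<gamma> t \<in> carrier G"
    and lim: "\<And>t. ((\<lambda>n. \<Gamma> n t) \<longlongrightarrow> \<gamma> t) F"
    by (rule pointwise_cluster_filter[OF comp, of \<Gamma>]) (auto simp: \<Gamma>_def)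
  have "(\<lambda>n. q n) \<longlonglongrightarrow> c0 + 0 *\<^sub>R X"
    unfolding q_def by (intro tendsto_intros lim_1_over_n)
  then have q: "q \<longlonglongrightarrow> c0" by simp
  have "\<forall>\<^sub>F n in sequentially. q n \<in> snd c ` fst c"
    using topological_tendstoD[OF q chart_image_open[OF c_in] c0_in] .
  then have gp: "\<forall>\<^sub>F n in sequentially. p (q n) = g n" by eventually_elim (simp add: g_def)
  have g1: "g \<longlonglongrightarrow> \<one>"
    using Lim_transform_eventually[OF tendsto_param[OF q c_in c0_in] gp] by simp
  have add: "\<gamma> (s + t) = \<gamma> s \<otimes> \<gamma> t" for s t
  proof -
    \<comment> \<open>The integer part is additive up to a defect of \<open>0\<close> or
      \<open>1\<close>, and \<open>g n\<close> raised to that defect still tends to the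
      identity.\<close>
    define e where "e n = \<lfloor>real n * (s + t)\<rfloor> - \<lfloor>real n * s\<rfloor> - \<lfloor>real n * t\<rfloor>" for n
    have e: "e n = 0 \<or> e n = 1" for n unfolding e_def distrib_left by linarith
    have "(\<lambda>n. g n [^] e n) \<longlonglongrightarrow> \<one>"
    proof (rule topological_tendstoI)
      fix S assume "open S" "\<one> \<in> S"
      from topological_tendstoD[OF g1 this] show "\<forall>\<^sub>F n in sequentially. g n [^] e n \<in> S"
      proof eventually_elim
        case (elim n)
        then show ?case using e[of n] \<open>\<one> \<in> S\<close> by auto
      qed
    qed
    then have "((\<lambda>n. g n [^] e n) \<longlongrightarrow> \<one>) F" using F(2) tendsto_mono by blast
    then have "((\<lambda>n. \<Gamma> n s \<otimes> \<Gamma> n t \<otimes> g n [^] e n) \<longlongrightarrow> \<gamma> s \<otimes> \<gamma> t \<otimes> \<one>) F"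
      using lim \<gamma>c by (intro tendsto_mult_G) (auto simp: \<Gamma>_def)
    moreover have "\<Gamma> n s \<otimes> \<Gamma> n t \<otimes> g n [^] e n = \<Gamma> n (s + t)" for n
    proof -
      have "\<lfloor>real n * (s + t)\<rfloor> = \<lfloor>real n * s\<rfloor> + \<lfloor>real n * t\<rfloor> + e n" by (simp add: e_def)
      then show ?thesis by (simp add: \<Gamma>_def int_pow_mult)
    qed
    ultimately have "((\<lambda>n. \<Gamma> n (s + t)) \<longlongrightarrow> \<gamma> s \<otimes> \<gamma> t) F" using \<gamma>c by simp
    from tendsto_unique[OF F(1) lim this] show ?thesis .
  qed
  have \<gamma>0: "\<gamma> 0 = \<one>"
    using add[of 0 0] \<gamma>c[of 0] by (metis add_0 r_cancel_one)
  have \<gamma>minus: "\<gamma> (- s) = inv (\<gamma> s)" for s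
    using add[of "- s" s] \<gamma>0 \<gamma>c by (simp add: inv_equality)
  \<comment> \<open>The power estimate passes to the cluster point, for times
    \<open>t \<ge> 0\<close>.\<close>
  have local: "\<exists>\<tau>>0. \<forall>t. 0 \<le> t \<and> t < \<tau> \<longrightarrow> \<gamma> t \<in> fst c \<and> norm (snd c (\<gamma> t) - c0 - t *\<^sub>R X) \<le> \<epsilon> * t"
    if \<epsilon>: "\<epsilon> > 0" for \<epsilon>
  proof -
    obtain \<tau>1 N where \<tau>1: "\<tau>1 > 0" "N > 0" "\<And>n j. n \<ge> N \<Longrightarrow> real j / real n < \<tau>1 \<Longrightarrow>
       q n \<in> snd c ` fst c \<and> p (q n) [^] j \<in> fst c \<and>
       norm (snd c (p (q n) [^] j) - c0 - (real j / real n) *\<^sub>R X) \<le> \<epsilon> * (real j / real n)"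
      using power_estimate[OF \<epsilon>, of X thesis] unfolding q_def by blast
    obtain r where r: "r > 0" "cball c0 r \<subseteq> snd c ` fst c"
      using chart_image_open[OF c_in] c0_in open_contains_cball by blast
    have pos: "norm X + \<epsilon> > 0" using \<epsilon> by (simp add: add_nonneg_pos)
    \<comment> \<open>Below \<open>\<tau>\<close> the coordinates of the approximating powers stay
      in the closed ball of radius \<open>r\<close>. Its image in the group is compact, so the limit
      still lies in the chart and its coordinates can be compared.\<close>
    define \<tau> where "\<tau> = min \<tau>1 (r / (norm X + \<epsilon>))"
    have "\<gamma> t \<in> fst c \<and> norm (snd c (\<gamma> t) - c0 - t *\<^sub>R X) \<le> \<epsilon> * t" if t: "0 \<le> t" "t < \<tau>" for t
    proof -
      define j where "j n = nat \<lfloor>real n * t\<rfloor>" for n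
      have j: "real (j n) \<le> real n * t" "real n * t < real (j n) + 1" for n
        using t by (auto simp: j_def)
      have jn: "real (j n) / real n \<le> t" if "n \<ge> N" for n
        using j(1)[of n] that \<tau>1(2) by (simp add: field_simps)
      have \<Gamma>j: "\<Gamma> n t = p (q n) [^] j n" if "n \<ge> N" for n
      proof -
        have "q n \<in> snd c ` fst c" using \<tau>1(3)[OF that, of 0] \<tau>1(1) by simp
        moreover have "\<lfloor>real n * t\<rfloor> = int (j n)" using t by (simp add: j_def)
        ultimately show ?thesis by (simp add: \<Gamma>_def g_def int_pow_int)
      qed
      have b: "\<Gamma> n t \<in> fst c" "norm (snd c (\<Gamma> n t) - c0 - (real (j n) / real n) *\<^sub>R X) \<le> \<epsilon> * t"
        "snd c (\<Gamma> n t) \<in> cball c0 r" if n: "n \<ge> N" for n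
      proof -
        have jt: "real (j n) / real n < \<tau>1" using jn[OF n] t by (simp add: \<tau>_def)
        note * = \<tau>1(3)[OF n jt, folded \<Gamma>j[OF n]]
        then show "\<Gamma> n t \<in> fst c" by simp
        have "\<epsilon> * (real (j n) / real n) \<le> \<epsilon> * t" using jn[OF n] \<epsilon> by (intro mult_left_mono) auto
        with * show 1: "norm (snd c (\<Gamma> n t) - c0 - (real (j n) / real n) *\<^sub>R X) \<le> \<epsilon> * t" by simp
        have "norm (snd c (\<Gamma> n t) - c0) \<le> norm (snd c (\<Gamma> n t) - c0 - (real (j n) / real n) *\<^sub>R X) + norm ((real (j n) / real n) *\<^sub>R X)"
          using norm_triangle_ineq[of "snd c (\<Gamma> n t) - c0 - (real (j n) / real n) *\<^sub>R X" "(real (j n) / real n) *\<^sub>R X"] by simp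
        also have "\<dots> \<le> \<epsilon> * t + t * norm X"
          using 1 mult_right_mono[OF jn[OF n], of "norm X"] by simp
        also have "\<dots> = (norm X + \<epsilon>) * t" by (simp add: algebra_simps)
        also have "\<dots> \<le> (norm X + \<epsilon>) * (r / (norm X + \<epsilon>))"
          using t pos by (intro mult_left_mono) (auto simp: \<tau>_def)
        also have "\<dots> = r" using pos by simp
        finally show "snd c (\<Gamma> n t) \<in> cball c0 r" by (simp add: dist_norm norm_minus_commute)
      qed
      have ev: "\<forall>\<^sub>F n in F. n \<ge> N" using F(2) eventually_ge_at_top filter_leD by blast
      have "compact (p ` cball c0 r)"
        by (rule compact_continuous_image[OF continuous_on_subset[OF param_cont[OF c_in] r(2)] compact_cball])
      then have "closed (p ` cball c0 r)" by (rule compact_imp_closed)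
      moreover have "\<forall>\<^sub>F n in F. \<Gamma> n t \<in> p ` cball c0 r"
        using ev
      proof eventually_elim
        case (elim n)
        then have "p (snd c (\<Gamma> n t)) = \<Gamma> n t" using b(1) c_in by simp
        then show ?case using imageI[OF b(3)[OF elim], of p] by simp
      qed
      ultimately have "\<gamma> t \<in> p ` cball c0 r" by (rule Lim_in_closed_set[OF _ _ F(1) lim])
      then have in_c: "\<gamma> t \<in> fst c" using r(2) c_in by auto
      have "\<forall>\<^sub>F n in F. \<Gamma> n t \<in> carrier G" by (simp add: \<Gamma>_def)
      from tendsto_chart[OF lim this c_in in_c]
      have l1: "((\<lambda>n. snd c (\<Gamma> n t)) \<longlongrightarrow> snd c (\<gamma> t)) F" .
      have "(\<lambda>n. real (j n) / real n) \<longlonglongrightarrow> t"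
      proof (rule tendsto_sandwich)
        show "\<forall>\<^sub>F n in sequentially. real (j n) / real n \<le> t"
          using eventually_ge_at_top[of N] by eventually_elim (rule jn)
        show "\<forall>\<^sub>F n in sequentially. t - 1 / real n \<le> real (j n) / real n"
          using eventually_gt_at_top[of 0]
        proof eventually_elim
          case (elim n)
          then have "real n * t / real n \<le> (real (j n) + 1) / real n"
            using j(2)[of n] by (intro divide_right_mono) auto
          then show ?case using elim by (simp add: add_divide_distrib)
        qed
        show "(\<lambda>n. t - 1 / real n) \<longlonglongrightarrow> t" using tendsto_diff[OF tendsto_const lim_1_over_n, of t] by simp
      qed simp
      then have l2: "((\<lambda>n. real (j n) / real n) \<longlongrightarrow> t) F" using F(2) tendsto_mono by blast
      have "((\<lambda>n. norm (snd c (\<Gamma> n t) - c0 - (real (j n) / real n) *\<^sub>R X)) \<longlongrightarrow> norm (snd c (\<gamma> t) - c0 - t *\<^sub>R X)) F"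
        by (intro tendsto_intros l1 l2)
      moreover have "\<forall>\<^sub>F n in F. norm (snd c (\<Gamma> n t) - c0 - (real (j n) / real n) *\<^sub>R X) \<le> \<epsilon> * t"
        using ev by eventually_elim (rule b(2))
      ultimately have "norm (snd c (\<gamma> t) - c0 - t *\<^sub>R X) \<le> \<epsilon> * t"
        by (rule tendsto_upperbound[OF _ _ F(1)])
      then show ?thesis using in_c by blast
    qed
    moreover have "\<tau> > 0" using \<tau>1 r pos by (simp add: \<tau>_def)
    ultimately show ?thesis by blast
  qed
  have inv_d: "((\<lambda>y. snd c (inv (p y))) has_derivative (\<lambda>h. - h)) (at c0)"
    and inv_in: "\<forall>\<^sub>F y in nhds c0. inv (p y) \<in> fst c"
    using G_deriv_D(4,5)[OF G_deriv_inv[OF G_deriv_p]] by auto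
  \<comment> \<open>Negative times are reached through
    \<open>\<gamma> (- s) = inv (\<gamma> s)\<close>, since inversion has derivative
    \<open>-1\<close> at the identity.\<close>
  have both: "\<exists>d>0. \<forall>t. norm t < d \<longrightarrow> \<gamma> t \<in> fst c \<and> norm (snd c (\<gamma> t) - c0 - t *\<^sub>R X) \<le> \<eta> * norm t"
    if \<eta>: "\<eta> > 0" for \<eta>
  proof -
    \<comment> \<open>\<open>\<epsilon> \<le> 1\<close> gives
      \<open>norm (y - c0) \<le> (norm X + 1) * s\<close>. The linearization error of the inversion
      and the error of \<open>\<gamma> s\<close> then contribute at most
      \<open>\<eta> / 2 * s\<close> each.\<close>
    define \<epsilon> where "\<epsilon> = min 1 (\<eta> / 2)"
    define e where "e = \<eta> / 2 / (norm X + 1)"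
    have \<epsilon>: "\<epsilon> > 0" "\<epsilon> \<le> 1" "\<epsilon> \<le> \<eta> / 2" using \<eta> by (auto simp: \<epsilon>_def)
    have X1: "norm X + 1 > 0" by (simp add: add_nonneg_pos)
    then have e: "e > 0" using \<eta> by (simp add: e_def)
    obtain \<tau> where \<tau>: "\<tau> > 0" "\<And>t. 0 \<le> t \<Longrightarrow> t < \<tau> \<Longrightarrow> \<gamma> t \<in> fst c \<and> norm (snd c (\<gamma> t) - c0 - t *\<^sub>R X) \<le> \<epsilon> * t"
      using local[OF \<epsilon>(1)] by blast
    obtain d1 where d1: "d1 > 0" "\<And>y. norm (y - c0) < d1 \<Longrightarrow> norm (snd c (inv (p y)) - snd c (inv (p c0)) - - (y - c0)) \<le> e * norm (y - c0)"
      using inv_d e unfolding has_derivative_at_alt by blast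
    obtain d2 where d2: "d2 > 0" "\<And>y. dist y c0 < d2 \<Longrightarrow> inv (p y) \<in> fst c"
      using inv_in unfolding eventually_nhds_metric by blast
    define d where "d = min \<tau> (min d1 d2 / (norm X + 1))"
    have "d > 0" using \<tau> d1 d2 X1 by (simp add: d_def)
    moreover have "\<gamma> t \<in> fst c \<and> norm (snd c (\<gamma> t) - c0 - t *\<^sub>R X) \<le> \<eta> * norm t" if t: "norm t < d" for t
    proof (cases "t \<ge> 0")
      case True
      then have "\<epsilon> * t \<le> \<eta> * t" using \<epsilon> \<eta> by (intro mult_right_mono) auto
      then show ?thesis using \<tau>(2)[of t] True t by (auto simp: d_def)
    next
      case False
      define s where "s = - t"
      have s: "0 \<le> s" "s < d" "t = - s" using False t by (auto simp: s_def)
      define y where "y = snd c (\<gamma> s)"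
      have \<gamma>s: "\<gamma> s \<in> fst c" "norm (y - c0 - s *\<^sub>R X) \<le> \<epsilon> * s" using \<tau>(2)[of s] s by (auto simp: d_def y_def)
      have "norm (y - c0) \<le> norm (y - c0 - s *\<^sub>R X) + norm (s *\<^sub>R X)"
        using norm_triangle_ineq[of "y - c0 - s *\<^sub>R X" "s *\<^sub>R X"] by simp
      also have "\<dots> \<le> 1 * s + s * norm X"
        using \<gamma>s(2) s \<epsilon>(2) by (intro add_mono order_trans[OF \<gamma>s(2)] mult_right_mono) auto
      also have "\<dots> = (norm X + 1) * s" by (simp add: algebra_simps)
      finally have y: "norm (y - c0) \<le> (norm X + 1) * s" .
      also have "\<dots> < (norm X + 1) * (min d1 d2 / (norm X + 1))"
        using s X1 by (intro mult_strict_left_mono) (auto simp: d_def)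
      also have "\<dots> = min d1 d2" using X1 by simp
      finally have yd: "norm (y - c0) < d1" "norm (y - c0) < d2" by auto
      have py: "p y = \<gamma> s" using \<gamma>s c_in by (simp add: y_def)
      have \<gamma>t: "\<gamma> t = inv (p y)" using s \<gamma>minus py by simp
      then have A: "\<gamma> t \<in> fst c" using d2(2)[of y] yd by (simp add: dist_norm)
      have B: "snd c (\<gamma> t) - c0 - t *\<^sub>R X = (snd c (inv (p y)) - snd c (inv (p c0)) - - (y - c0)) - (y - c0 - s *\<^sub>R X)"
        unfolding \<gamma>t using s(3) by simp
      have C: "norm ((snd c (inv (p y)) - snd c (inv (p c0)) - - (y - c0)) - (y - c0 - s *\<^sub>R X)) \<le> e * norm (y - c0) + \<epsilon> * s"
        by (rule order_trans[OF norm_triangle_ineq4 add_mono[OF d1(2)[OF yd(1)] \<gamma>s(2)]])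
      have D: "e * norm (y - c0) + \<epsilon> * s \<le> e * ((norm X + 1) * s) + \<eta> / 2 * s"
        using y e \<epsilon> s by (intro add_mono mult_left_mono mult_right_mono) auto
      have E: "e * ((norm X + 1) * s) + \<eta> / 2 * s = \<eta> * norm t"
      proof -
        have "e * (norm X + 1) = \<eta> / 2"
          using X1 e_def nonzero_eq_divide_eq[of "norm X + 1" e "\<eta> / 2"] by linarith
        then have *: "e * ((norm X + 1) * s) = \<eta> / 2 * s" by (metis mult.assoc)
        have "norm t = s" using s by simp
        then show ?thesis unfolding * by simp
      qed
      have "norm (snd c (\<gamma> t) - c0 - t *\<^sub>R X) \<le> \<eta> * norm t"
        unfolding B using C D unfolding E by (rule order_trans)
      with A show ?thesis ..
    qed
    ultimately show ?thesis by blast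
  qed
  have deriv: "((\<lambda>s. snd c (\<gamma> s)) has_vector_derivative X) (at 0)"
    unfolding has_vector_derivative_def has_derivative_at_alt \<gamma>0 diff_zero
    using both by (blast intro: bounded_linear_scaleR_left)
  have "isCont (\<lambda>s. snd c (\<gamma> s)) 0"
    using deriv has_vector_derivative_continuous by blast
  then have "((\<lambda>s. snd c (\<gamma> s)) \<longlongrightarrow> c0) (nhds 0)" by (simp add: isCont_nhds \<gamma>0)
  from tendsto_param[OF this c_in c0_in]
  have *: "((\<lambda>s. p (snd c (\<gamma> s))) \<longlongrightarrow> \<one>) (nhds 0)" by simp
  obtain d where "d > 0" "\<And>t. norm t < d \<Longrightarrow> \<gamma> t \<in> fst c" using both[of 1] by auto
  then have "\<forall>\<^sub>F s in nhds 0. p (snd c (\<gamma> s)) = \<gamma> s"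
    unfolding eventually_nhds_metric using c_in by (intro exI[of _ d]) auto
  then have lim0: "(\<gamma> \<longlongrightarrow> \<one>) (nhds 0)" using Lim_transform_eventually[OF *] by blast
  \<comment> \<open>The homomorphism property carries continuity at \<open>0\<close> to every
    point.\<close>
  have "continuous_on UNIV \<gamma>"
    unfolding continuous_on_eq_continuous_at[OF open_UNIV]
  proof
    fix s
    have "((\<lambda>h. \<gamma> s \<otimes> \<gamma> h) \<longlongrightarrow> \<gamma> s \<otimes> \<one>) (at 0)"
      using tendsto_mono[OF at_within_le_nhds lim0] \<gamma>c by (intro tendsto_mult_G tendsto_const) auto
    then show "isCont \<gamma> s" unfolding isCont_iff using \<gamma>c by (simp add: add)
  qed
  then have "exp_curve G c (carrier G) X \<gamma>"
    using deriv \<gamma>c add by (auto simp: exp_curve_def one_parameter_subgroup_def)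
  then show ?thesis using that by blast
qed

text \<open>Conjugating the curve by an element of \<open>T\<close> does not change its velocity, so
  by uniqueness the curve commutes with \<open>T\<close>. The closure of \<open>T\<close> times the
  curve is then a torus, which maximality identifies with \<open>T\<close>.\<close>

lemma exp_curve_in_maximal_torus:
  assumes comp: "compact (carrier G)" and T: "maximal_torus G T"
    and X: "\<And>t. t \<in> T \<Longrightarrow> Ad G c t X = X"
  obtains \<gamma> where "exp_curve G c T X \<gamma>"
proof -
  obtain \<gamma> where \<gamma>: "exp_curve G c (carrier G) X \<gamma>" using exp_curve_exists[OF comp] .
  note \<gamma>c = exp_curve_in[OF \<gamma>] and \<gamma>add = exp_curve_add[OF \<gamma>]
  have T': "subgroup T G" "connected T" "\<And>s t. s \<in> T \<Longrightarrow> t \<in> T \<Longrightarrow> s \<otimes> t = t \<otimes> s"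
    using T by (auto simp: maximal_torus_def torus_in_def)
  have Tc: "t \<in> T \<Longrightarrow> t \<in> carrier G" for t using subgroup.mem_carrier[OF T'(1)] .
  have comm: "t \<otimes> \<gamma> s = \<gamma> s \<otimes> t" if t: "t \<in> T" for t s
  proof -
    define \<gamma>' where "\<gamma>' s = t \<otimes> \<gamma> s \<otimes> inv t" for s
    note tc = Tc[OF t]
    have "G_deriv \<gamma>' 0 (\<lambda>h. Ad G c t (h *\<^sub>R X))"
      using G_deriv_conj[OF exp_curve_G_deriv[OF \<gamma> order_refl] tc] by (simp add: \<gamma>'_def[abs_def])
    then have "((\<lambda>s. snd c (\<gamma>' s)) has_derivative (\<lambda>h. Ad G c t (h *\<^sub>R X))) (at 0)"
      by (rule G_deriv_D)
    moreover have "Ad G c t (h *\<^sub>R X) = h *\<^sub>R X" for h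
      using bounded_linear.linear[OF Ad_linear[OF tc]] X[OF t] by (simp add: linear_scale)
    ultimately have d: "((\<lambda>s. snd c (\<gamma>' s)) has_vector_derivative X) (at 0)"
      by (simp add: has_vector_derivative_def)
    have "(\<gamma>' \<longlongrightarrow> \<gamma>' s) (nhds s)" for s
      unfolding \<gamma>'_def using exp_curve_cont[OF \<gamma>] \<gamma>c tc
      by (intro tendsto_mult_G tendsto_const) (auto simp: continuous_on_eq_continuous_at isCont_nhds)
    then have "continuous_on UNIV \<gamma>'" by (simp add: continuous_on_eq_continuous_at isCont_nhds)
    moreover have "\<gamma>' (s + r) = \<gamma>' s \<otimes> \<gamma>' r" for s r
    proof -
      have "(t \<otimes> \<gamma> s \<otimes> inv t) \<otimes> (t \<otimes> \<gamma> r \<otimes> inv t) = t \<otimes> \<gamma> s \<otimes> (inv t \<otimes> t) \<otimes> \<gamma> r \<otimes> inv t"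
        using tc \<gamma>c by (simp only: m_assoc m_closed inv_closed)
      then show ?thesis using tc \<gamma>c by (simp add: \<gamma>'_def \<gamma>add m_assoc)
    qed
    ultimately have "exp_curve G c (carrier G) X \<gamma>'"
      using d \<gamma>c tc by (auto simp: exp_curve_def one_parameter_subgroup_def \<gamma>'_def)
    then have "\<gamma>' = \<gamma>" using exp_curve_unique \<gamma> by blast
    then have "t \<otimes> \<gamma> s \<otimes> inv t = \<gamma> s" by (metis \<gamma>'_def)
    then have "t \<otimes> \<gamma> s \<otimes> inv t \<otimes> t = \<gamma> s \<otimes> t" by simp
    then show ?thesis using tc \<gamma>c by (simp add: m_assoc)
  qed
  \<comment> \<open>A connected abelian subgroup. It need not be closed, since the curve may wind
    densely; hence the closure \<open>K\<close>.\<close>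
  define S where "S = (\<lambda>(t, s). t \<otimes> \<gamma> s) ` (T \<times> UNIV)"
  define K where "K = closure S"
  have clG: "closed (carrier G)" using comp compact_imp_closed by blast
  have S_sub: "S \<subseteq> carrier G" using Tc \<gamma>c by (auto simp: S_def)
  then have K_sub: "K \<subseteq> carrier G" unfolding K_def using clG closure_minimal by blast
  have cont: "continuous_on (T \<times> UNIV) (\<lambda>z. (\<lambda>(x, y). x \<otimes> y) (fst z, \<gamma> (snd z)))"
    using Tc \<gamma>c
    by (intro continuous_on_compose2[OF mult_cont] continuous_on_Pair continuous_on_fst continuous_on_id
          continuous_on_compose2[OF exp_curve_cont[OF \<gamma>]] continuous_on_snd) auto
  have "connected S"
    unfolding S_def
    by (rule connected_continuous_image) (use cont T'(2) connected_Times in \<open>auto simp: case_prod_unfold\<close>)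
  then have conn: "connected K" unfolding K_def by (rule connected_imp_connected_closure)
  have S_mult: "x \<otimes> y \<in> S" and S_comm: "x \<otimes> y = y \<otimes> x" if xy: "x \<in> S" "y \<in> S" for x y
  proof -
    obtain t s t' s' where x: "x = t \<otimes> \<gamma> s" "t \<in> T" and y: "y = t' \<otimes> \<gamma> s'" "t' \<in> T"
      using xy by (auto simp: S_def)
    have mult: "(t \<otimes> \<gamma> s) \<otimes> (t' \<otimes> \<gamma> s') = (t \<otimes> t') \<otimes> \<gamma> (s + s')" if "t \<in> T" "t' \<in> T" for t t' s s'
    proof -
      note c = Tc[OF that(1)] Tc[OF that(2)]
      have "(t \<otimes> \<gamma> s) \<otimes> (t' \<otimes> \<gamma> s') = t \<otimes> (\<gamma> s \<otimes> t') \<otimes> \<gamma> s'" using c \<gamma>c by (simp add: m_assoc)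
      also have "\<dots> = t \<otimes> (t' \<otimes> \<gamma> s) \<otimes> \<gamma> s'" using comm[OF that(2)] by simp
      finally show ?thesis using c \<gamma>c by (simp add: m_assoc \<gamma>add)
    qed
    show "x \<otimes> y \<in> S"
      unfolding x y mult[OF x(2) y(2)] S_def using subgroup.m_closed[OF T'(1) x(2) y(2)] by force
    show "x \<otimes> y = y \<otimes> x"
      unfolding x y mult[OF x(2) y(2)] mult[OF y(2) x(2)] using T'(3)[OF x(2) y(2)] by (simp add: add.commute)
  qed
  have S_inv: "inv x \<in> S" if xS: "x \<in> S" for x
  proof -
    obtain t s where x: "x = t \<otimes> \<gamma> s" "t \<in> T" using xS by (auto simp: S_def)
    have it: "inv t \<in> T" using subgroup.m_inv_closed[OF T'(1) x(2)] .
    have "inv x = inv t \<otimes> \<gamma> (- s)"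
      using comm[OF it, of "- s"] Tc[OF x(2)] \<gamma>c by (simp add: x inv_mult_group exp_curve_minus[OF \<gamma> order_refl])
    then show ?thesis using it by (force simp: S_def)
  qed
  have multK: "continuous_on (closure (S \<times> S)) (\<lambda>(x, y). x \<otimes> y)"
    by (rule continuous_on_subset[OF mult_cont]) (use K_sub in \<open>auto simp: closure_Times K_def\<close>)
  have T_S: "T \<subseteq> S"
  proof
    fix t assume "t \<in> T"
    then have "t = t \<otimes> \<gamma> 0" using Tc exp_curve_0[OF \<gamma> order_refl] by simp
    then show "t \<in> S" using \<open>t \<in> T\<close> by (force simp: S_def)
  qed
  have S_K: "S \<subseteq> K" by (simp add: K_def closure_subset)
  have K_mult: "x \<otimes> y \<in> K" if "x \<in> K" "y \<in> K" for x y
  proof -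
    have "(\<lambda>(x, y). x \<otimes> y) ` closure (S \<times> S) \<subseteq> K"
      by (rule image_closure_subset[OF multK]) (use S_mult S_K in \<open>auto simp: K_def\<close>)
    then show ?thesis using that by (auto simp: closure_Times K_def)
  qed
  \<comment> \<open>Commuting is a closed condition because the diagonal of a Hausdorff space is
    closed.\<close>
  have K_comm: "x \<otimes> y = y \<otimes> x" if "x \<in> K" "y \<in> K" for x y
  proof -
    have "continuous_on (closure (S \<times> S)) (\<lambda>z. (\<lambda>(x, y). x \<otimes> y) (snd z, fst z))"
      using K_sub
      by (intro continuous_on_compose2[OF mult_cont] continuous_on_Pair continuous_on_fst continuous_on_snd continuous_on_id)
         (auto simp: closure_Times K_def)
    then have "continuous_on (closure (S \<times> S)) (\<lambda>z. (fst z \<otimes> snd z, snd z \<otimes> fst z))"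
      using multK by (intro continuous_on_Pair) (auto simp: case_prod_unfold)
    then have "(\<lambda>z. (fst z \<otimes> snd z, snd z \<otimes> fst z)) ` closure (S \<times> S) \<subseteq> {y. \<exists>x. y = (x, x)}"
      by (rule image_closure_subset[OF _ closed_diagonal]) (use S_comm in auto)
    moreover have "(x, y) \<in> closure (S \<times> S)" using that by (simp add: closure_Times K_def)
    ultimately have "(\<lambda>z. (fst z \<otimes> snd z, snd z \<otimes> fst z)) (x, y) \<in> {y. \<exists>x. y = (x, x)}" by blast
    then show ?thesis by simp
  qed
  have K_inv: "inv x \<in> K" if "x \<in> K" for x
  proof -
    have "(\<lambda>x. inv x) ` closure S \<subseteq> K"
      by (rule image_closure_subset[OF continuous_on_subset[OF inv_cont]])
         (use K_sub S_inv S_K in \<open>auto simp: K_def\<close>)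
    then show ?thesis using that by (auto simp: K_def)
  qed
  have one_T: "\<one> \<in> T" using T'(1) by (rule subgroup.one_closed)
  have "subgroup K G"
    using K_sub K_mult K_inv one_T T_S S_K by (intro subgroupI) auto
  moreover have "compact K"
    using comp K_sub by (metis K_def closed_closure compact_Int_closed inf.absorb_iff2)
  ultimately have "torus_in G K" using conn K_comm by (simp add: torus_in_def)
  then have "K = T" using T T_S S_K by (auto simp: maximal_torus_def)
  moreover have "\<gamma> s \<in> S" for s
  proof -
    have "\<gamma> s = \<one> \<otimes> \<gamma> s" using \<gamma>c by simp
    then show ?thesis using one_T by (force simp: S_def)
  qed
  ultimately have "\<gamma> s \<in> T" for s using S_K by blast
  then have "exp_curve G c T X \<gamma>"
    using \<gamma> by (auto simp: exp_curve_def one_parameter_subgroup_def)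
  then show ?thesis using that by blast
qed

end


section \<open>Smoothness of the representation\<close>

lemma cinner_add_left: "cinner (x + y) z = cinner x z + cinner y z"
  and cinner_add_right: "cinner z (x + y) = cinner z x + cinner z y"
  and cinner_diff_left: "cinner (x - y) z = cinner x z - cinner y z"
  and cinner_diff_right: "cinner z (x - y) = cinner z x - cinner z y"
  and cinner_scale_left: "cinner (k *s x) z = k * cinner x z"
  and cinner_scale_right: "cinner z (k *s x) = cnj k * cinner z x"
  and cinner_minus_left: "cinner (- x) z = - cinner x z"
  and cinner_minus_right: "cinner z (- x) = - cinner z x"
  and cinner_zero_left [simp]: "cinner 0 z = 0"
  and cinner_zero_right [simp]: "cinner z 0 = 0"
  by (simp_all add: cinner_def algebra_simps sum.distrib sum_subtractf sum_distrib_left sum_negf)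

lemma cinner_commute: "cinner y x = cnj (cinner x y)"
  by (simp add: cinner_def mult.commute)

lemma Re_cinner: "Re (cinner x y) = x \<bullet> y"
  by (simp add: cinner_def inner_vec_def inner_complex_def)

lemma cinner_self: "cinner x x = of_real ((norm x)\<^sup>2)"
proof (rule complex_eqI)
  show "Re (cinner x x) = Re (of_real ((norm x)\<^sup>2))" by (simp add: Re_cinner power2_norm_eq_inner)
  have "cinner x x = cnj (cinner x x)" by (rule cinner_commute)
  from arg_cong[OF this, of Im] show "Im (cinner x x) = Im (of_real ((norm x)\<^sup>2))" by simp
qed

lemma cinner_eq_0_iff [simp]: "cinner x x = 0 \<longleftrightarrow> x = 0"
  by (simp add: cinner_self)

lemma cinner_eqI: "(\<And>z. cinner x z = cinner y z) \<Longrightarrow> x = y"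
  by (metis cinner_axis_right vec_eq_iff)

definition adj :: "complex ^ 'n ^ 'm \<Rightarrow> complex ^ 'm ^ 'n" where
  "adj A = (\<chi> i j. cnj (A $ j $ i))"

lemma cinner_adj: "cinner (A *v x) y = cinner x (adj A *v y)"
proof -
  have "cinner (A *v x) y = (\<Sum>i\<in>UNIV. \<Sum>j\<in>UNIV. A $ i $ j * x $ j * cnj (y $ i))"
    by (simp add: cinner_def matrix_vector_mult_def sum_distrib_right)
  also have "\<dots> = (\<Sum>j\<in>UNIV. \<Sum>i\<in>UNIV. A $ i $ j * x $ j * cnj (y $ i))" by (rule sum.swap)
  also have "\<dots> = cinner x (adj A *v y)"
    by (simp add: cinner_def matrix_vector_mult_def adj_def sum_distrib_left mult_ac)
  finally show ?thesis .
qed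

lemma adj_adj [simp]: "adj (adj A) = A"
  by (simp add: adj_def vec_eq_iff)

lemma cinner_adj': "cinner (adj A *v x) y = cinner x (A *v y)"
  by (simp add: cinner_adj)

lemma adj_eqI: "(\<And>x y. cinner (A *v x) y = cinner x (B *v y)) \<Longrightarrow> adj A = B"
  unfolding matrix_eq by (metis cinner_adj' cinner_eqI cinner_commute)

lemma adj_mult: "adj (A ** B) = adj B ** adj A"
  by (rule adj_eqI) (simp add: cinner_adj flip: matrix_vector_mul_assoc)

lemma bounded_linear_smult: "bounded_linear (\<lambda>x :: complex ^ 'n. z *s x)"
proof -
  have "linear (\<lambda>x :: complex ^ 'n. z *s x)"
    by (rule linearI) (simp_all add: vec_eq_iff algebra_simps)
  then show ?thesis by (rule linear_conv_bounded_linear[THEN iffD1])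
qed

lemma smult_scaleR: "complex_of_real r *s x = r *\<^sub>R x"
  unfolding vec_eq_iff vector_smult_component vector_scaleR_component by (simp add: scaleR_conv_of_real)

lemma matrix_mult_scaleR: "(A :: complex ^ 'n ^ 'm) *v (r *\<^sub>R x) = r *\<^sub>R (A *v x)"
  by (simp add: vec.scale flip: smult_scaleR)

lemma complex_subspace_real: "vec.subspace (V :: (complex ^ 'n) set) \<Longrightarrow> subspace V"
  unfolding subspace_def vec.subspace_def by (metis smult_scaleR)

lemma bounded_linear_matrix_vector: "bounded_linear (\<lambda>A :: complex ^ 'n ^ 'm. A *v x)"
proof -
  have "linear (\<lambda>A :: complex ^ 'n ^ 'm. A *v x)"
    by (rule linearI) (simp_all add: vec_eq_iff matrix_vector_mult_def algebra_simps sum.distrib scaleR_sum_right)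
  then show ?thesis by (rule linear_conv_bounded_linear[THEN iffD1])
qed

lemma bounded_linear_matrix_vector': "bounded_linear (\<lambda>x. (A :: complex ^ 'n ^ 'm) *v x)"
proof -
  have "linear (\<lambda>x. (A :: complex ^ 'n ^ 'm) *v x)"
    by (rule linearI) (simp_all add: matrix_vector_right_distrib matrix_mult_scaleR)
  then show ?thesis by (rule linear_conv_bounded_linear[THEN iffD1])
qed

text \<open>The matrix is reassembled from its columns, the values on the basis vectors.\<close>

lemma matrix_differentiable:
  fixes F :: "'a::real_normed_vector \<Rightarrow> complex ^ 'n ^ 'm"
  assumes "\<And>v. (\<lambda>x. F x *v v) differentiable (at a)"
  shows "F differentiable (at a)"
proof -
  define col :: "'n \<Rightarrow> complex ^ 'm \<Rightarrow> complex ^ 'n ^ 'm"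
    where "col j u = (\<chi> i k. if k = j then u $ i else 0)" for j u
  have "linear (col j)" for j
    by (rule linearI) (simp_all add: col_def vec_eq_iff)
  then have bl: "bounded_linear (col j)" for j by (rule linear_conv_bounded_linear[THEN iffD1])
  have "F x = (\<Sum>j\<in>UNIV. col j (F x *v axis j 1))" for x
    by (simp add: vec_eq_iff col_def matrix_vector_mult_def axis_def if_distrib cong: if_cong)
  moreover have "(\<lambda>x. \<Sum>j\<in>UNIV. col j (F x *v axis j 1)) differentiable (at a)"
    using assms bounded_linear.has_derivative[OF bl]
    by (intro differentiable_sum) (auto simp: differentiable_def, blast)
  ultimately show ?thesis by presburger
qed

section \<open>Uniform linearization and a C^1 cutoff\<close>

text \<open>Prepares differentiation under the Haar integral: the linearization in \<open>x\<close>
  is uniform for \<open>z\<close> near \<open>b\<close>. The derivative varies little along each of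
  finitely many coordinate directions, which bounds its variation in operator norm.\<close>

lemma C1_at_partial_uniform:
  fixes f :: "'a::{real_normed_vector,heine_borel} \<times> 'b::real_normed_vector \<Rightarrow> 'c::real_normed_vector"
  assumes fd: "finite B" "span B = (UNIV :: 'a set)" and f: "C1_at f (a, b)" and \<epsilon>: "\<epsilon> > 0"
  obtains \<delta> where "\<delta> > 0"
    "\<And>z. dist z b < \<delta> \<Longrightarrow> (\<lambda>x. f (x, z)) differentiable (at a)"
    "\<And>x z. dist z b < \<delta> \<Longrightarrow> norm (x - a) < \<delta> \<Longrightarrow>
      norm (f (x, z) - f (a, z) - frechet_derivative (\<lambda>x. f (x, z)) (at a) (x - a)) \<le> \<epsilon> * norm (x - a)"
proof -
  obtain S f' where S: "open S" "(a, b) \<in> S" "\<And>y. y \<in> S \<Longrightarrow> (f has_derivative f' y) (at y)"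
    "continuous_on (S \<times> UNIV) (\<lambda>(y, v). f' y v)"
    using f unfolding C1_at_def by blast
  obtain C :: "'a set" and u where C: "coordinates C u" using fd_coordinates[OF fd] .
  then have finC: "finite C" by (simp add: coordinates_def)
  have "\<exists>K. \<forall>x. \<bar>u x b\<bar> \<le> norm x * K" if "b \<in> C" for b
    using bounded_linear.bounded[of "\<lambda>x. u x b"] C that by (auto simp: coordinates_def)
  then obtain K where K: "\<And>b x. b \<in> C \<Longrightarrow> \<bar>u x b\<bar> \<le> norm x * K b" by metis
  \<comment> \<open>The summand \<open>1\<close> keeps \<open>M\<close> positive. The factor
    \<open>2\<close> in \<open>\<eta>\<close> is for the derivatives at \<open>(y, z)\<close> and at
    \<open>(a, z)\<close>, each compared with the one at \<open>(a, b)\<close>.\<close>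
  define M where "M = (\<Sum>b\<in>C. \<bar>K b\<bar>) + 1"
  have M: "M > 0" by (simp add: M_def add_nonneg_pos sum_nonneg)
  define \<eta> where "\<eta> = \<epsilon> / (2 * M)"
  have \<eta>: "\<eta> > 0" using \<epsilon> M by (simp add: \<eta>_def)
  have "\<forall>\<^sub>F w in nhds (a, b). norm (f' w (k, 0) - f' (a, b) (k, 0)) < \<eta>" for k
  proof -
    have "continuous_on S (\<lambda>y. (\<lambda>(y, v). f' y v) (y, (k, 0)))"
      by (rule continuous_on_compose2[OF S(4)]) (auto intro!: continuous_on_Pair continuous_on_id continuous_on_const)
    then have "isCont (\<lambda>y. f' y (k, 0)) (a, b)" using S(1,2) by (simp add: continuous_on_eq_continuous_at)
    then have "((\<lambda>y. f' y (k, 0)) \<longlongrightarrow> f' (a, b) (k, 0)) (nhds (a, b))" unfolding isCont_nhds .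
    from tendstoD[OF this \<eta>] show ?thesis by (simp add: dist_norm)
  qed
  then have "\<forall>\<^sub>F w in nhds (a, b). \<forall>k\<in>C. norm (f' w (k, 0) - f' (a, b) (k, 0)) < \<eta>"
    using finC by (simp add: eventually_ball_finite)
  moreover have "\<forall>\<^sub>F w in nhds (a, b). w \<in> S" using S(1,2) by (rule eventually_nhds_in_open)
  ultimately have "\<forall>\<^sub>F w in nhds (a, b). w \<in> S \<and> (\<forall>k\<in>C. norm (f' w (k, 0) - f' (a, b) (k, 0)) < \<eta>)"
    by eventually_elim simp
  then obtain d where d: "d > 0"
    "\<And>w. dist w (a, b) < d \<Longrightarrow> w \<in> S \<and> (\<forall>k\<in>C. norm (f' w (k, 0) - f' (a, b) (k, 0)) < \<eta>)"
    unfolding eventually_nhds_metric by blast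
  have near: "dist (x, z) (a, b) < d" if "dist z b < d / 2" "norm (x - a) < d / 2" for x z
    using norm_Pair_le[of "x - a" "z - b"] that by (simp add: dist_norm)
  have part: "((\<lambda>x. f (x, z)) has_derivative (\<lambda>h. f' (x, z) (h, 0))) (at x)" if "(x, z) \<in> S" for x z
    using has_derivative_compose[OF has_derivative_Pair[OF has_derivative_ident has_derivative_const] S(3)[OF that]] .
  have close: "norm (f' w (h, 0) - f' (a, b) (h, 0)) \<le> norm h * (M * \<eta>)" if w: "dist w (a, b) < d" for w h
  proof -
    have lin: "linear (\<lambda>h. f' w (h, 0) - f' (a, b) (h, 0))"
    proof -
      interpret w: bounded_linear "f' w" using S(3) d(2)[OF w] has_derivative_bounded_linear by blast
      interpret ab: bounded_linear "f' (a, b)" using S(2,3) has_derivative_bounded_linear by blast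
      show ?thesis
      proof (rule linearI)
        fix h k :: 'a and r :: real
        show "f' w (h + k, 0) - f' (a, b) (h + k, 0) = f' w (h, 0) - f' (a, b) (h, 0) + (f' w (k, 0) - f' (a, b) (k, 0))"
          using w.add[of "(h, 0)" "(k, 0)"] ab.add[of "(h, 0)" "(k, 0)"] by simp
        show "f' w (r *\<^sub>R h, 0) - f' (a, b) (r *\<^sub>R h, 0) = r *\<^sub>R (f' w (h, 0) - f' (a, b) (h, 0))"
          using w.scaleR[of r "(h, 0)"] ab.scaleR[of r "(h, 0)"] by (simp add: scaleR_diff_right)
      qed
    qed
    have "norm (f' w (h, 0) - f' (a, b) (h, 0)) = norm (\<Sum>k\<in>C. u h k *\<^sub>R (f' w (k, 0) - f' (a, b) (k, 0)))"
      by (simp only: coordinates_linear[OF C lin, of h])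
    also have "\<dots> \<le> (\<Sum>k\<in>C. norm (u h k *\<^sub>R (f' w (k, 0) - f' (a, b) (k, 0))))" by (rule norm_sum)
    also have "\<dots> \<le> (\<Sum>k\<in>C. (norm h * \<bar>K k\<bar>) * \<eta>)"
    proof (rule sum_mono)
      fix k assume k: "k \<in> C"
      have 1: "\<bar>u h k\<bar> \<le> norm h * \<bar>K k\<bar>"
        using K[OF k, of h] by (meson abs_ge_self mult_left_mono norm_ge_zero order_trans)
      have 2: "norm (f' w (k, 0) - f' (a, b) (k, 0)) \<le> \<eta>" using d(2)[OF w] k by (simp add: less_imp_le)
      show "norm (u h k *\<^sub>R (f' w (k, 0) - f' (a, b) (k, 0))) \<le> (norm h * \<bar>K k\<bar>) * \<eta>"
        unfolding norm_scaleR by (rule mult_mono[OF 1 2]) auto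
    qed
    also have "\<dots> = norm h * ((\<Sum>k\<in>C. \<bar>K k\<bar>) * \<eta>)"
      by (simp add: sum_distrib_left sum_distrib_right mult.assoc)
    also have "\<dots> \<le> norm h * (M * \<eta>)"
      using \<eta> by (intro mult_left_mono mult_right_mono) (auto simp: M_def)
    finally show ?thesis .
  qed
  show ?thesis
  proof (rule that[of "d / 2"])
    show "d / 2 > 0" using d(1) by simp
    fix z assume z: "dist z b < d / 2"
    have az: "(a, z) \<in> S" using d(2)[OF near[OF z, of a]] d(1) by simp
    show "(\<lambda>x. f (x, z)) differentiable (at a)" using part[OF az] by (auto simp: differentiable_def)
    fix x assume x: "norm (x - a) < d / 2"
    have fr: "frechet_derivative (\<lambda>x. f (x, z)) (at a) = (\<lambda>h. f' (a, z) (h, 0))"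
      using frechet_derivative_at[OF part[OF az]] by simp
    have "norm (f (x, z) - f (a, z) - (\<lambda>h. f' (a, z) (h, 0)) (x - a)) \<le> norm (x - a) * \<epsilon>"
    proof (rule differentiable_bound_linearization[where S="ball a (d / 2)" and f'="\<lambda>y h. f' (y, z) (h, 0)"])
      show "a + t *\<^sub>R (x - a) \<in> ball a (d / 2)" if "t \<in> {0..1}" for t
      proof -
        have "norm (t *\<^sub>R (x - a)) \<le> 1 * norm (x - a)" using that unfolding norm_scaleR by (intro mult_right_mono) auto
        then show ?thesis using x by (simp add: dist_norm)
      qed
      show "((\<lambda>x. f (x, z)) has_derivative (\<lambda>h. f' (y, z) (h, 0))) (at y within ball a (d / 2))"
        if "y \<in> ball a (d / 2)" for y
      proof -
        have "norm (y - a) < d / 2" using that by (simp add: dist_norm norm_minus_commute)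
        then have "(y, z) \<in> S" using d(2)[OF near[OF z]] by blast
        from has_derivative_at_withinI[OF part[OF this]] show ?thesis .
      qed
      show "onorm ((\<lambda>h. f' (y, z) (h, 0)) - (\<lambda>h. f' (a, z) (h, 0))) \<le> \<epsilon>" if y: "y \<in> ball a (d / 2)" for y
      proof (rule onorm_bound)
        show "0 \<le> \<epsilon>" using \<epsilon> by simp
        fix h
        have "norm (y - a) < d / 2" "norm (a - a) < d / 2" using y d(1) by (simp_all add: dist_norm norm_minus_commute)
        then have 1: "dist (y, z) (a, b) < d" "dist (a, z) (a, b) < d"
          using near[OF z] by blast+
        have "norm (f' (y, z) (h, 0) - f' (a, z) (h, 0)) =
            norm ((f' (y, z) (h, 0) - f' (a, b) (h, 0)) - (f' (a, z) (h, 0) - f' (a, b) (h, 0)))" by simp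
        also have "\<dots> \<le> norm h * (M * \<eta>) + norm h * (M * \<eta>)"
          by (rule order_trans[OF norm_triangle_ineq4 add_mono[OF close[OF 1(1)] close[OF 1(2)]]])
        also have "\<dots> = \<epsilon> * norm h" using M by (simp add: \<eta>_def)
        finally show "norm (((\<lambda>h. f' (y, z) (h, 0)) - (\<lambda>h. f' (a, z) (h, 0))) h) \<le> \<epsilon> * norm h" by simp
      qed
      show "a \<in> ball a (d / 2)" using d(1) by simp
    qed
    then show "norm (f (x, z) - f (a, z) - frechet_derivative (\<lambda>x. f (x, z)) (at a) (x - a)) \<le> \<epsilon> * norm (x - a)"
      by (simp add: fr mult.commute)
  qed
qed

lemma C1_at_real:
  fixes f :: "real \<Rightarrow> real"
  assumes "\<And>t. (f has_real_derivative f' t) (at t)" "continuous_on UNIV f'"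
  shows "C1_at f t"
  unfolding C1_at_def
proof (intro exI conjI ballI)
  show "(f has_derivative (\<lambda>v. f' y * v)) (at y)" for y
    using assms(1)[of y] by (simp add: has_field_derivative_def)
  show "continuous_on (UNIV \<times> UNIV) (\<lambda>(y, v). f' y * v)"
    unfolding case_prod_unfold
    by (intro continuous_on_mult continuous_on_compose2[OF assms(2)] continuous_on_fst continuous_on_snd continuous_on_id) auto
qed auto

text \<open>Squaring the positive part removes its corner; this is the profile of the bump
  below.\<close>

lemma C1_at_max_square: "C1_at (\<lambda>t :: real. (max 0 t)\<^sup>2) t"
proof (rule C1_at_real)
  fix t :: real
  consider "t > 0" | "t < 0" | "t = 0" by linarith
  then show "((\<lambda>t. (max 0 t)\<^sup>2) has_real_derivative 2 * max 0 t) (at t)"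
  proof cases
    case 1
    have "((\<lambda>t. t\<^sup>2) has_real_derivative 2 * max 0 t) (at t)" using 1 by (auto intro!: derivative_eq_intros)
    then show ?thesis
      by (rule has_field_derivative_transform_within_open[of _ _ _ "{0<..}"]) (use 1 in auto)
  next
    case 2
    have "((\<lambda>t. 0) has_real_derivative 2 * max 0 t) (at t)" using 2 by (auto intro!: derivative_eq_intros)
    then show ?thesis
      by (rule has_field_derivative_transform_within_open[of _ _ _ "{..<0}"]) (use 2 in auto)
  next
    case 3
    have "(\<lambda>h :: real. (max 0 h)\<^sup>2 / h) \<midarrow>0\<rightarrow> 0"
    proof (rule Lim_null_comparison)
      show "\<forall>\<^sub>F h in at 0. norm ((max 0 h)\<^sup>2 / h) \<le> \<bar>h\<bar>"
        by (rule always_eventually) (auto simp: max_def power2_eq_square)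
      show "(\<lambda>h::real. \<bar>h\<bar>) \<midarrow>0\<rightarrow> 0" by (rule tendsto_rabs_zero) simp
    qed
    then show ?thesis using 3 by (simp add: DERIV_def)
  qed
qed (intro continuous_intros)

section \<open>Unitary representations and Haar measure\<close>

locale lie_rep = lie_group_chart G \<A> c
  for G :: "('g::t2_space, 'm) monoid_scheme" (structure)
    and \<A> :: "('g, 'e::{real_normed_vector,heine_borel}) chart set" and c +
  fixes \<mu> :: "'g measure" and \<sigma> :: "'g \<Rightarrow> complex ^ 'n::finite ^ 'n"
  assumes comp: "compact (carrier G)" and haar: "normalized_haar G \<mu>"
    and rep: "unitary_rep G \<sigma>" and irred: "irreducible_on (carrier G) \<sigma> UNIV"
begin

lemma \<sigma>_mult: "g \<in> carrier G \<Longrightarrow> h \<in> carrier G \<Longrightarrow> \<sigma> (g \<otimes> h) = \<sigma> g ** \<sigma> h"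
  and \<sigma>_one: "\<sigma> \<one> = mat 1"
  and \<sigma>_cont: "continuous_on (carrier G) \<sigma>"
  and \<sigma>_unitary: "g \<in> carrier G \<Longrightarrow> cinner (\<sigma> g *v x) (\<sigma> g *v y) = cinner x y"
  using rep by (auto simp: unitary_rep_def)

lemma \<sigma>_inv: "g \<in> carrier G \<Longrightarrow> \<sigma> (inv g) ** \<sigma> g = mat 1" "g \<in> carrier G \<Longrightarrow> \<sigma> g ** \<sigma> (inv g) = mat 1"
  using \<sigma>_mult[of "inv g" g] \<sigma>_mult[of g "inv g"] \<sigma>_one by simp_all

lemma \<sigma>_inv_v: "g \<in> carrier G \<Longrightarrow> \<sigma> (inv g) *v (\<sigma> g *v x) = x" "g \<in> carrier G \<Longrightarrow> \<sigma> g *v (\<sigma> (inv g) *v x) = x"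
  by (simp_all add: matrix_vector_mul_assoc \<sigma>_inv)

lemma \<sigma>_mult_v: "g \<in> carrier G \<Longrightarrow> h \<in> carrier G \<Longrightarrow> \<sigma> (g \<otimes> h) *v x = \<sigma> g *v (\<sigma> h *v x)"
  by (simp add: \<sigma>_mult matrix_vector_mul_assoc)

lemma \<sigma>_norm: "g \<in> carrier G \<Longrightarrow> norm (\<sigma> g *v x) = norm x"
  using \<sigma>_unitary[of g x x] by (simp add: cinner_self power2_eq_iff_nonneg flip: of_real_power)

lemma \<sigma>_adj: "g \<in> carrier G \<Longrightarrow> adj (\<sigma> g) = \<sigma> (inv g)"
  by (rule adj_eqI) (metis \<sigma>_inv_v(2) \<sigma>_unitary inv_closed)

lemma irreducibleD: "vec.subspace W \<Longrightarrow> (\<And>g x. g \<in> carrier G \<Longrightarrow> x \<in> W \<Longrightarrow> \<sigma> g *v x \<in> W) \<Longrightarrow> x \<in> W \<Longrightarrow> x \<noteq> 0 \<Longrightarrow> W = UNIV"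
  using irred unfolding irreducible_on_def invariant_subspace_def by blast

lemma orbit_cont: "continuous_on (carrier G) (\<lambda>y. \<sigma> y *v v)"
  by (rule bounded_linear.continuous_on[OF bounded_linear_matrix_vector \<sigma>_cont])

lemma space_\<mu>: "space \<mu> = carrier G" and sets_\<mu>: "sets \<mu> = sets (restrict_space borel (carrier G))"
  and emeasure_\<mu>: "emeasure \<mu> (space \<mu>) = 1"
  using haar by (auto simp: normalized_haar_def)


lemma finite_\<mu>: "finite_measure \<mu>"
  by (rule finite_measureI) (simp add: emeasure_\<mu>)

lemma measurable_cont:
  fixes f :: "'g \<Rightarrow> 'b::topological_space"
  assumes "continuous_on (carrier G) f"
  shows "f \<in> borel_measurable \<mu>"
  using borel_measurable_continuous_on_restrict[OF assms] measurable_cong_sets[OF sets_\<mu> refl] by blast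

lemma integrable_cont:
  fixes f :: "'g \<Rightarrow> 'b::{banach,second_countable_topology}"
  assumes "continuous_on (carrier G) f"
  shows "integrable \<mu> f"
proof -
  have "bounded (f ` carrier G)"
    using compact_continuous_image[OF assms comp] compact_imp_bounded by blast
  then obtain M where "\<And>y. y \<in> carrier G \<Longrightarrow> norm (f y) \<le> M" unfolding bounded_iff by blast
  then show ?thesis
    by (intro finite_measure.integrable_const_bound[OF finite_\<mu>, of _ M] measurable_cont[OF assms] AE_I2)
      (simp add: space_\<mu>)
qed

lemma left_mult_cont: "g \<in> carrier G \<Longrightarrow> continuous_on (carrier G) (\<lambda>y. g \<otimes> y)"
  unfolding continuous_on_def
  by (intro ballI tendsto_mult_G tendsto_const tendsto_ident_at) (auto simp: eventually_at_filter)

lemma left_mult_measurable: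
  assumes "g \<in> carrier G" shows "(\<lambda>y. g \<otimes> y) \<in> measurable \<mu> \<mu>"
proof -
  have "(\<lambda>y. g \<otimes> y) \<in> measurable \<mu> (restrict_space borel (carrier G))"
    by (rule measurable_restrict_space2) (use assms measurable_cont[OF left_mult_cont[OF assms]] in \<open>auto simp: space_\<mu>\<close>)
  then show ?thesis using measurable_cong_sets[OF refl sets_\<mu>] by blast
qed

lemma distr_left_mult: "g \<in> carrier G \<Longrightarrow> distr \<mu> \<mu> (\<lambda>y. g \<otimes> y) = \<mu>"
  using haar by (auto simp: normalized_haar_def)

lemma haar_integral_left:
  fixes f :: "'g \<Rightarrow> 'b::{banach,second_countable_topology}"
  assumes "g \<in> carrier G" "f \<in> borel_measurable \<mu>"
  shows "(LINT y|\<mu>. f (g \<otimes> y)) = (LINT y|\<mu>. f y)"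
  using integral_distr[OF left_mult_measurable[OF assms(1)] assms(2)] distr_left_mult[OF assms(1)] by simp

text \<open>Haar measure charges every nonempty open set: finitely many translates of a null open
  set would cover the compact group.\<close>

lemma continuous_nonneg_integral_zero:
  fixes f :: "'g \<Rightarrow> real"
  assumes f: "continuous_on (carrier G) f" "\<And>y. y \<in> carrier G \<Longrightarrow> f y \<ge> 0"
    and zero: "(LINT y|\<mu>. f y) = 0" and y: "y \<in> carrier G"
  shows "f y = 0"
proof (rule ccontr)
  assume fy: "f y \<noteq> 0"
  define U where "U = {y \<in> carrier G. f y \<noteq> 0}"
  have ae: "AE y in \<mu>. f y = 0"
  proof -
    have "AE y in \<mu>. 0 \<le> f y" by (rule AE_I2) (simp add: space_\<mu> f(2))
    then show ?thesis using integral_nonneg_eq_0_iff_AE[OF integrable_cont[OF f(1)]] zero by simp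
  qed
  have Um: "U \<in> sets \<mu>"
    using measurable_sets[OF measurable_cont[OF f(1)], of "- {0}"]
    by (simp add: U_def space_\<mu> vimage_def Collect_conj_eq Int_commute)
  have U0: "emeasure \<mu> U = 0"
    using ae Um by (subst (asm) AE_iff_measurable[of U]) (auto simp: U_def space_\<mu>)
  have U_op: "openin (top_of_set (carrier G)) U"
    using continuous_openin_preimage_gen[OF f(1) open_Compl[OF closed_singleton], of 0]
    by (simp add: U_def vimage_def Collect_conj_eq)
  \<comment> \<open>The translate of \<open>U\<close> by \<open>inv g\<close>, null by left
    invariance.\<close>
  define V where "V g = {x \<in> carrier G. g \<otimes> x \<in> U}" for g
  have V0: "emeasure \<mu> (V g) = 0" "V g \<in> sets \<mu>" if "g \<in> carrier G" for g
  proof -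
    have eq: "(\<lambda>y. g \<otimes> y) -` U \<inter> space \<mu> = V g" by (auto simp: V_def space_\<mu>)
    show "V g \<in> sets \<mu>" using measurable_sets[OF left_mult_measurable[OF that] Um] eq by simp
    show "emeasure \<mu> (V g) = 0"
      using emeasure_distr[OF left_mult_measurable[OF that] Um] distr_left_mult[OF that] U0 eq by simp
  qed
  have V_op: "openin (top_of_set (carrier G)) (V g)" if "g \<in> carrier G" for g
  proof -
    have "V g = carrier G \<inter> (\<lambda>y. g \<otimes> y) -` U" by (auto simp: V_def)
    then show ?thesis
      using continuous_openin_preimage[OF left_mult_cont[OF that] _ U_op] that by auto
  qed
  have "carrier G \<subseteq> \<Union> (V ` carrier G)"
  proof
    fix x assume x: "x \<in> carrier G"
    have "(y \<otimes> inv x) \<otimes> x = y" using x y by (simp add: m_assoc)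
    then have "x \<in> V (y \<otimes> inv x)" using x y fy by (simp add: V_def U_def)
    then show "x \<in> \<Union> (V ` carrier G)" using x y by (intro UN_I[of "y \<otimes> inv x"]) auto
  qed
  moreover have "\<forall>D\<in>V ` carrier G. openin (top_of_set (carrier G)) D" using V_op by auto
  ultimately have "\<exists>\<D>\<subseteq>V ` carrier G. finite \<D> \<and> carrier G \<subseteq> \<Union> \<D>"
    using comp unfolding compact_eq_openin_cover by simp
  then obtain \<D> where \<D>: "\<D> \<subseteq> V ` carrier G" "finite \<D>" "carrier G \<subseteq> \<Union> \<D>" by auto
  have Dm: "D \<in> sets \<mu>" if "D \<in> \<D>" for D using that \<D>(1) V0 by auto
  have "emeasure \<mu> (carrier G) \<le> emeasure \<mu> (\<Union> \<D>)"
    using \<D> Dm by (intro emeasure_mono sets.finite_Union) auto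
  also have "\<dots> \<le> (\<Sum>D\<in>\<D>. emeasure \<mu> D)"
    using \<D>(2) Dm emeasure_subadditive_finite[of \<D> "\<lambda>D. D" \<mu>] by auto
  also have "\<dots> = 0" using \<D> V0 by (intro sum.neutral) auto
  finally show False using emeasure_\<mu> by (simp add: space_\<mu>)
qed

section \<open>Differentiable vectors\<close>

text \<open>A Garding vector. For a bump \<open>\<phi>\<close> near the identity, left invariance of
  the integral moves the action of \<open>inv (p x)\<close> from the orbit into the argument of
  \<open>\<phi>\<close>, where the derivative can be taken under the integral sign.\<close>

lemma smooth_vector_exists:
  assumes "inner_form (\<beta> :: 'e \<Rightarrow> 'e \<Rightarrow> real)"
  obtains w where "w \<noteq> 0" "(\<lambda>x. \<sigma> (inv (p x)) *v w) differentiable (at c0)"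
proof -
  interpret inner_form \<beta> by fact
  obtain B :: "'e set" where B: "finite B" "span B = UNIV" using fin_dim .
  define I where "I = snd c ` fst c"
  have I: "open I" "c0 \<in> I" using chart_image_open[OF c_in] c0_in by (auto simp: I_def)
  have pI: "x \<in> I \<Longrightarrow> p x \<in> fst c" for x using c_in by (auto simp: I_def)
  have pIc: "x \<in> I \<Longrightarrow> p x \<in> carrier G" for x using pI dom_c by blast
  \<comment> \<open>Any nonzero vector would do.\<close>
  define v :: "complex ^ 'n" where "v = axis undefined 1"
  have v: "v \<noteq> 0" by (simp add: v_def axis_eq_0_iff)
  have plim: "(p \<longlongrightarrow> \<one>) (nhds c0)" using G_deriv_D(2)[OF G_deriv_p] .
  have "((\<lambda>x. \<sigma> (p x) *v v) \<longlongrightarrow> \<sigma> \<one> *v v) (nhds c0)"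
    by (rule continuous_on_tendsto_compose[OF orbit_cont plim]) (use G_deriv_D(3)[OF G_deriv_p] in auto)
  then have "((\<lambda>x. (\<sigma> (p x) *v v) \<bullet> v) \<longlongrightarrow> v \<bullet> v) (nhds c0)"
    by (intro tendsto_inner tendsto_const) (simp add: \<sigma>_one)
  then have "\<forall>\<^sub>F x in nhds c0. (\<sigma> (p x) *v v) \<bullet> v > 0"
    by (rule order_tendstoD(1)) (simp add: v)
  moreover have "\<forall>\<^sub>F x in nhds c0. x \<in> I" using I by (rule eventually_nhds_in_open)
  ultimately have "\<forall>\<^sub>F x in nhds c0. x \<in> I \<and> (\<sigma> (p x) *v v) \<bullet> v > 0" by eventually_elim simp
  then obtain \<rho> where \<rho>: "\<rho> > 0" "\<And>x. dist x c0 < \<rho> \<Longrightarrow> x \<in> I \<and> (\<sigma> (p x) *v v) \<bullet> v > 0"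
    unfolding eventually_nhds_metric by blast
  obtain k where k: "k > 0" "\<And>x. k * (norm x)\<^sup>2 \<le> \<beta> x x" using coercive by metis
  \<comment> \<open>Coercivity then keeps the ellipsoid \<open>Q\<close> within distance
    \<open>\<rho> / 2\<close> of \<open>c0\<close>.\<close>
  define r where "r = k * (\<rho> / 2)\<^sup>2"
  have r0: "r > 0" using k \<rho> by (simp add: r_def)
  \<comment> \<open>The bump is built from \<open>\<beta>\<close>, since the norm of the model space
    need not be differentiable.\<close>
  define E where "E x = \<beta> (x - c0) (x - c0)" for x
  have E_cont: "continuous_on S E" for S
    unfolding E_def by (intro bb.continuous_on continuous_on_diff continuous_on_id continuous_on_const)
  define Q where "Q = {x. E x \<le> r}"
  have Q: "x \<in> I" "(\<sigma> (p x) *v v) \<bullet> v > 0" "dist x c0 \<le> \<rho> / 2" if "x \<in> Q" for x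
  proof -
    have "k * (norm (x - c0))\<^sup>2 \<le> k * (\<rho> / 2)\<^sup>2" using k(2)[of "x - c0"] that by (simp add: Q_def E_def r_def)
    then have "(norm (x - c0))\<^sup>2 \<le> (\<rho> / 2)\<^sup>2" using k(1) by simp
    then show d: "dist x c0 \<le> \<rho> / 2" using \<rho>(1) by (simp add: dist_norm power2_le_iff_abs_le)
    then have "dist x c0 < \<rho>" using \<rho>(1) by simp
    with \<rho>(2) show "x \<in> I" "(\<sigma> (p x) *v v) \<bullet> v > 0" by blast+
  qed
  have "closed Q" unfolding Q_def by (intro closed_Collect_le E_cont continuous_on_const)
  moreover have "bounded Q" unfolding bounded_def using Q(3) by (metis dist_commute)
  ultimately have "compact Q" by (simp add: compact_eq_bounded_closed)
  define K where "K = p ` Q"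
  have "continuous_on Q p"
    by (rule continuous_on_subset[OF param_cont[OF c_in]]) (use Q(1) in \<open>auto simp: I_def\<close>)
  then have K: "closed K" unfolding K_def using \<open>compact Q\<close> compact_continuous_image compact_imp_closed by blast
  have Kc: "g \<in> fst c" if "g \<in> K" for g using that Q(1) pI by (auto simp: K_def)
  define \<psi> where "\<psi> x = (max 0 (r - E x))\<^sup>2" for x
  \<comment> \<open>The extension by zero is continuous because \<open>\<phi>\<close> vanishes
    outside \<open>K\<close>, a closed subset of the group inside the chart.\<close>
  define \<phi> where "\<phi> g = (if g \<in> fst c then \<psi> (snd c g) else 0)" for g
  have \<phi>0: "\<phi> g = 0" if "g \<notin> K" for g
  proof (cases "g \<in> fst c")
    case True
    then have "snd c g \<notin> Q" using that c_in by (metis K_def chart_param imageI)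
    then show ?thesis by (simp add: \<phi>_def \<psi>_def Q_def max_def)
  qed (simp add: \<phi>_def)
  have C1E: "C1_at (\<lambda>x. r - E x) x" for x
    unfolding C1_at_def
  proof (intro exI conjI ballI)
    have "((\<lambda>x. \<beta> (x - c0) (x - c0)) has_derivative (\<lambda>h. \<beta> (y - c0) h + \<beta> h (y - c0))) (at y)" for y
      by (rule bb.FDERIV) (auto intro!: derivative_eq_intros)
    from has_derivative_diff[OF has_derivative_const this]
    show "((\<lambda>x. r - E x) has_derivative (\<lambda>h. 0 - (\<beta> (y - c0) h + \<beta> h (y - c0)))) (at y)" for y
      unfolding E_def .
    show "continuous_on (UNIV \<times> UNIV) (\<lambda>(y, h). 0 - (\<beta> (y - c0) h + \<beta> h (y - c0)))"
      unfolding case_prod_unfold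
      by (intro continuous_on_diff continuous_on_add bb.continuous_on continuous_on_fst continuous_on_snd continuous_on_id continuous_on_const)
  qed auto
  have C1\<psi>: "C1_at \<psi> x" for x
    unfolding \<psi>_def[abs_def] by (rule C1_at_compose[OF C1E C1_at_max_square])
  \<comment> \<open>Neighbourhoods within the group that, unlike those of
    \<open>at y within carrier G\<close>, contain the point itself.\<close>
  define N where "N y = inf (nhds y) (principal (carrier G))" for y
  have N_carr: "\<forall>\<^sub>F y' in N y. y' \<in> carrier G" for y
    unfolding N_def eventually_inf_principal by simp
  have N_lim: "((\<lambda>y. y) \<longlongrightarrow> y) (N y)" for y
    unfolding N_def by (simp add: filterlim_def)
  have \<phi>_lim: "(\<phi> \<longlongrightarrow> \<phi> g) (N g)" if g: "g \<in> carrier G" for g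
  proof (cases "g \<in> fst c")
    case True
    note dom = eventually_in_dom[OF N_lim N_carr c_in True]
    have "((\<lambda>h. \<psi> (snd c h)) \<longlongrightarrow> \<psi> (snd c g)) (N g)"
      using isCont_tendsto_compose[OF C1_at_isCont[OF C1\<psi>] tendsto_chart[OF N_lim N_carr c_in True]] .
    then show ?thesis
      by (rule Lim_transform_eventually[THEN tendsto_eq_rhs]) (use dom True in \<open>auto simp: \<phi>_def elim: eventually_mono\<close>)
  next
    case False
    then have gK: "g \<notin> K" using Kc by blast
    have "\<forall>\<^sub>F h in N g. h \<in> - K"
      using topological_tendstoD[OF N_lim open_Compl[OF K]] gK by blast
    then have "\<forall>\<^sub>F h in N g. 0 = \<phi> h" by eventually_elim (simp add: \<phi>0)
    from Lim_transform_eventually[OF tendsto_const this] show ?thesis by (simp add: \<phi>0[OF gK])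
  qed
  have \<phi>_cont: "continuous_on (carrier G) \<phi>"
    unfolding continuous_on_def
  proof
    fix g assume "g \<in> carrier G"
    moreover have "at g within carrier G \<le> N g" unfolding N_def at_within_def by (rule inf_mono) auto
    ultimately show "(\<phi> \<longlongrightarrow> \<phi> g) (at g within carrier G)" using \<phi>_lim tendsto_mono by blast
  qed
  define h where "h x y = \<phi> (p x \<otimes> y)" for x y
  define fd where "fd y = frechet_derivative (\<lambda>x. h x y) (at c0)" for y
  have h_cont: "continuous_on (carrier G) (h x)" if "x \<in> I" for x
    unfolding h_def by (rule continuous_on_compose2[OF \<phi>_cont left_mult_cont[OF pIc[OF that]]]) (use pIc[OF that] in auto)
  \<comment> \<open>A linearization estimate for a formula \<open>f\<close> carries over to
    \<open>h\<close> where the two agree near \<open>c0\<close>.\<close>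
  have agree: "(\<lambda>x. h x y) differentiable (at c0) \<and> (\<forall>x. norm (x - c0) < \<delta> \<longrightarrow>
        norm (h x y - h c0 y - fd y (x - c0)) \<le> \<epsilon> * norm (x - c0))"
    if \<delta>: "\<delta> > 0" and eq: "\<And>x. norm (x - c0) < \<delta> \<Longrightarrow> f x = h x y" and f: "f differentiable (at c0)"
      and b: "\<And>x. norm (x - c0) < \<delta> \<Longrightarrow> norm (f x - f c0 - frechet_derivative f (at c0) (x - c0)) \<le> \<epsilon> * norm (x - c0)"
    for \<delta> \<epsilon> y f
  proof -
    have "(f has_derivative frechet_derivative f (at c0)) (at c0)" using f frechet_derivative_works by blast
    then have d: "((\<lambda>x. h x y) has_derivative frechet_derivative f (at c0)) (at c0)"
      by (rule has_derivative_transform_within_open[of _ _ _ _ "ball c0 \<delta>"])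
         (use \<delta> eq in \<open>auto simp: dist_norm norm_minus_commute\<close>)
    then have "fd y = frechet_derivative f (at c0)" unfolding fd_def using frechet_derivative_at by metis
    with d b eq \<delta> show ?thesis by (auto simp: differentiable_def)
  qed
  \<comment> \<open>Inside the chart \<open>h\<close> has a C^1 formula in coordinates; outside,
    small translates of \<open>y\<close> avoid the support of \<open>\<phi>\<close> and
    \<open>h\<close> is zero.\<close>
  have loc: "\<exists>\<delta>>0. \<forall>\<^sub>F y in N y0. (\<lambda>x. h x y) differentiable (at c0) \<and> (\<forall>x. norm (x - c0) < \<delta> \<longrightarrow>
        norm (h x y - h c0 y - fd y (x - c0)) \<le> \<epsilon> * norm (x - c0))"
    if y0: "y0 \<in> carrier G" and \<epsilon>: "\<epsilon> > 0" for y0 \<epsilon>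
  proof (cases "y0 \<in> fst c")
    case True
    define z0 where "z0 = snd c y0"
    define f where "f = (\<lambda>w. \<psi> ((\<lambda>(x, z). snd c (p x \<otimes> p z)) w))"
    have "C1_at f (c0, z0)"
      unfolding f_def z0_def
      by (rule C1_at_compose[OF C1_mult[of c c c \<one> y0] C1\<psi>]) (use c_in one_c True y0 in auto)
    then obtain \<delta>1 where \<delta>1: "\<delta>1 > 0"
      "\<And>z. dist z z0 < \<delta>1 \<Longrightarrow> (\<lambda>x. f (x, z)) differentiable (at c0)"
      "\<And>x z. dist z z0 < \<delta>1 \<Longrightarrow> norm (x - c0) < \<delta>1 \<Longrightarrow>
         norm (f (x, z) - f (c0, z) - frechet_derivative (\<lambda>x. f (x, z)) (at c0) (x - c0)) \<le> \<epsilon> * norm (x - c0)"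
      using C1_at_partial_uniform[OF B _ \<epsilon>, of f c0 z0 thesis] by blast
    have "G_C1_at (\<lambda>w. p (fst w) \<otimes> p (snd w)) (c0, z0)"
      by (intro G_C1_at_mult G_C1_at_compose[OF C1_at_fst G_C1_at_param] G_C1_at_compose[OF C1_at_snd G_C1_at_param])
         (use c_in c0_in True in \<open>auto simp: z0_def\<close>)
    from G_C1_at_D(4)[OF this c_in]
    have "\<forall>\<^sub>F w in nhds (c0, z0). p (fst w) \<otimes> p (snd w) \<in> fst c" using True c_in y0 by (simp add: z0_def)
    then obtain d where d: "d > 0" "\<And>w. dist w (c0, z0) < d \<Longrightarrow> p (fst w) \<otimes> p (snd w) \<in> fst c"
      unfolding eventually_nhds_metric by blast
    define \<delta> where "\<delta> = min \<delta>1 (d / 2)"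
    have \<delta>: "\<delta> > 0" using \<delta>1 d by (simp add: \<delta>_def)
    note lim = tendsto_chart[OF N_lim N_carr c_in True]
    have "\<forall>\<^sub>F y in N y0. dist (snd c y) z0 < \<delta>" using tendstoD[OF lim \<delta>] by (simp add: z0_def)
    then have "\<forall>\<^sub>F y in N y0. (\<lambda>x. h x y) differentiable (at c0) \<and> (\<forall>x. norm (x - c0) < \<delta> \<longrightarrow>
        norm (h x y - h c0 y - fd y (x - c0)) \<le> \<epsilon> * norm (x - c0))"
      using eventually_in_dom[OF N_lim N_carr c_in True]
    proof eventually_elim
      case (elim y)
      have z: "dist (snd c y) z0 < \<delta>1" using elim by (simp add: \<delta>_def)
      show ?case
      proof (rule agree[OF \<delta> _ \<delta>1(2)[OF z]])
        fix x assume x: "norm (x - c0) < \<delta>"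
        have "dist (x, snd c y) (c0, z0) < d"
          using norm_Pair_le[of "x - c0" "snd c y - z0"] x elim by (simp add: dist_norm \<delta>_def)
        from d(2)[OF this] show "f (x, snd c y) = h x y" using elim c_in by (simp add: f_def h_def \<phi>_def)
        show "norm (f (x, snd c y) - f (c0, snd c y) - frechet_derivative (\<lambda>x. f (x, snd c y)) (at c0) (x - c0)) \<le> \<epsilon> * norm (x - c0)"
          by (rule \<delta>1(3)[OF z]) (use x in \<open>simp add: \<delta>_def\<close>)
      qed
    qed
    then show ?thesis using \<delta> by blast
  next
    case False
    then have yK: "y0 \<notin> K" using Kc by blast
    have "((\<lambda>w. p (fst w) \<otimes> snd w) \<longlongrightarrow> \<one> \<otimes> y0) (nhds c0 \<times>\<^sub>F N y0)"
    proof (rule tendsto_mult_G)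
      show "((\<lambda>w. p (fst w)) \<longlongrightarrow> \<one>) (nhds c0 \<times>\<^sub>F N y0)" using filterlim_compose[OF plim filterlim_fst] .
      show "(snd \<longlongrightarrow> y0) (nhds c0 \<times>\<^sub>F N y0)" using filterlim_compose[OF N_lim filterlim_snd] .
      show "\<forall>\<^sub>F w in nhds c0 \<times>\<^sub>F N y0. p (fst w) \<in> carrier G"
        using eventually_compose_filterlim[OF G_deriv_D(3)[OF G_deriv_p] filterlim_fst] .
      show "\<forall>\<^sub>F w in nhds c0 \<times>\<^sub>F N y0. snd w \<in> carrier G"
        using eventually_compose_filterlim[OF N_carr filterlim_snd] .
    qed (use y0 in auto)
    from topological_tendstoD[OF this open_Compl[OF K]]
    have "\<forall>\<^sub>F w in nhds c0 \<times>\<^sub>F N y0. p (fst w) \<otimes> snd w \<in> - K" using y0 yK by simp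
    then obtain P Q where P: "eventually P (nhds c0)" and Q: "eventually Q (N y0)"
      and PQ: "\<And>x y. P x \<Longrightarrow> Q y \<Longrightarrow> p x \<otimes> y \<notin> K"
      unfolding eventually_prod_filter by auto
    obtain \<delta> where \<delta>: "\<delta> > 0" "\<And>x. dist x c0 < \<delta> \<Longrightarrow> P x"
      using P unfolding eventually_nhds_metric by blast
    have "\<forall>\<^sub>F y in N y0. (\<lambda>x. h x y) differentiable (at c0) \<and> (\<forall>x. norm (x - c0) < \<delta> \<longrightarrow>
        norm (h x y - h c0 y - fd y (x - c0)) \<le> \<epsilon> * norm (x - c0))"
      using Q
    proof eventually_elim
      case (elim y)
      show ?case
      proof (rule agree[OF \<delta>(1), of "\<lambda>_. 0"])
        fix x assume "norm (x - c0) < \<delta>"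
        then have "P x" using \<delta>(2) by (simp add: dist_norm)
        then show "0 = h x y" using PQ elim \<phi>0 by (simp add: h_def)
        have "frechet_derivative (\<lambda>_. 0 :: real) (at c0) = (\<lambda>_. 0)"
          using frechet_derivative_at[OF has_derivative_const] by metis
        then show "norm (0 - 0 - frechet_derivative (\<lambda>_. 0 :: real) (at c0) (x - c0)) \<le> \<epsilon> * norm (x - c0)"
          using \<epsilon> by simp
      qed simp
    qed
    then show ?thesis using \<delta>(1) by blast
  qed
  \<comment> \<open>Compactness of the group makes the linearization uniform in
    \<open>y\<close>.\<close>
  have unif: "\<exists>\<delta>>0. \<forall>y\<in>carrier G. (\<lambda>x. h x y) differentiable (at c0) \<and> (\<forall>x. norm (x - c0) < \<delta> \<longrightarrow>
        norm (h x y - h c0 y - fd y (x - c0)) \<le> \<epsilon> * norm (x - c0))" if \<epsilon>: "\<epsilon> > 0" for \<epsilon>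
  proof -
    define P where "P \<delta> y \<longleftrightarrow> (\<lambda>x. h x y) differentiable (at c0) \<and> (\<forall>x. norm (x - c0) < \<delta> \<longrightarrow>
        norm (h x y - h c0 y - fd y (x - c0)) \<le> \<epsilon> * norm (x - c0))" for \<delta> y
    have "\<exists>\<delta> U. \<delta> > 0 \<and> open U \<and> y0 \<in> U \<and> (\<forall>y\<in>U. y \<in> carrier G \<longrightarrow> P \<delta> y)" if y0: "y0 \<in> carrier G" for y0
    proof -
      obtain \<delta> where \<delta>: "\<delta> > 0" "\<forall>\<^sub>F y in N y0. P \<delta> y" using loc[OF y0 \<epsilon>] unfolding P_def by blast
      then obtain S where "open S" "y0 \<in> S" "\<forall>y\<in>S. y \<in> carrier G \<longrightarrow> P \<delta> y"
        unfolding N_def eventually_inf_principal eventually_nhds by blast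
      with \<delta>(1) show ?thesis by blast
    qed
    then obtain \<delta> U where \<delta>U: "\<And>y0. y0 \<in> carrier G \<Longrightarrow>
        \<delta> y0 > 0 \<and> open (U y0) \<and> y0 \<in> U y0 \<and> (\<forall>y\<in>U y0. y \<in> carrier G \<longrightarrow> P (\<delta> y0) y)"
      by metis
    obtain D where D: "D \<subseteq> carrier G" "finite D" "carrier G \<subseteq> (\<Union>y\<in>D. U y)"
      by (rule compactE_image[OF comp, of "carrier G" U]) (use \<delta>U in blast)+
    define \<delta>' where "\<delta>' = Min (insert 1 (\<delta> ` D))"
    have "\<delta>' > 0" using D \<delta>U by (auto simp: \<delta>'_def)
    moreover have "P \<delta>' y" if y: "y \<in> carrier G" for y
    proof -
      obtain y0 where y0: "y0 \<in> D" "y \<in> U y0" using D(3) y by blast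
      then have "P (\<delta> y0) y" using \<delta>U D(1) y by blast
      moreover have "\<delta>' \<le> \<delta> y0" using y0 D by (simp add: \<delta>'_def)
      ultimately show ?thesis unfolding P_def by (meson less_le_trans)
    qed
    ultimately show ?thesis unfolding P_def by blast
  qed
  have fd_lin: "linear (fd y)" if "y \<in> carrier G" for y
  proof -
    have "(\<lambda>x. h x y) differentiable (at c0)" using unif[OF zero_less_one] that by blast
    then show ?thesis unfolding fd_def using frechet_derivative_works has_derivative_linear by blast
  qed
  \<comment> \<open>As a uniform limit of difference quotients the derivative is continuous in
    \<open>y\<close>, hence can be integrated.\<close>
  have fd_cont: "continuous_on (carrier G) (\<lambda>y. fd y l)" for l
  proof (rule uniform_limit_theorem)
    have "(\<lambda>n. c0 + (1 / real n) *\<^sub>R l) \<longlonglongrightarrow> c0 + 0 *\<^sub>R l"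
      by (intro tendsto_intros lim_1_over_n)
    then have lim: "(\<lambda>n. c0 + (1 / real n) *\<^sub>R l) \<longlonglongrightarrow> c0" by simp
    have "\<forall>\<^sub>F n in sequentially. c0 + (1 / real n) *\<^sub>R l \<in> I"
      using topological_tendstoD[OF lim I] .
    then show "\<forall>\<^sub>F n in sequentially. continuous_on (carrier G) (\<lambda>y. real n * (h (c0 + (1 / real n) *\<^sub>R l) y - h c0 y))"
      by eventually_elim (intro continuous_on_mult continuous_on_diff continuous_on_const h_cont I)
    show "uniform_limit (carrier G) (\<lambda>n y. real n * (h (c0 + (1 / real n) *\<^sub>R l) y - h c0 y)) (\<lambda>y. fd y l) sequentially"
    proof (rule uniform_limitI)
      fix e :: real assume e: "e > 0"
      have l1: "norm l + 1 > 0" by (simp add: add_nonneg_pos)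
      obtain \<delta> where \<delta>: "\<delta> > 0" "\<And>y x. y \<in> carrier G \<Longrightarrow> norm (x - c0) < \<delta> \<Longrightarrow>
        norm (h x y - h c0 y - fd y (x - c0)) \<le> e / (norm l + 1) * norm (x - c0)"
        using unif[OF divide_pos_pos[OF e l1]] by blast
      have "\<forall>\<^sub>F n in sequentially. norm (c0 + (1 / real n) *\<^sub>R l - c0) < \<delta>"
        using tendstoD[OF lim \<delta>(1)] by (simp add: dist_norm)
      then show "\<forall>\<^sub>F n in sequentially. \<forall>y\<in>carrier G. dist (real n * (h (c0 + (1 / real n) *\<^sub>R l) y - h c0 y)) (fd y l) < e"
        using eventually_gt_at_top[of 0]
      proof eventually_elim
        case (elim n)
        show ?case
        proof
          fix y assume y: "y \<in> carrier G"
          let ?x = "c0 + (1 / real n) *\<^sub>R l"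
          have "fd y (?x - c0) = (1 / real n) * fd y l" using linear_scale[OF fd_lin[OF y]] by simp
          then have "real n * (h ?x y - h c0 y) - fd y l = real n * (h ?x y - h c0 y - fd y (?x - c0))"
            using elim(2) by (simp add: right_diff_distrib)
          then have "dist (real n * (h ?x y - h c0 y)) (fd y l) = real n * norm (h ?x y - h c0 y - fd y (?x - c0))"
            by (simp add: dist_norm abs_mult)
          also have "\<dots> \<le> real n * (e / (norm l + 1) * norm (?x - c0))"
            by (intro mult_left_mono \<delta>(2)[OF y elim(1)]) simp
          also have "\<dots> = e * (norm l / (norm l + 1))" using elim(2) by simp
          also have "\<dots> < e * 1" using e l1 by (intro mult_strict_left_mono) auto
          finally show "dist (real n * (h ?x y - h c0 y)) (fd y l) < e" by simp
        qed
      qed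
    qed
  qed simp
  define w where "w = (LINT y|\<mu>. \<phi> y *\<^sub>R (\<sigma> y *v v))"
  define \<Phi> where "\<Phi> x = (LINT y|\<mu>. h x y *\<^sub>R (\<sigma> y *v v))" for x
  define L where "L l = (LINT y|\<mu>. fd y l *\<^sub>R (\<sigma> y *v v))" for l
  have int_fd: "integrable \<mu> (\<lambda>y. fd y l *\<^sub>R (\<sigma> y *v v))" for l
    by (intro integrable_cont continuous_on_scaleR fd_cont orbit_cont)
  have int_h: "integrable \<mu> (\<lambda>y. h x y *\<^sub>R (\<sigma> y *v v))" if "x \<in> I" for x
    by (intro integrable_cont continuous_on_scaleR h_cont[OF that] orbit_cont)
  have int_\<phi>: "integrable \<mu> (\<lambda>y. \<phi> y *\<^sub>R (\<sigma> y *v v))"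
    by (intro integrable_cont continuous_on_scaleR \<phi>_cont orbit_cont)
  have "linear L"
  proof (rule linearI)
    fix a b :: 'e and s :: real
    have "L (a + b) = (LINT y|\<mu>. fd y a *\<^sub>R (\<sigma> y *v v) + fd y b *\<^sub>R (\<sigma> y *v v))"
      unfolding L_def
      by (rule Bochner_Integration.integral_cong[OF refl]) (simp add: space_\<mu> linear_add[OF fd_lin] scaleR_add_left)
    then show "L (a + b) = L a + L b" unfolding L_def by (simp add: Bochner_Integration.integral_add[OF int_fd int_fd])
    have "L (s *\<^sub>R a) = (LINT y|\<mu>. s *\<^sub>R (fd y a *\<^sub>R (\<sigma> y *v v)))"
      unfolding L_def
      by (rule Bochner_Integration.integral_cong[OF refl]) (simp add: space_\<mu> linear_scale[OF fd_lin])
    then show "L (s *\<^sub>R a) = s *\<^sub>R L a" unfolding L_def by (simp del: scaleR_scaleR)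
  qed
  then have L_bl: "bounded_linear L" using fd_linear_bounded[OF B] by blast
  have "(\<Phi> has_derivative L) (at c0)"
    unfolding has_derivative_at_alt
  proof (intro conjI L_bl allI impI)
    fix e :: real assume e: "e > 0"
    have v1: "norm v + 1 > 0" by (simp add: add_nonneg_pos)
    obtain \<delta> where \<delta>: "\<delta> > 0" "\<And>y x. y \<in> carrier G \<Longrightarrow> norm (x - c0) < \<delta> \<Longrightarrow>
      norm (h x y - h c0 y - fd y (x - c0)) \<le> e / (norm v + 1) * norm (x - c0)"
      using unif[OF divide_pos_pos[OF e v1]] by blast
    obtain d where d: "d > 0" "ball c0 d \<subseteq> I" using I open_contains_ball by blast
    show "\<exists>d>0. \<forall>x. norm (x - c0) < d \<longrightarrow> norm (\<Phi> x - \<Phi> c0 - L (x - c0)) \<le> e * norm (x - c0)"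
    proof (intro exI[of _ "min \<delta> d"] conjI allI impI)
      show "min \<delta> d > 0" using \<delta> d by simp
      fix x assume x: "norm (x - c0) < min \<delta> d"
      then have xI: "x \<in> I" using d(2) by (auto simp: dist_norm norm_minus_commute)
      have int: "integrable \<mu> (\<lambda>y. h x y *\<^sub>R (\<sigma> y *v v) - h c0 y *\<^sub>R (\<sigma> y *v v) - fd y (x - c0) *\<^sub>R (\<sigma> y *v v))"
        by (intro Bochner_Integration.integrable_diff int_h int_fd xI I)
      have "\<Phi> x - \<Phi> c0 - L (x - c0) = (LINT y|\<mu>. h x y *\<^sub>R (\<sigma> y *v v) - h c0 y *\<^sub>R (\<sigma> y *v v) - fd y (x - c0) *\<^sub>R (\<sigma> y *v v))"
        unfolding \<Phi>_def L_def
        by (simp add: Bochner_Integration.integral_diff Bochner_Integration.integrable_diff int_h int_fd xI I)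
      also have "norm \<dots> \<le> (LINT y|\<mu>. e / (norm v + 1) * norm (x - c0) * norm v)"
      proof (rule order_trans[OF integral_norm_bound integral_mono[OF integrable_norm[OF int]]])
        show "integrable \<mu> (\<lambda>y. e / (norm v + 1) * norm (x - c0) * norm v)"
          by (rule integrable_cont) (rule continuous_on_const)
        fix y assume "y \<in> space \<mu>"
        then have y: "y \<in> carrier G" by (simp add: space_\<mu>)
        have "norm (h x y *\<^sub>R (\<sigma> y *v v) - h c0 y *\<^sub>R (\<sigma> y *v v) - fd y (x - c0) *\<^sub>R (\<sigma> y *v v)) =
            norm (h x y - h c0 y - fd y (x - c0)) * norm v"
          by (simp add: \<sigma>_norm[OF y] flip: scaleR_diff_left)
        also have "\<dots> \<le> e / (norm v + 1) * norm (x - c0) * norm v"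
          using \<delta>(2)[OF y, of x] x by (intro mult_right_mono) auto
        finally show "norm (h x y *\<^sub>R (\<sigma> y *v v) - h c0 y *\<^sub>R (\<sigma> y *v v) - fd y (x - c0) *\<^sub>R (\<sigma> y *v v)) \<le>
          e / (norm v + 1) * norm (x - c0) * norm v" .
      qed
      also have "\<dots> = e / (norm v + 1) * norm (x - c0) * norm v"
        by (simp add: measure_def emeasure_\<mu>)
      also have "\<dots> = (e * norm (x - c0)) * (norm v / (norm v + 1))" by simp
      also have "\<dots> \<le> (e * norm (x - c0)) * 1"
        using e v1 by (intro mult_left_mono) auto
      finally show "norm (\<Phi> x - \<Phi> c0 - L (x - c0)) \<le> e * norm (x - c0)" by simp
    qed
  qed
  \<comment> \<open>Substituting \<open>p x \<otimes> y\<close> for \<open>y\<close> cancels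
    \<open>\<sigma> (inv (p x))\<close> and leaves the translated bump \<open>h x\<close>.\<close>
  moreover have "\<Phi> x = \<sigma> (inv (p x)) *v w" if x: "x \<in> I" for x
  proof -
    note g = pIc[OF x]
    let ?F = "\<lambda>y. \<phi> y *\<^sub>R (\<sigma> (inv (p x)) *v (\<sigma> y *v v))"
    have Fm: "?F \<in> borel_measurable \<mu>"
      by (intro measurable_cont continuous_on_scaleR \<phi>_cont bounded_linear.continuous_on[OF bounded_linear_matrix_vector'] orbit_cont)
    have "\<sigma> (inv (p x)) *v w = (LINT y|\<mu>. \<sigma> (inv (p x)) *v (\<phi> y *\<^sub>R (\<sigma> y *v v)))"
      unfolding w_def by (rule integral_bounded_linear[OF bounded_linear_matrix_vector' int_\<phi>, symmetric])
    also have "\<dots> = (LINT y|\<mu>. ?F y)" by (simp add: matrix_mult_scaleR)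
    also have "\<dots> = (LINT y|\<mu>. ?F (p x \<otimes> y))" by (rule haar_integral_left[OF g Fm, symmetric])
    also have "\<dots> = \<Phi> x"
      unfolding \<Phi>_def h_def
      by (rule Bochner_Integration.integral_cong[OF refl]) (use g in \<open>simp add: space_\<mu> \<sigma>_mult_v \<sigma>_inv_v\<close>)
    finally show ?thesis ..
  qed
  ultimately have "((\<lambda>x. \<sigma> (inv (p x)) *v w) has_derivative L) (at c0)"
    by (rule has_derivative_transform_within_open[OF _ I]) auto
  then have diff: "(\<lambda>x. \<sigma> (inv (p x)) *v w) differentiable (at c0)" by (auto simp: differentiable_def)
  \<comment> \<open>On the support of \<open>\<phi>\<close> the orbit has positive inner product
    with \<open>v\<close>. Pairing \<open>w\<close> with \<open>v\<close> thus integrates a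
    nonnegative function that is positive at the identity.\<close>
  have "w \<noteq> 0"
  proof
    assume "w = 0"
    have "(LINT y|\<mu>. \<phi> y * ((\<sigma> y *v v) \<bullet> v)) = (LINT y|\<mu>. (\<phi> y *\<^sub>R (\<sigma> y *v v)) \<bullet> v)" by simp
    also have "\<dots> = w \<bullet> v" unfolding w_def by (rule integral_inner_left) (rule int_\<phi>)
    finally have zero: "(LINT y|\<mu>. \<phi> y * ((\<sigma> y *v v) \<bullet> v)) = 0" using \<open>w = 0\<close> by simp
    have nn: "\<phi> y * ((\<sigma> y *v v) \<bullet> v) \<ge> 0" for y
    proof (cases "y \<in> K")
      case True
      then have "(\<sigma> y *v v) \<bullet> v > 0" using Q(2) by (auto simp: K_def)
      then show ?thesis by (simp add: \<phi>_def \<psi>_def)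
    qed (simp add: \<phi>0)
    have "\<phi> \<one> * ((\<sigma> \<one> *v v) \<bullet> v) = 0"
      by (rule continuous_nonneg_integral_zero[OF _ _ zero])
         (auto intro!: continuous_on_mult \<phi>_cont continuous_on_inner orbit_cont continuous_on_const nn)
    then show False using r0 v one_c by (simp add: \<sigma>_one \<phi>_def \<psi>_def E_def bb.zero_left)
  qed
  with diff show ?thesis using that by blast
qed

text \<open>The differentiable vectors form an invariant subspace, nonzero by averaging and hence
  everything.\<close>

lemma \<sigma>_differentiable:
  assumes "inner_form (\<beta> :: 'e \<Rightarrow> 'e \<Rightarrow> real)"
  shows "(\<lambda>x. \<sigma> (p x)) differentiable (at c0)"
proof -
  define W where "W = {w. (\<lambda>x. \<sigma> (inv (p x)) *v w) differentiable (at c0)}"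
  obtain w0 where w0: "w0 \<noteq> 0" "w0 \<in> W" using smooth_vector_exists[OF assms] by (auto simp: W_def)
  have "vec.subspace W"
  proof (rule vec.subspaceI)
    show "0 \<in> W" by (simp add: W_def)
    show "x + y \<in> W" if "x \<in> W" "y \<in> W" for x y
      using that by (simp add: W_def matrix_vector_right_distrib)
    show "z *s x \<in> W" if "x \<in> W" for z x
      using that bounded_linear.has_derivative[OF bounded_linear_smult, of _ _ _ z]
      unfolding W_def differentiable_def mem_Collect_eq vec.scale by blast
  qed
  moreover have "\<sigma> g *v w \<in> W" if g: "g \<in> carrier G" and w: "w \<in> W" for g w
  proof -
    obtain D where D: "((\<lambda>x. \<sigma> (inv (p x)) *v w) has_derivative D) (at c0)"
      using w by (auto simp: W_def differentiable_def)
    \<comment> \<open>Moving \<open>\<sigma> g\<close> past \<open>\<sigma> (inv (p y))\<close>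
      conjugates the argument, so the derivative at \<open>\<sigma> g *v w\<close> is the one at
      \<open>w\<close> composed with Ad and followed by \<open>\<sigma> g\<close>.\<close>
    note F = G_deriv_conj_p[OF inv_closed[OF g]]
    have "((\<lambda>y. \<sigma> (inv (inv g \<otimes> p y \<otimes> inv (inv g))) *v w) has_derivative (\<lambda>h. D (Ad G c (inv g) h))) (at c0)"
      by (rule G_deriv_chain[OF F, of "\<lambda>k. \<sigma> (inv k) *v w", OF D])
    from bounded_linear.has_derivative[OF bounded_linear_matrix_vector' this, of "\<sigma> g"]
    have "((\<lambda>y. \<sigma> g *v (\<sigma> (inv (inv g \<otimes> p y \<otimes> inv (inv g))) *v w)) has_derivative (\<lambda>h. \<sigma> g *v D (Ad G c (inv g) h))) (at c0)" .
    then have "((\<lambda>y. \<sigma> (inv (p y)) *v (\<sigma> g *v w)) has_derivative (\<lambda>h. \<sigma> g *v D (Ad G c (inv g) h))) (at c0)"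
    proof (rule has_derivative_transform_within_open[OF _ chart_image_open[OF c_in] c0_in])
      fix y assume "y \<in> snd c ` fst c"
      then have y: "p y \<in> carrier G" using c_in dom_c by auto
      have "inv (inv g \<otimes> p y \<otimes> inv (inv g)) = inv g \<otimes> inv (p y) \<otimes> g"
        using g y by (simp add: inv_mult_group m_assoc)
      then have "\<sigma> g *v (\<sigma> (inv (inv g \<otimes> p y \<otimes> inv (inv g))) *v w) = \<sigma> g *v (\<sigma> (inv g) *v (\<sigma> (inv (p y)) *v (\<sigma> g *v w)))"
        using g y by (simp add: \<sigma>_mult_v)
      then show "\<sigma> g *v (\<sigma> (inv (inv g \<otimes> p y \<otimes> inv (inv g))) *v w) = \<sigma> (inv (p y)) *v (\<sigma> g *v w)"
        using g by (simp add: \<sigma>_inv_v)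
    qed
    then show ?thesis by (auto simp: W_def differentiable_def)
  qed
  ultimately have W: "W = UNIV" using irreducibleD w0 by blast
  show ?thesis
  proof (rule matrix_differentiable)
    fix v
    have "v \<in> W" by (simp add: W)
    then obtain D where D: "((\<lambda>x. \<sigma> (inv (p x)) *v v) has_derivative D) (at c0)"
      by (auto simp: W_def differentiable_def)
    \<comment> \<open>The inverse built into \<open>W\<close> is removed by a second inversion, at
      the cost of a sign.\<close>
    have "((\<lambda>y. \<sigma> (inv (inv (p y))) *v v) has_derivative (\<lambda>h. D (- h))) (at c0)"
      by (rule G_deriv_chain[OF G_deriv_inv[OF G_deriv_p], of "\<lambda>k. \<sigma> (inv k) *v v", OF D])
    then have "((\<lambda>y. \<sigma> (p y) *v v) has_derivative (\<lambda>h. D (- h))) (at c0)"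
      by (rule has_derivative_transform_within_open[OF _ chart_image_open[OF c_in] c0_in])
         (use c_in dom_c in auto)
    then show "(\<lambda>x. \<sigma> (p x) *v v) differentiable (at c0)" by (auto simp: differentiable_def)
  qed
qed

end


section \<open>The infinitesimal representation and the roots\<close>

text \<open>Integrating \<open>f (t + u)\<close> over \<open>u\<close> in \<open>{0..a}\<close>
  multiplies \<open>f t\<close> by a nonzero constant \<open>K\<close>. The same integral has moving
  endpoints \<open>t\<close> and \<open>a + t\<close>, so it is differentiable in
  \<open>t\<close>.\<close>

lemma continuous_hom_differentiable:
  fixes f :: "real \<Rightarrow> complex"
  assumes cont: "continuous_on UNIV f" and hom: "\<And>s t. f (s + t) = f s * f t" and one: "f 0 = 1"
  obtains d where "(f has_vector_derivative d) (at 0)"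
proof -
  have contA: "continuous_on A f" for A using cont continuous_on_subset by blast
  have "isCont f 0" using cont by (simp add: continuous_on_eq_continuous_at)
  then obtain e where e: "e > 0" "\<And>t. dist t 0 < e \<Longrightarrow> dist (f t) 1 < 1 / 2"
    unfolding continuous_at_eps_delta one by (metis half_gt_zero zero_less_one)
  \<comment> \<open>On \<open>{0..a}\<close> the values of \<open>f\<close> stay within
    \<open>1 / 2\<close> of \<open>1\<close>, which keeps \<open>K\<close> away from zero.\<close>
  define a where "a = min (e / 2) 1"
  have a: "a > 0" "a \<le> 1" "a < e" using e(1) by (auto simp: a_def)
  define K where "K = integral {0..a} f"
  have "K - of_real a = integral {0..a} (\<lambda>t. f t - 1)"
    unfolding K_def using a
    by (subst integral_diff) (auto intro!: integrable_continuous_interval contA simp: scaleR_conv_of_real)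
  also have "norm \<dots> \<le> 1 / 2 * (a - 0)"
  proof (rule integral_bound)
    show "norm (f t - 1) \<le> 1 / 2" if "t \<in> {0..a}" for t
      using e(2)[of t] a that by (auto simp: dist_norm less_imp_le)
  qed (use a in \<open>auto intro!: continuous_on_diff contA\<close>)
  finally have "norm (K - of_real a) \<le> a / 2" by simp
  then have K: "K \<noteq> 0" using a by auto
  \<comment> \<open>The base point \<open>-1\<close> leaves room for negative
    \<open>t\<close>.\<close>
  define F where "F x = integral {-1..x} f" for x
  have F: "(F has_vector_derivative f x) (at x)" if "x \<in> {-1<..<3}" for x
  proof -
    have "(F has_vector_derivative f x) (at x within {-1..3})"
      unfolding F_def using that by (intro integral_has_vector_derivative contA) auto
    moreover have "at x within {-1..3} = at x"
      using that by (intro at_within_interior) auto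
    ultimately show ?thesis by simp
  qed
  have eq: "f t = (F (a + t) - F t) / K" if t: "t \<in> {-1<..<1}" for t
  proof -
    have "f t * K = integral {0..a} (f \<circ> (\<lambda>u. u + t))" by (simp add: K_def o_def hom mult.commute)
    also have "\<dots> = integral {0 + t..a + t} f"
      by (rule integral_shift[OF contA])
    also have "\<dots> = F (a + t) - F t"
    proof -
      have "integral {-1..t} f + integral {t..a + t} f = integral {-1..a + t} f"
        by (rule Henstock_Kurzweil_Integration.integral_combine) (use t a in \<open>auto intro!: integrable_continuous_interval contA\<close>)
      then show ?thesis by (simp add: F_def algebra_simps)
    qed
    finally show ?thesis using K by (simp add: field_simps)
  qed
  have "((\<lambda>t. F (a + t)) has_vector_derivative f a) (at 0)"
  proof -
    have "((\<lambda>t :: real. a + t) has_derivative (\<lambda>h. h)) (at 0)" by (auto intro!: derivative_eq_intros)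
    moreover have "(F has_derivative (\<lambda>h. h *\<^sub>R f a)) (at (a + 0))"
      using F[of a] a by (simp add: has_vector_derivative_def)
    ultimately show ?thesis unfolding has_vector_derivative_def by (rule has_derivative_compose)
  qed
  moreover have "(F has_vector_derivative f 0) (at 0)" by (rule F) simp
  ultimately have "((\<lambda>t. (F (a + t) - F t) * inverse K) has_vector_derivative (f a - f 0) * inverse K) (at 0)"
    by (intro has_vector_derivative_mult_left has_vector_derivative_diff)
  then have "(f has_vector_derivative (f a - f 0) * inverse K) (at 0)"
    by (rule has_vector_derivative_transform_within_open[of _ _ _ "{-1<..<1}"])
       (use eq in \<open>auto simp: divide_inverse\<close>)
  then show ?thesis using that by blast
qed

text \<open>Difference quotients stay in the closed subspace. This is how invariance under the group
  passes to its Lie algebra.\<close>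

lemma derivative_in_subspace:
  fixes F :: "'a::real_normed_vector \<Rightarrow> 'b::real_normed_vector"
  assumes F: "(F has_derivative F') (at x)" and ev: "\<forall>\<^sub>F y in nhds x. F y \<in> S" and S: "subspace S" "closed S"
  shows "F' h \<in> S"
proof (rule ccontr)
  assume no: "F' h \<notin> S"
  interpret F': bounded_linear F' using F by (rule has_derivative_bounded_linear)
  have h: "norm h > 0" using no S(1) F'.zero subspace_0 by force
  obtain d where d: "d > 0" "ball (F' h) d \<subseteq> - S"
    using no S(2) by (metis ComplI open_Compl open_contains_ball)
  have "d / 2 / norm h > 0" using d h by simp
  then obtain e1 where e1: "e1 > 0" "\<And>y. norm (y - x) < e1 \<Longrightarrow> norm (F y - F x - F' (y - x)) \<le> d / 2 / norm h * norm (y - x)"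
    using F unfolding has_derivative_at_alt by blast
  obtain e2 where e2: "e2 > 0" "\<And>y. dist y x < e2 \<Longrightarrow> F y \<in> S"
    using ev unfolding eventually_nhds_metric by blast
  define t where "t = min e1 e2 / 2 / norm h"
  have t: "t > 0" using e1 e2 h by (simp add: t_def)
  have "t * norm h = min e1 e2 / 2" using h by (simp add: t_def)
  then have th: "norm (t *\<^sub>R h) < e1" "norm (t *\<^sub>R h) < e2" using t e1(1) e2(1) by auto
  have FS: "F (x + t *\<^sub>R h) \<in> S" "F x \<in> S" using e2 th by (auto simp: dist_norm)
  define u where "u = inverse t *\<^sub>R (F (x + t *\<^sub>R h) - F x)"
  have uS: "u \<in> S" unfolding u_def using FS S(1) by (intro subspace_scale subspace_diff)
  have "u - F' h = inverse t *\<^sub>R (F (x + t *\<^sub>R h) - F x - F' (x + t *\<^sub>R h - x))"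
    using t by (simp add: u_def F'.scaleR scaleR_diff_right)
  then have "norm (u - F' h) = inverse t * norm (F (x + t *\<^sub>R h) - F x - F' (x + t *\<^sub>R h - x))"
    using t by simp
  also have "\<dots> \<le> inverse t * (d / 2 / norm h * norm (x + t *\<^sub>R h - x))"
    using t th by (intro mult_left_mono e1(2)) auto
  also have "\<dots> = d / 2" using t h by simp
  finally have "u \<in> ball (F' h) d" using d(1) by (simp add: dist_norm norm_minus_commute)
  then show False using uS d(2) by blast
qed

lemma matrix_scaleR_left: "(r *\<^sub>R A) ** B = r *\<^sub>R (A ** (B :: complex ^ 'n ^ 'm))"
  and matrix_scaleR_right: "A ** (r *\<^sub>R B) = r *\<^sub>R (A ** (B :: complex ^ 'n ^ 'm))"
  by (simp_all add: vec_eq_iff matrix_matrix_mult_def scaleR_sum_right)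

lemma matrix_scaleR_vector: "(r *\<^sub>R A) *v x = r *\<^sub>R (A *v (x :: complex ^ 'n))"
  by (simp add: vec_eq_iff matrix_vector_mult_def scaleR_sum_right)

lemma bounded_bilinear_matrix_mult: "bounded_bilinear ((**) :: complex ^ 'n ^ 'm \<Rightarrow> complex ^ 'k ^ 'n \<Rightarrow> complex ^ 'k ^ 'm)"
  unfolding bilinear_conv_bounded_bilinear[symmetric] bilinear_def
  by (auto intro!: linearI simp: matrix_scaleR_left matrix_scaleR_right)
     (simp_all add: vec_eq_iff matrix_matrix_mult_def algebra_simps sum.distrib)

lemma bounded_linear_adj: "bounded_linear (adj :: complex ^ 'n ^ 'm \<Rightarrow> complex ^ 'm ^ 'n)"
  unfolding linear_conv_bounded_linear[symmetric]
  by (rule linearI) (simp_all add: adj_def vec_eq_iff)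

locale lie_rep_form = lie_rep G \<A> c \<mu> \<sigma>
  for G :: "('g::t2_space, 'm) monoid_scheme" (structure)
    and \<A> :: "('g, 'e::{real_normed_vector,heine_borel}) chart set" and c and \<mu>
    and \<sigma> :: "'g \<Rightarrow> complex ^ 'n::finite ^ 'n" +
  fixes \<beta> :: "'e \<Rightarrow> 'e \<Rightarrow> real"
  assumes form: "Ad_invariant_inner G c \<beta>"
begin

lemma inner_form_\<beta>: "inner_form \<beta>"
proof -
  obtain B :: "'e set" where B: "finite B" "span B = UNIV" using fin_dim .
  show ?thesis
    using form fd_bilinear_bounded[OF B, of \<beta>] unfolding Ad_invariant_inner_def
    by (intro inner_form.intro) blast+
qed

sublocale inner_form \<beta> by (rule inner_form_\<beta>)

lemma Ad_isometry: "g \<in> carrier G \<Longrightarrow> \<beta> (Ad G c g X) (Ad G c g Y) = \<beta> X Y"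
  using form by (auto simp: Ad_invariant_inner_def)

definition D where "D = frechet_derivative (\<lambda>x. \<sigma> (p x)) (at c0)"

lemma D_deriv: "((\<lambda>x. \<sigma> (p x)) has_derivative D) (at c0)"
  unfolding D_def using \<sigma>_differentiable[OF inner_form_\<beta>] frechet_derivative_works by blast

lemma D_bl: "bounded_linear D"
  using D_deriv by (rule has_derivative_bounded_linear)

lemma D_linear: "linear D"
  using D_bl by (rule bounded_linear.linear)

lemma D_chain: "G_deriv F x A \<Longrightarrow> ((\<lambda>y. \<sigma> (F y)) has_derivative (\<lambda>h. D (A h))) (at x)"
  using G_deriv_chain[of F x A \<sigma> D] D_deriv by blast

lemma D_inv: "((\<lambda>x. \<sigma> (inv (p x))) has_derivative (\<lambda>h. - D h)) (at c0)"
  using D_chain[OF G_deriv_inv[OF G_deriv_p]] by (simp add: linear_neg[OF D_linear])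

text \<open>Differentiate \<open>adj (\<sigma> g) = \<sigma> (inv g)\<close>.\<close>

lemma D_adj: "adj (D X) = - D X"
proof -
  have "((\<lambda>x. adj (\<sigma> (p x))) has_derivative (\<lambda>h. adj (D h))) (at c0)"
    by (rule bounded_linear.has_derivative[OF bounded_linear_adj D_deriv])
  then have "((\<lambda>x. \<sigma> (inv (p x))) has_derivative (\<lambda>h. adj (D h))) (at c0)"
    by (rule has_derivative_transform_within_open[OF _ chart_image_open[OF c_in] c0_in])
       (use c_in dom_c \<sigma>_adj in auto)
  from fun_cong[OF has_derivative_unique[OF this D_inv]] show ?thesis .
qed

lemma conj_deriv: "((\<lambda>x. \<sigma> (p x) ** M ** \<sigma> (inv (p x))) has_derivative (\<lambda>h. D h ** M - M ** D h)) (at c0)"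
proof -
  have "((\<lambda>x. \<sigma> (p x) ** M) has_derivative (\<lambda>h. D h ** M)) (at c0)"
    by (rule bounded_linear.has_derivative[OF bounded_bilinear.bounded_linear_left[OF bounded_bilinear_matrix_mult] D_deriv])
  from bounded_bilinear.FDERIV[OF bounded_bilinear_matrix_mult this D_inv]
  have "((\<lambda>x. (\<sigma> (p x) ** M) ** \<sigma> (inv (p x))) has_derivative
      (\<lambda>h. (\<sigma> (p c0) ** M) ** (- D h) + (D h ** M) ** \<sigma> (inv (p c0)))) (at c0)" .
  moreover have "(\<sigma> (p c0) ** M) ** (- D h) + (D h ** M) ** \<sigma> (inv (p c0)) = D h ** M - M ** D h" for h
    by (simp add: \<sigma>_one bounded_bilinear.minus_right[OF bounded_bilinear_matrix_mult])
  ultimately show ?thesis by simp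
qed

lemma D_Ad:
  assumes g: "g \<in> carrier G" shows "D (Ad G c g X) = \<sigma> g ** D X ** \<sigma> (inv g)"
proof -
  have "((\<lambda>x. \<sigma> (g \<otimes> p x \<otimes> inv g)) has_derivative (\<lambda>h. D (Ad G c g h))) (at c0)"
    by (rule D_chain[OF G_deriv_conj_p[OF g]])
  then have 1: "((\<lambda>x. \<sigma> g ** \<sigma> (p x) ** \<sigma> (inv g)) has_derivative (\<lambda>h. D (Ad G c g h))) (at c0)"
    by (rule has_derivative_transform_within_open[OF _ chart_image_open[OF c_in] c0_in])
       (use c_in dom_c g \<sigma>_mult in auto)
  have "((\<lambda>x. \<sigma> g ** \<sigma> (p x)) has_derivative (\<lambda>h. \<sigma> g ** D h)) (at c0)"
    by (rule bounded_linear.has_derivative[OF bounded_bilinear.bounded_linear_right[OF bounded_bilinear_matrix_mult] D_deriv])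
  from bounded_linear.has_derivative[OF bounded_bilinear.bounded_linear_left[OF bounded_bilinear_matrix_mult] this]
  have "((\<lambda>x. \<sigma> g ** \<sigma> (p x) ** \<sigma> (inv g)) has_derivative (\<lambda>h. \<sigma> g ** D h ** \<sigma> (inv g))) (at c0)" .
  from fun_cong[OF has_derivative_unique[OF 1 this]] show ?thesis .
qed

lemma eventually_p_carrier: "\<forall>\<^sub>F x in nhds c0. p x \<in> carrier G"
  by (rule G_deriv_D(3)[OF G_deriv_p])

text \<open>The commutator is the derivative of \<open>\<sigma> g ** D Y ** \<sigma> (inv g)\<close>
  in \<open>g\<close>. This matrix is \<open>D (Ad G c g Y)\<close>, so the curve, and with it the
  derivative, stays in the range of \<open>D\<close>. Existence of \<open>Z\<close> replaces a Lie
  bracket.\<close>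

lemma D_bracket: "\<exists>Z. D X ** D Y - D Y ** D X = D Z"
proof -
  have "(\<lambda>h. D h ** D Y - D Y ** D h) X \<in> range D"
  proof (rule derivative_in_subspace[OF conj_deriv])
    show "\<forall>\<^sub>F x in nhds c0. \<sigma> (p x) ** D Y ** \<sigma> (inv (p x)) \<in> range D"
      using eventually_p_carrier by eventually_elim (metis D_Ad rangeI)
    show "subspace (range D)" by (rule linear_subspace_image[OF D_linear subspace_UNIV])
    then show "closed (range D)" by (rule closed_subspace)
  qed
  then show ?thesis by auto
qed

definition dop where "dop Z x = D (fst Z) *v x + \<i> *s (D (snd Z) *v x)"

lemma dop_derived_rep: "derived_rep G c \<sigma> Z v = dop Z v"
proof -
  have "((\<lambda>x. \<sigma> (p x) *v v) has_derivative (\<lambda>h. D h *v v)) (at c0)"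
    by (rule bounded_linear.has_derivative[OF bounded_linear_matrix_vector D_deriv])
  from frechet_derivative_at[OF this, symmetric] show ?thesis by (simp add: derived_rep_def dop_def Let_def)
qed

text \<open>\<open>J\<close> is the multiplication by $i$ and \<open>cj\<close> the conjugation of pairs \<open>(X, Y)\<close> standing
  for $X + iY$.\<close>

definition "J Z = (- snd Z, fst Z)" for Z :: "'e \<times> 'e"
definition "cj Z = (fst Z, - snd Z)" for Z :: "'e \<times> 'e"

lemma cj_cj [simp]: "cj (cj Z) = Z" by (simp add: cj_def)

lemma dop_J: "dop (J Z) x = \<i> *s dop Z x"
  by (simp add: dop_def J_def linear_neg[OF D_linear] vec.scale_right_distrib vec_eq_iff
        matrix_vector_mult_def sum_negf algebra_simps)

lemma dop_add: "dop (Z + Z') x = dop Z x + dop Z' x"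
  by (simp add: dop_def linear_add[OF D_linear] matrix_vector_mult_add_rdistrib vec.scale_right_distrib)

lemma dop_scaleR: "dop (r *\<^sub>R Z) x = r *\<^sub>R dop Z x"
  by (simp add: dop_def linear_scale[OF D_linear] matrix_scaleR_vector vec_eq_iff algebra_simps)

lemma dop_zero: "dop 0 x = 0"
  using dop_scaleR[of 0 0 x] by simp

text \<open>\<open>D X\<close> is skew-adjoint, and moving i to the second slot conjugates the
  pair.\<close>

lemma cinner_dop: "cinner (dop Z x) y = - cinner x (dop (cj Z) y)"
proof -
  have "cinner (D X *v x) y = - cinner x (D X *v y)" for X x y
  proof -
    have "cinner (D X *v x) y = cinner x ((- D X) *v y)" by (simp add: cinner_adj D_adj)
    moreover have "(- D X) *v y = - (D X *v y)" by (simp add: vec_eq_iff matrix_vector_mult_def sum_negf)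
    ultimately show ?thesis by (simp add: cinner_minus_right)
  qed
  moreover have "D (- X) *v y = - (D X *v y)" for X y
    by (simp add: linear_neg[OF D_linear] vec_eq_iff matrix_vector_mult_def sum_negf)
  ultimately show ?thesis
    by (simp add: dop_def cj_def cinner_add_left cinner_add_right cinner_diff_right cinner_scale_left cinner_scale_right cinner_minus_right)
qed

lemma dop_commute: "\<exists>Z''. \<forall>x. dop Z (dop Z' x) = dop Z' (dop Z x) + dop Z'' x"
proof -
  have "\<exists>W. \<forall>x. D X *v (D Y *v x) = D Y *v (D X *v x) + D W *v x" for X Y
  proof -
    obtain W where "D X ** D Y - D Y ** D X = D W" using D_bracket by blast
    then have "D X ** D Y = D Y ** D X + D W" by (simp add: algebra_simps)
    then show ?thesis by (metis matrix_vector_mul_assoc matrix_vector_mult_add_rdistrib)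
  qed
  then obtain W where W: "\<And>X Y x. D X *v (D Y *v x) = D Y *v (D X *v x) + D (W X Y) *v x" by metis
  obtain X Y X' Y' where Z: "Z = (X, Y)" "Z' = (X', Y')" by (metis surj_pair)
  \<comment> \<open>The pair consists of the real and imaginary parts of the bracket of
    \<open>X + iY\<close> and \<open>X' + iY'\<close>, with \<open>W\<close> in place of the real
    bracket.\<close>
  have "dop Z (dop Z' x) = dop Z' (dop Z x) + dop (W X X' - W Y Y', W X Y' + W Y X') x" for x
    by (simp add: Z dop_def matrix_vector_right_distrib vec.scale W[of X X'] W[of X Y'] W[of Y X'] W[of Y Y']
         linear_add[OF D_linear] linear_diff[OF D_linear] matrix_vector_mult_add_rdistrib matrix_vector_mult_diff_rdistrib
         vec.scale_right_distrib)
  then show ?thesis by blast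
qed

end

section \<open>The highest-weight vector and its isotropy algebra\<close>

locale weight_rep = lie_rep_form G \<A> c \<mu> \<sigma> \<beta>
  for G :: "('g::t2_space, 'm) monoid_scheme" (structure)
    and \<A> :: "('g, 'e::{real_normed_vector,heine_borel}) chart set" and c and \<mu>
    and \<sigma> :: "'g \<Rightarrow> complex ^ 'n::finite ^ 'n" and \<beta> +
  fixes T P lam v0
  assumes T: "maximal_torus G T" and P: "positive_root_system G c T P"
    and v0: "highest_weight_vector G c T P \<sigma> lam v0"
begin

lemma T_subgroup: "subgroup T G" and T_comm: "s \<in> T \<Longrightarrow> t \<in> T \<Longrightarrow> s \<otimes> t = t \<otimes> s"
  using T by (auto simp: maximal_torus_def torus_in_def)

lemma T_carrier: "T \<subseteq> carrier G"
  using T_subgroup by (rule subgroup.subset)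

lemma T_in: "t \<in> T \<Longrightarrow> t \<in> carrier G"
  using T_carrier by blast

text \<open>\<open>\<nu> X\<close> is the derivative of the character along a chosen curve. The
  choice is immaterial because the curve with velocity \<open>X\<close> is unique, and the
  derivative exists because a continuous homomorphism on the line is differentiable.\<close>

lemma char_exp_exists:
  assumes \<xi>: "torus_character G T \<xi>"
  obtains \<nu> where "char_exp G c T \<nu> \<xi>"
proof -
  define \<nu> where "\<nu> X = (if \<exists>\<gamma>. exp_curve G c T X \<gamma>
    then vector_derivative (\<lambda>s. \<xi> ((SOME \<gamma>. exp_curve G c T X \<gamma>) s)) (at 0) else 0)" for X
  have "((\<lambda>s. \<xi> (\<gamma> s)) has_vector_derivative \<nu> X) (at 0)" if \<gamma>: "exp_curve G c T X \<gamma>" for X \<gamma>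
  proof -
    have "exp_curve G c T X (SOME \<gamma>. exp_curve G c T X \<gamma>)"
      using someI[of "exp_curve G c T X", OF \<gamma>] .
    then have some: "(SOME \<gamma>. exp_curve G c T X \<gamma>) = \<gamma>"
      using exp_curve_unique \<gamma> T_carrier by blast
    have "continuous_on UNIV (\<lambda>s. \<xi> (\<gamma> s))"
      using \<xi> exp_curve_in[OF \<gamma>] unfolding torus_character_def
      by (intro continuous_on_compose2[OF _ exp_curve_cont[OF \<gamma>]]) auto
    moreover have "\<xi> (\<gamma> (s + t)) = \<xi> (\<gamma> s) * \<xi> (\<gamma> t)" for s t
      using \<xi> exp_curve_in[OF \<gamma>] by (simp add: torus_character_def exp_curve_add[OF \<gamma>])
    moreover have "\<xi> (\<gamma> 0) = 1"
    proof -
      have "\<xi> (\<gamma> 0) * \<xi> (\<gamma> 0) = \<xi> (\<gamma> 0)"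
        using \<open>\<And>t s. \<xi> (\<gamma> (s + t)) = \<xi> (\<gamma> s) * \<xi> (\<gamma> t)\<close>[of 0 0] by simp
      moreover have "cmod (\<xi> (\<gamma> 0)) = 1" using \<xi> exp_curve_in[OF \<gamma>] by (simp add: torus_character_def)
      ultimately show ?thesis by force
    qed
    ultimately obtain d where d: "((\<lambda>s. \<xi> (\<gamma> s)) has_vector_derivative d) (at 0)"
      using continuous_hom_differentiable[of "\<lambda>s. \<xi> (\<gamma> s)"] by blast
    have "\<nu> X = d" using \<gamma> vector_derivative_at[OF d] unfolding \<nu>_def some by auto
    then show ?thesis using d by simp
  qed
  moreover have "\<nu> X = 0" if "X \<notin> lie_algebra G c T" for X
    using that by (simp add: \<nu>_def lie_algebra_def)
  ultimately have "char_exp G c T \<nu> \<xi>" using \<xi> by (simp add: char_exp_def)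
  then show ?thesis using that by blast
qed

text \<open>Serves to pass from a root outside \<open>P\<close> to its negative.\<close>

lemma char_exp_cnj:
  assumes "char_exp G c T \<nu> \<xi>" and im: "\<And>t. t \<in> T \<Longrightarrow> \<xi> t \<noteq> 0"
  shows "char_exp G c T (\<lambda>X. - \<nu> X) (\<lambda>t. inverse (\<xi> t))"
proof -
  have \<xi>: "torus_character G T \<xi>" "\<And>X. X \<notin> lie_algebra G c T \<Longrightarrow> \<nu> X = 0"
    "\<And>X \<gamma>. exp_curve G c T X \<gamma> \<Longrightarrow> ((\<lambda>s. \<xi> (\<gamma> s)) has_vector_derivative \<nu> X) (at 0)"
    using assms by (auto simp: char_exp_def)
  have "torus_character G T (\<lambda>t. inverse (\<xi> t))"
    using \<xi>(1) im by (auto simp: torus_character_def norm_inverse intro!: continuous_on_inverse)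
  moreover have "((\<lambda>s. inverse (\<xi> (\<gamma> s))) has_vector_derivative - \<nu> X) (at 0)" if \<gamma>: "exp_curve G c T X \<gamma>" for X \<gamma>
  proof -
    have "\<xi> \<one> = 1"
    proof -
      have "\<one> \<in> T" using T_subgroup by (rule subgroup.one_closed)
      then have "\<xi> (\<one> \<otimes> \<one>) = \<xi> \<one> * \<xi> \<one>" "\<xi> \<one> \<noteq> 0"
        using \<xi>(1) im unfolding torus_character_def by blast+
      then show ?thesis by simp
    qed
    then have "\<xi> (\<gamma> 0) = 1" using exp_curve_0[OF \<gamma> T_carrier] by simp
    moreover have "((\<lambda>s. inverse (\<xi> (\<gamma> s))) has_derivative (\<lambda>h. - (inverse (\<xi> (\<gamma> 0)) * (h *\<^sub>R \<nu> X) * inverse (\<xi> (\<gamma> 0))))) (at 0)"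
      by (rule Deriv.has_derivative_inverse) (use \<xi>(3)[OF \<gamma>] \<open>\<xi> (\<gamma> 0) = 1\<close> in \<open>auto simp: has_vector_derivative_def\<close>)
    ultimately show ?thesis by (simp add: has_vector_derivative_def)
  qed
  ultimately show ?thesis using \<xi>(2) by (simp add: char_exp_def)
qed

text \<open>The isotropy algebra of the line of \<open>v0\<close> in the complexified Lie algebra.
  It contains the complexified torus algebra and the positive root vectors, so it is a parabolic
  subalgebra.\<close>

definition "stab_alg = {Z. \<exists>k. dop Z v0 = k *s v0}"

lemma stab_alg_subspace: "subspace stab_alg"
proof (rule subspaceI)
  show "0 \<in> stab_alg" by (auto simp: stab_alg_def dop_zero intro!: exI[of _ 0])
  show "x + y \<in> stab_alg" if xy: "x \<in> stab_alg" "y \<in> stab_alg" for x y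
  proof -
    obtain k k' where "dop x v0 = k *s v0" "dop y v0 = k' *s v0" using xy by (auto simp: stab_alg_def)
    then have "dop (x + y) v0 = (k + k') *s v0" by (simp add: dop_add vec.scale_left_distrib)
    then show ?thesis unfolding stab_alg_def by blast
  qed
  show "r *\<^sub>R x \<in> stab_alg" if x: "x \<in> stab_alg" for r x
  proof -
    obtain k where "dop x v0 = k *s v0" using x by (auto simp: stab_alg_def)
    then have "dop (r *\<^sub>R x) v0 = (of_real r * k) *s v0"
      unfolding dop_scaleR smult_scaleR[symmetric] by simp
    then show ?thesis unfolding stab_alg_def by blast
  qed
qed

lemma stab_alg_J: "Z \<in> stab_alg \<Longrightarrow> J Z \<in> stab_alg"
  by (auto simp: stab_alg_def dop_J)

lemma weight_v0:
  obtains \<xi>0 where "\<And>t. t \<in> T \<Longrightarrow> \<sigma> t *v v0 = \<xi>0 t *s v0"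
  using v0 by (auto simp: highest_weight_vector_def)

abbreviation "AdC \<equiv> Ad_complex G c"

lemma stab_alg_Ad: assumes t: "t \<in> T" and Z: "Z \<in> stab_alg" shows "AdC t Z \<in> stab_alg"
proof -
  obtain \<xi>0 where \<xi>0: "\<And>t. t \<in> T \<Longrightarrow> \<sigma> t *v v0 = \<xi>0 t *s v0" using weight_v0 by blast
  have it: "inv t \<in> T" using subgroup.m_inv_closed[OF T_subgroup t] .
  obtain k where k: "dop Z v0 = k *s v0" using Z by (auto simp: stab_alg_def)
  have "dop (AdC t Z) v0 = \<sigma> t *v (dop Z (\<sigma> (inv t) *v v0))"
    by (simp add: dop_def Ad_complex_def D_Ad[OF T_in[OF t]] vec.add vec.scale flip: matrix_vector_mul_assoc)
  also have "\<dots> = \<xi>0 (inv t) *s (k *s (\<xi>0 t *s v0))"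
  proof -
    have "dop Z (\<xi>0 (inv t) *s v0) = \<xi>0 (inv t) *s dop Z v0"
      by (simp add: dop_def vec.scale vec.scale_right_distrib mult.commute)
    then show ?thesis by (simp add: \<xi>0[OF it] k vec.scale \<xi>0[OF t])
  qed
  finally show ?thesis by (auto simp: stab_alg_def)
qed

text \<open>By maximality of the torus, the real and imaginary parts of a fixed \<open>Z\<close> are
  velocities of curves in \<open>T\<close>, and \<open>T\<close> moves \<open>v0\<close> only along
  its line.\<close>

lemma fixed_in_stab_alg:
  assumes fix_t: "\<And>t. t \<in> T \<Longrightarrow> AdC t Z = Z"
  shows "Z \<in> stab_alg"
proof -
  obtain \<xi>0 where \<xi>0: "\<And>t. t \<in> T \<Longrightarrow> \<sigma> t *v v0 = \<xi>0 t *s v0" using weight_v0 by blast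
  have *: "\<exists>k. D X *v v0 = k *s v0" if X: "\<And>t. t \<in> T \<Longrightarrow> Ad G c t X = X" for X
  proof -
    obtain \<gamma> where \<gamma>: "exp_curve G c T X \<gamma>" using exp_curve_in_maximal_torus[OF comp T X] by blast
    have "((\<lambda>s. \<sigma> (\<gamma> s)) has_derivative (\<lambda>h. D (h *\<^sub>R X))) (at 0)"
      by (rule D_chain[OF exp_curve_G_deriv[OF \<gamma> T_carrier]])
    from bounded_linear.has_derivative[OF bounded_linear_matrix_vector this, of v0]
    have d: "((\<lambda>s. \<sigma> (\<gamma> s) *v v0) has_derivative (\<lambda>h. D (h *\<^sub>R X) *v v0)) (at 0)" .
    have "(\<lambda>h. D (h *\<^sub>R X) *v v0) 1 \<in> vec.span {v0}"
    proof (rule derivative_in_subspace[OF d])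
      show "\<forall>\<^sub>F s in nhds 0. \<sigma> (\<gamma> s) *v v0 \<in> vec.span {v0}"
        using \<xi>0[OF exp_curve_in[OF \<gamma>]] by (auto simp: vec.span_singleton intro!: always_eventually)
      show "subspace (vec.span {v0})" by (rule complex_subspace_real[OF vec.subspace_span])
      then show "closed (vec.span {v0})" by (rule closed_subspace)
    qed
    then show ?thesis by (auto simp: vec.span_singleton)
  qed
  have "Ad G c t (fst Z) = fst Z" "Ad G c t (snd Z) = snd Z" if "t \<in> T" for t
    using fix_t[OF that] by (auto simp: Ad_complex_def prod_eq_iff)
  then obtain k1 k2 where "D (fst Z) *v v0 = k1 *s v0" "D (snd Z) *v v0 = k2 *s v0"
    using *[of "fst Z"] *[of "snd Z"] by blast
  then have "dop Z v0 = (k1 + \<i> * k2) *s v0" by (simp add: dop_def vec.scale_left_distrib)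
  then show ?thesis unfolding stab_alg_def by blast
qed

lemma root_vector_in_stab_alg:
  assumes "\<alpha> \<in> P" "Z \<in> root_space G c T \<alpha>"
  shows "Z \<in> stab_alg"
proof -
  have "dop Z v0 = 0" using v0 assms by (auto simp: highest_weight_vector_def dop_derived_rep)
  then show ?thesis by (auto simp: stab_alg_def intro!: exI[of _ 0])
qed

text \<open>The real part of the Hermitian extension of \<open>\<beta>\<close>. Both
  \<open>J\<close> and Ad of the torus are isometries for it, as \<open>joint_eigenvector\<close>
  requires.\<close>

definition \<beta>2 where "\<beta>2 Z Z' = \<beta> (fst Z) (fst Z') + \<beta> (snd Z) (snd Z')"

lemma linear_AdC: "t \<in> T \<Longrightarrow> linear (AdC t)"
  using bounded_linear.linear[OF Ad_linear[OF T_in]]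
  by (auto intro!: linearI simp: Ad_complex_def linear_add linear_scale)

lemma inner_form_\<beta>2: "inner_form \<beta>2"
proof (rule inner_form.intro)
  obtain B :: "'e set" where B: "finite B" "span B = UNIV" using fin_dim .
  obtain B2 :: "('e \<times> 'e) set" where B2: "finite B2" "span B2 = UNIV" using fd_prod[OF B] .
  have "bilinear \<beta>2"
    unfolding bilinear_def \<beta>2_def
    by (auto intro!: linearI simp: bb.add_left bb.add_right bb.scaleR_left bb.scaleR_right algebra_simps)
  then show "bounded_bilinear \<beta>2" by (rule fd_bilinear_bounded[OF B2])
  show "\<beta>2 x y = \<beta>2 y x" for x y by (simp add: \<beta>2_def sym)
  show "\<beta>2 x x > 0" if "x \<noteq> 0" for x
  proof -
    have "fst x \<noteq> 0 \<or> snd x \<noteq> 0" using that by (auto simp: prod_eq_iff)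
    then show ?thesis
      using pos[of "fst x"] pos[of "snd x"] nonneg[of "fst x"] nonneg[of "snd x"] by (auto simp: \<beta>2_def)
  qed
qed

text \<open>Otherwise, the orthogonal complement of all these sums contains a joint eigenvector \<open>Z\<close> of
  \<open>Ad T\<close>. If its character is trivial, then \<open>Z\<close> lies in $\mathfrak t_{\mathbb C}$ by the maximality
  of the torus; if not, then \<open>Z\<close> or \<open>cj Z\<close> belongs to a positive root and annihilates \<open>v0\<close>.\<close>

lemma stab_alg_sum_cj: "\<exists>Z1\<in>stab_alg. \<exists>Z2\<in>stab_alg. Z = Z1 + cj Z2"
proof (rule ccontr)
  assume no: "\<not> ?thesis"
  interpret b2: inner_form \<beta>2 by (rule inner_form_\<beta>2)
  obtain B :: "'e set" where B: "finite B" "span B = UNIV" using fin_dim .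
  obtain B2 :: "('e \<times> 'e) set" where B2: "finite B2" "span B2 = UNIV" using fd_prod[OF B] .
  define Q where "Q = {Z1 + cj Z2 | Z1 Z2. Z1 \<in> stab_alg \<and> Z2 \<in> stab_alg}"
  have cj_lin: "cj (x + y) = cj x + cj y" "cj (r *\<^sub>R x) = r *\<^sub>R cj x" "cj 0 = 0" for x y r
    by (simp_all add: cj_def prod_eq_iff)
  have "linear cj" by (rule linearI) (simp_all add: cj_lin)
  then have "subspace (cj ` stab_alg)" by (rule linear_subspace_image[OF _ stab_alg_subspace])
  from subspace_sums[OF stab_alg_subspace this] have "subspace {x + y |x y. x \<in> stab_alg \<and> y \<in> cj ` stab_alg}" .
  moreover have "{x + y |x y. x \<in> stab_alg \<and> y \<in> cj ` stab_alg} = Q" unfolding Q_def by blast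
  ultimately have Q_sub: "subspace Q" by simp
  have bQ: "Z \<in> Q" "cj Z \<in> Q" if "Z \<in> stab_alg" for Z
  proof -
    have "Z = Z + cj 0" "cj Z = 0 + cj Z" by (simp_all add: cj_lin(3))
    then show "Z \<in> Q" "cj Z \<in> Q"
      unfolding Q_def using that subspace_0[OF stab_alg_subspace] by blast+
  qed
  have Q_J: "J q \<in> Q" if qQ: "q \<in> Q" for q
  proof -
    obtain Z1 Z2 where q: "q = Z1 + cj Z2" "Z1 \<in> stab_alg" "Z2 \<in> stab_alg" using qQ by (auto simp: Q_def)
    have "J q = J Z1 + cj (- J Z2)" by (simp add: q J_def cj_def prod_eq_iff)
    moreover have "- J Z2 \<in> stab_alg" using stab_alg_J[OF q(3)] subspace_neg[OF stab_alg_subspace] by blast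
    ultimately show ?thesis using stab_alg_J[OF q(2)] unfolding Q_def by blast
  qed
  have Ad_cj: "AdC t (cj Z) = cj (AdC t Z)" if "t \<in> T" for t Z
    using bounded_linear.linear[OF Ad_linear[OF T_in[OF that]]] by (simp add: Ad_complex_def cj_def linear_neg)
  have Ad_J: "AdC t (J Z) = J (AdC t Z)" if "t \<in> T" for t Z
    using bounded_linear.linear[OF Ad_linear[OF T_in[OF that]]] by (simp add: Ad_complex_def J_def linear_neg)
  have Q_Ad: "AdC t q \<in> Q" if t: "t \<in> T" and q: "q \<in> Q" for t q
  proof -
    obtain Z1 Z2 where q: "q = Z1 + cj Z2" "Z1 \<in> stab_alg" "Z2 \<in> stab_alg" using q by (auto simp: Q_def)
    have "AdC t q = AdC t Z1 + cj (AdC t Z2)"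
      by (simp add: q linear_add[OF linear_AdC[OF t]] Ad_cj[OF t])
    then show ?thesis using stab_alg_Ad[OF t] q(2,3) unfolding Q_def by blast
  qed
  have Ad_mult': "AdC s (AdC t Z) = AdC (s \<otimes> t) Z" if "s \<in> T" "t \<in> T" for s t Z
    using that T_in by (simp add: Ad_complex_def Ad_mult)
  have Ad_one': "AdC \<one> Z = Z" for Z by (simp add: Ad_complex_def Ad_one)
  have iT: "t \<in> T \<Longrightarrow> inv t \<in> T" for t using subgroup.m_inv_closed[OF T_subgroup] .
  have Ad_iso: "\<beta>2 (AdC t x) (AdC t y) = \<beta>2 x y" if "t \<in> T" for t x y
    using T_in[OF that] by (simp add: \<beta>2_def Ad_complex_def Ad_isometry)
  have J_iso: "\<beta>2 (J x) (J y) = \<beta>2 x y" for x y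
    by (simp add: \<beta>2_def J_def bb.minus_left bb.minus_right)
  have J_J: "J (J x) = - x" for x by (simp add: J_def prod_eq_iff)
  have J_lin: "linear J" by (rule linearI) (simp_all add: J_def)
  define U where "U = {Z. \<forall>q\<in>Q. \<beta>2 Z q = 0}"
  have "Z \<notin> Q" unfolding Q_def using no by blast
  then have "Q \<noteq> UNIV" by blast
  then obtain z where z: "z \<noteq> 0" "z \<in> U"
  proof (rule b2.ortho_complement_nontrivial[OF fd_closed_subspace[OF B2 Q_sub] Q_sub])
    fix z assume z: "z \<noteq> 0" "\<And>q. q \<in> Q \<Longrightarrow> \<beta>2 z q = 0"
    have "z \<in> U" unfolding U_def by (intro CollectI ballI z(2))
    then show thesis by (rule that[OF z(1)])
  qed
  have U_sub: "subspace U"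
    by (rule subspaceI) (auto simp: U_def b2.bb.add_left b2.bb.scaleR_left b2.bb.zero_left)
  have U_J: "J x \<in> U" if "x \<in> U" for x
  proof -
    have "\<beta>2 (J x) q = - \<beta>2 x (J q)" for q
      using J_iso[of x "J q"] J_J by (simp add: b2.bb.minus_right)
    then show ?thesis using that Q_J by (auto simp: U_def)
  qed
  have U_Ad: "AdC t x \<in> U" if t: "t \<in> T" and x: "x \<in> U" for t x
  proof -
    have "\<beta>2 (AdC t x) q = \<beta>2 x (AdC (inv t) q)" for q
    proof -
      have "AdC t (AdC (inv t) q) = q"
        using Ad_mult'[OF t iT[OF t]] T_in[OF t] by (simp add: Ad_one')
      then show ?thesis using Ad_iso[OF t, of x "AdC (inv t) q"] by simp
    qed
    then show ?thesis using x Q_Ad[OF iT[OF t]] by (auto simp: U_def)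
  qed
  obtain Z where Z: "Z \<in> U" "Z \<noteq> 0" and eig: "\<And>A. A \<in> AdC ` T \<Longrightarrow> \<exists>a b. A Z = a *\<^sub>R Z + b *\<^sub>R J Z"
  proof (rule b2.joint_eigenvector[OF B2 J_lin J_J J_iso, of "AdC ` T" U])
    show "\<exists>A'\<in>AdC ` T. \<forall>x. A (A' x) = x" if A: "A \<in> AdC ` T" for A
    proof -
      obtain t where t: "t \<in> T" "A = AdC t" using A by blast
      have "A (AdC (inv t) x) = x" for x using Ad_mult'[OF t(1) iT[OF t(1)]] T_in[OF t(1)] by (simp add: Ad_one' t(2))
      then show ?thesis using iT[OF t(1)] by blast
    qed
    show "A (A' x) = A' (A x)" if AA': "A \<in> AdC ` T" "A' \<in> AdC ` T" for A A' x
    proof -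
      obtain s t where "s \<in> T" "t \<in> T" "A = AdC s" "A' = AdC t" using AA' by blast
      then show ?thesis using Ad_mult'[of s t x] Ad_mult'[of t s x] T_comm[of s t] by simp
    qed
    show "linear A" if "A \<in> AdC ` T" for A using that linear_AdC by blast
    show "\<beta>2 (A x) (A y) = \<beta>2 x y" if "A \<in> AdC ` T" for A x y using that Ad_iso by blast
    show "A (J x) = J (A x)" if "A \<in> AdC ` T" for A x using that Ad_J by blast
    show "subspace U" by (rule U_sub)
    show "U \<noteq> {0}" using z by blast
    show "J x \<in> U" if "x \<in> U" for x using that by (rule U_J)
    show "A x \<in> U" if "A \<in> AdC ` T" "x \<in> U" for A x using that U_Ad by blast
    fix u assume u: "u \<in> U" "u \<noteq> 0" "\<And>A. A \<in> AdC ` T \<Longrightarrow> \<exists>a b. A u = a *\<^sub>R u + b *\<^sub>R J u"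
    show thesis by (rule that[OF u(1,2)]) (rule u(3))
  qed
  have Znz: "\<beta>2 Z Z > 0" using b2.pos[OF Z(2)] .
  \<comment> \<open>The coordinates of \<open>AdC t Z\<close> in the orthogonal pair
    \<open>Z\<close>, \<open>J Z\<close>, combined to a complex number. The explicit formula gives
    the continuity of the character.\<close>
  define \<xi> where "\<xi> t = Complex (\<beta>2 (AdC t Z) Z / \<beta>2 Z Z) (\<beta>2 (AdC t Z) (J Z) / \<beta>2 Z Z)" for t
  have cs: "cscale w x = Re w *\<^sub>R x + Im w *\<^sub>R J x" for w x
    by (simp add: cscale_def J_def prod_eq_iff)
  have ZJ: "\<beta>2 Z (J Z) = 0" "\<beta>2 (J Z) Z = 0"
    using sym by (simp_all add: \<beta>2_def J_def bb.minus_right bb.minus_left)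
  have \<xi>: "AdC t Z = cscale (\<xi> t) Z" if t: "t \<in> T" for t
  proof -
    obtain a b where ab: "AdC t Z = a *\<^sub>R Z + b *\<^sub>R J Z" using eig t by blast
    have "\<beta>2 (AdC t Z) Z = a * \<beta>2 Z Z" "\<beta>2 (AdC t Z) (J Z) = b * \<beta>2 Z Z"
      by (simp_all add: ab b2.bb.add_left b2.bb.scaleR_left ZJ J_iso)
    then have "\<xi> t = Complex a b" using Znz by (simp add: \<xi>_def)
    then show ?thesis by (simp add: cs ab)
  qed
  have cs_norm: "\<beta>2 (cscale w Z) (cscale w Z) = (cmod w)\<^sup>2 * \<beta>2 Z Z" for w
    by (simp add: cs b2.bb.add_left b2.bb.add_right b2.bb.scaleR_left b2.bb.scaleR_right ZJ J_iso cmod_def power2_eq_square algebra_simps)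
  have cs_inj: "w = w'" if "cscale w Z = cscale w' Z" for w w'
  proof -
    have "cscale (w - w') Z = cscale w Z - cscale w' Z" by (simp add: cs algebra_simps)
    then have "(cmod (w - w'))\<^sup>2 * \<beta>2 Z Z = 0" using cs_norm[of "w - w'"] that by (simp add: b2.bb.zero_left)
    then show ?thesis using Znz by simp
  qed
  have \<xi>1: "cmod (\<xi> t) = 1" if t: "t \<in> T" for t
  proof -
    have "(cmod (\<xi> t))\<^sup>2 * \<beta>2 Z Z = \<beta>2 Z Z" using cs_norm[of "\<xi> t"] Ad_iso[OF t, of Z Z] \<xi>[OF t] by simp
    then have "(cmod (\<xi> t))\<^sup>2 = 1" using Znz by simp
    then show ?thesis using power2_eq_iff_nonneg[of "cmod (\<xi> t)" 1] by simp
  qed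
  have \<xi>_mult: "\<xi> (s \<otimes> t) = \<xi> s * \<xi> t" if s: "s \<in> T" and t: "t \<in> T" for s t
  proof (rule cs_inj)
    have "cscale (\<xi> (s \<otimes> t)) Z = AdC s (AdC t Z)"
      using \<xi>[of "s \<otimes> t"] Ad_mult'[OF s t] subgroup.m_closed[OF T_subgroup s t] by simp
    also have "\<dots> = cscale (\<xi> t) (AdC s Z)"
      by (simp add: \<xi>[OF t] cs[of "\<xi> t"] linear_add[OF linear_AdC[OF s]] linear_scale[OF linear_AdC[OF s]] Ad_J[OF s])
    also have "\<dots> = cscale (\<xi> s * \<xi> t) Z"
      by (simp add: \<xi>[OF s] cscale_def algebra_simps)
    finally show "cscale (\<xi> (s \<otimes> t)) Z = cscale (\<xi> s * \<xi> t) Z" .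
  qed
  have AdZ_cont: "continuous_on T (\<lambda>t. AdC t Z)"
    unfolding Ad_complex_def
    by (intro continuous_on_Pair continuous_on_subset[OF Ad_cont T_carrier])
  have "continuous_on T \<xi>"
    unfolding \<xi>_def Complex_eq using Znz
    by (intro continuous_on_add continuous_on_mult continuous_on_of_real continuous_on_divide
          b2.bb.continuous_on AdZ_cont continuous_on_const) auto
  then have "torus_character G T \<xi>" using \<xi>1 \<xi>_mult by (auto simp: torus_character_def)
  then obtain \<nu> where \<nu>: "char_exp G c T \<nu> \<xi>" using char_exp_exists by blast
  have "Z \<in> Q"
  proof (cases "\<forall>t\<in>T. \<xi> t = 1")
    case True
    then have "AdC t Z = Z" if "t \<in> T" for t using \<xi>[OF that] that by (simp add: cs)
    then show ?thesis using fixed_in_stab_alg bQ by blast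
  next
    case False
    then have root: "\<nu> \<in> roots G c T" using \<nu> \<xi> Z(2) unfolding roots_def by blast
    show ?thesis
    proof (cases "\<nu> \<in> P")
      case True
      have "Z \<in> root_space G c T \<nu>" using \<nu> \<xi> by (auto simp: root_space_def)
      then show ?thesis using root_vector_in_stab_alg[OF True] bQ by blast
    next
      case False
      then have neg: "(\<lambda>X. - \<nu> X) \<in> P" using P root by (auto simp: positive_root_system_def)
      have nz: "\<xi> t \<noteq> 0" if "t \<in> T" for t using \<xi>1[OF that] by auto
      \<comment> \<open>Conjugation replaces the character by its complex conjugate, which on the
        unit circle is its inverse.\<close>
      have "AdC t (cj Z) = cscale (inverse (\<xi> t)) (cj Z)" if t: "t \<in> T" for t
      proof -
        have "inverse (\<xi> t) = cnj (\<xi> t)"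
          using \<xi>1[OF t] complex_norm_square[of "\<xi> t"] by (intro inverse_unique) simp
        then show ?thesis unfolding Ad_cj[OF t] \<xi>[OF t] by (simp add: cscale_def cj_def prod_eq_iff)
      qed
      then have "cj Z \<in> root_space G c T (\<lambda>X. - \<nu> X)"
        using char_exp_cnj[OF \<nu> nz] unfolding root_space_def by blast
      then have "cj Z \<in> stab_alg" by (rule root_vector_in_stab_alg[OF neg])
      from bQ(2)[OF this] show ?thesis by simp
    qed
  qed
  then have "\<beta>2 Z Z = 0" using Z(1) by (auto simp: U_def)
  then show False using Znz by simp
qed

end


section \<open>Injectivity of the Berezin symbol\<close>

definition is_proj :: "complex ^ 'n ^ 'n \<Rightarrow> (complex ^ 'n) set \<Rightarrow> bool" where
  "is_proj P V \<longleftrightarrow> (\<forall>x. P *v x \<in> V) \<and> (\<forall>x\<in>V. P *v x = x) \<and> adj P = P"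

text \<open>The real orthogonal projection onto \<open>V\<close> is complex linear: as
  \<open>V\<close> contains \<open>\<i> *s w\<close> along with \<open>w\<close>, real orthogonality
  to \<open>V\<close> implies complex orthogonality.\<close>

lemma proj_exists:
  fixes V :: "(complex ^ 'n) set"
  assumes V: "vec.subspace V"
  obtains P where "is_proj P V"
proof -
  have rs: "subspace V" using V by (rule complex_subspace_real)
  have "\<exists>y\<in>V. \<forall>w\<in>V. cinner (x - y) w = 0" for x
  proof -
    obtain y z where y: "y \<in> span V" "\<And>w. w \<in> span V \<Longrightarrow> orthogonal z w" "x = y + z"
      using orthogonal_subspace_decomp_exists[of V x] by blast
    have sp: "span V = V" using rs by (simp add: span_eq_iff)
    have "cinner z w = 0" if w: "w \<in> V" for w
    proof (rule complex_eqI)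
      show "Re (cinner z w) = Re 0" using y(2)[of w] w sp by (simp add: Re_cinner orthogonal_def)
      have "\<i> *s w \<in> V" using V w by (simp add: vec.subspace_scale)
      then have "Re (cinner z (\<i> *s w)) = 0" using y(2)[of "\<i> *s w"] sp by (simp add: Re_cinner orthogonal_def)
      then show "Im (cinner z w) = Im 0" by (simp add: cinner_scale_right)
    qed
    then show ?thesis using y sp by (intro bexI[of _ y]) auto
  qed
  then obtain f where f: "\<And>x. f x \<in> V" "\<And>x w. w \<in> V \<Longrightarrow> cinner (x - f x) w = 0" by metis
  have uniq: "y = f x" if "y \<in> V" "\<And>w. w \<in> V \<Longrightarrow> cinner (x - y) w = 0" for x y
  proof -
    have d: "f x - y \<in> V" using that f(1) V by (simp add: vec.subspace_diff)
    have "cinner (f x - y) (f x - y) = cinner (x - y) (f x - y) - cinner (x - f x) (f x - y)"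
      by (simp flip: cinner_diff_left)
    also have "\<dots> = 0" using that(2)[OF d] f(2)[OF d] by simp
    finally show ?thesis by simp
  qed
  have add: "f (x + y) = f x + f y" for x y
  proof (rule uniq[symmetric])
    show "f x + f y \<in> V" using f(1) V by (simp add: vec.subspace_add)
    show "cinner (x + y - (f x + f y)) w = 0" if "w \<in> V" for w
    proof -
      have "x + y - (f x + f y) = (x - f x) + (y - f y)" by simp
      then show ?thesis using f(2)[OF that] by (simp only: cinner_add_left add_0_left)
    qed
  qed
  have scale: "f (k *s x) = k *s f x" for k x
  proof (rule uniq[symmetric])
    show "k *s f x \<in> V" using f(1) V by (simp add: vec.subspace_scale)
    show "cinner (k *s x - k *s f x) w = 0" if "w \<in> V" for w
    proof -
      have "k *s x - k *s f x = k *s (x - f x)" by (simp add: vec.scale_right_diff_distrib)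
      then show ?thesis using f(2)[OF that] by (simp only: cinner_scale_left mult_zero_right)
    qed
  qed
  have fix_V: "f x = x" if "x \<in> V" for x using uniq[of x x] that by simp
  have lin: "Vector_Spaces.linear (*s) (*s) f"
    by unfold_locales (auto simp: add scale)
  define P where "P = matrix f"
  have Pf: "P *v x = f x" for x unfolding P_def using matrix_works[OF lin] .
  have "cinner (P *v x) y = cinner x (P *v y)" for x y
  proof -
    have "cinner (f x) y = cinner (f x) (f y)"
      using f(2)[OF f(1)[of x], of y] cinner_commute[of "f x" "y - f y"]
      by (simp add: cinner_diff_right)
    also have "\<dots> = cinner x (f y)"
      using f(2)[OF f(1)[of y], of x] by (simp add: cinner_diff_left)
    finally show ?thesis by (simp add: Pf)
  qed
  then have "adj P = P" by (rule adj_eqI)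
  then have "is_proj P V" using f(1) fix_V by (simp add: is_proj_def Pf)
  then show ?thesis using that by blast
qed

lemma is_proj_in: "is_proj P V \<Longrightarrow> P *v x \<in> V"
  and is_proj_fix: "is_proj P V \<Longrightarrow> x \<in> V \<Longrightarrow> P *v x = x"
  and is_proj_adj: "is_proj P V \<Longrightarrow> cinner (P *v x) y = cinner x (P *v y)"
  by (auto simp: is_proj_def cinner_adj)

lemma is_proj_orth: "is_proj P V \<Longrightarrow> w \<in> V \<Longrightarrow> cinner (x - P *v x) w = 0"
  by (simp add: cinner_diff_left is_proj_adj is_proj_fix)

lemma is_proj_zero:
  assumes "is_proj P V" "\<And>w. w \<in> V \<Longrightarrow> cinner x w = 0"
  shows "P *v x = 0"
  using assms is_proj_adj[OF assms(1), of x "P *v x"]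
  by (metis cinner_eq_0_iff is_proj_fix is_proj_in)

text \<open>Stability of \<open>V\<close> under \<open>adj M\<close> makes the orthogonal complement
  stable under \<open>M\<close>, so \<open>M\<close> respects the splitting.\<close>

lemma proj_commute:
  assumes P: "is_proj P V" and M: "\<And>x. x \<in> V \<Longrightarrow> M *v x \<in> V" "\<And>x. x \<in> V \<Longrightarrow> adj M *v x \<in> V"
  shows "P ** M = M ** P"
proof -
  have "P *v (M *v x) = M *v (P *v x)" for x
  proof -
    have "P *v (M *v (x - P *v x)) = 0"
    proof (rule is_proj_zero[OF P])
      fix w assume "w \<in> V"
      then show "cinner (M *v (x - P *v x)) w = 0"
        using is_proj_orth[OF P M(2)] by (simp add: cinner_adj)
    qed
    moreover have "P *v (M *v (P *v x)) = M *v (P *v x)"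
      using is_proj_fix[OF P M(1)[OF is_proj_in[OF P]]] .
    ultimately show ?thesis by (simp add: vec.diff)
  qed
  then show ?thesis by (simp add: matrix_eq flip: matrix_vector_mul_assoc)
qed

context weight_rep
begin

text \<open>The orthogonal projection onto \<open>V\<close> commutes with every \<open>D X\<close>,
  as these are skew-adjoint. Its conjugate by \<open>\<sigma> g\<close> then has zero derivative in
  \<open>g\<close> and is constant on the connected group. This avoids writing group elements as
  exponentials.\<close>

lemma D_invariant_imp_invariant:
  assumes conn: "connected (carrier G)" and V: "vec.subspace V" "\<And>X x. x \<in> V \<Longrightarrow> D X *v x \<in> V"
    and g: "g \<in> carrier G" and x: "x \<in> V"
  shows "\<sigma> g *v x \<in> V"
proof -
  obtain P where P: "is_proj P V" using proj_exists[OF V(1)] .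
  have "adj (D X) *v x \<in> V" if "x \<in> V" for X x
    using V(2)[OF that, of "- X"] by (simp add: D_adj linear_neg[OF D_linear])
  then have comm: "P ** D X = D X ** P" for X using proj_commute[OF P V(2)] by blast
  define F where "F g = \<sigma> g ** P ** \<sigma> (inv g)" for g
  have "((\<lambda>x. F (g \<otimes> p x)) has_derivative (\<lambda>_. 0)) (at c0)" if g: "g \<in> carrier G" for g
  proof -
    have "((\<lambda>x. \<sigma> (p x) ** P ** \<sigma> (inv (p x))) has_derivative (\<lambda>h. 0)) (at c0)"
      using conj_deriv[of P] by (simp add: comm)
    from bounded_linear.has_derivative[OF bounded_bilinear.bounded_linear_right[OF bounded_bilinear_matrix_mult] this, of "\<sigma> g"]
    have "((\<lambda>x. \<sigma> g ** (\<sigma> (p x) ** P ** \<sigma> (inv (p x)))) has_derivative (\<lambda>h. \<sigma> g ** 0)) (at c0)" .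
    from bounded_linear.has_derivative[OF bounded_bilinear.bounded_linear_left[OF bounded_bilinear_matrix_mult] this, of "\<sigma> (inv g)"]
    have "((\<lambda>x. \<sigma> g ** (\<sigma> (p x) ** P ** \<sigma> (inv (p x))) ** \<sigma> (inv g)) has_derivative (\<lambda>h. \<sigma> g ** 0 ** \<sigma> (inv g))) (at c0)" .
    then have "((\<lambda>x. \<sigma> g ** (\<sigma> (p x) ** P ** \<sigma> (inv (p x))) ** \<sigma> (inv g)) has_derivative (\<lambda>h. 0)) (at c0)"
      by (simp add: bounded_bilinear.zero_left[OF bounded_bilinear_matrix_mult] bounded_bilinear.zero_right[OF bounded_bilinear_matrix_mult])
    then show ?thesis
      by (rule has_derivative_transform_within_open[OF _ chart_image_open[OF c_in] c0_in])
         (use c_in dom_c g in \<open>auto simp: F_def \<sigma>_mult inv_mult_group matrix_mul_assoc\<close>)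
  qed
  from zero_derivative_constant[OF conn this g one_closed]
  have "F g = F \<one>" .
  then have "\<sigma> g ** P ** \<sigma> (inv g) = P" by (simp add: F_def \<sigma>_one)
  then have "\<sigma> g ** P ** (\<sigma> (inv g) ** \<sigma> g) = P ** \<sigma> g" by (metis matrix_mul_assoc)
  then have "\<sigma> g ** P = P ** \<sigma> g" by (simp add: \<sigma>_inv(1)[OF g])
  then have "\<sigma> g *v x = P *v (\<sigma> g *v x)"
    using is_proj_fix[OF P x] by (metis matrix_vector_mul_assoc)
  then show ?thesis using is_proj_in[OF P] by metis
qed

lemma dop_scale: "dop Z (k *s x) = k *s dop Z x"
  and dop_vadd: "dop Z (x + y) = dop Z x + dop Z y"
  and dop_vzero: "dop Z 0 = 0"
  by (simp_all add: dop_def vec.scale vec.add vec.scale_right_distrib mult.commute)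

lemma v0_nonzero: "v0 \<noteq> 0"
  using v0 by (simp add: highest_weight_vector_def)

text \<open>The words in the lowering operators \<open>dop Z\<close>, \<open>cj Z \<in> stab_alg\<close>, generate the whole space from
  \<open>v0\<close>: moving a further operator to the right through a word only produces shorter words, and at
  \<open>v0\<close> it splits by \<open>stab_alg_sum_cj\<close> into a lowering operator and one that scales \<open>v0\<close>.\<close>

lemma words_span:
  assumes conn: "connected (carrier G)"
  shows "vec.span {foldr dop Zs v0 |Zs. \<forall>Z\<in>set Zs. cj Z \<in> stab_alg} = UNIV" (is "vec.span ?R = _")
proof -
  define S where "S = vec.span ?R"
  have S: "vec.subspace S" by (simp add: S_def)
  have word: "foldr dop Zs v0 \<in> S" if "\<forall>Z\<in>set Zs. cj Z \<in> stab_alg" for Zs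
    unfolding S_def by (rule vec.span_base) (use that in blast)
  have v0S: "v0 \<in> S" using word[of "[]"] by simp
  have ext: "dop Z x \<in> S" if x: "x \<in> S" and R: "\<And>y. y \<in> ?R \<Longrightarrow> dop Z y \<in> S" for Z x
    using x unfolding S_def
  proof (induction rule: vec.span_induct)
    case base
    show ?case
      by (rule vec.subspaceI) (use S in \<open>auto simp: dop_vzero dop_vadd dop_scale vec.subspace_0 vec.subspace_add vec.subspace_scale simp flip: S_def\<close>)
  qed (use R in \<open>simp flip: S_def\<close>)
  have lower: "dop Z x \<in> S" if Z: "cj Z \<in> stab_alg" and x: "x \<in> S" for Z x
  proof (rule ext[OF x])
    fix y assume "y \<in> ?R"
    then obtain Zs where Zs: "y = foldr dop Zs v0" "\<forall>Z\<in>set Zs. cj Z \<in> stab_alg" by blast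
    then show "dop Z y \<in> S" using word[of "Z # Zs"] Z by simp
  qed
  have all_word: "dop N (foldr dop Zs v0) \<in> S" if "\<forall>Z\<in>set Zs. cj Z \<in> stab_alg" for N Zs
    using that
  proof (induction Zs arbitrary: N)
    case Nil
    obtain Z1 Z2 where N: "Z1 \<in> stab_alg" "Z2 \<in> stab_alg" "N = Z1 + cj Z2" using stab_alg_sum_cj by blast
    obtain k where k: "dop Z1 v0 = k *s v0" using N(1) by (auto simp: stab_alg_def)
    have "dop (cj Z2) v0 \<in> S" using lower[of "cj Z2" v0] N(2) v0S by simp
    then show ?case
      using S v0S by (simp add: N(3) dop_add k vec.subspace_add vec.subspace_scale)
  next
    case (Cons Z Zs)
    obtain N' where N': "\<And>x. dop N (dop Z x) = dop Z (dop N x) + dop N' x"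
      using dop_commute by blast
    have "dop Z (dop N (foldr dop Zs v0)) \<in> S" using lower Cons by simp
    moreover have "dop N' (foldr dop Zs v0) \<in> S" using Cons by simp
    ultimately show ?case using S by (simp add: N' vec.subspace_add)
  qed
  have "dop N x \<in> S" if "x \<in> S" for N x
    by (rule ext[OF that]) (use all_word in blast)
  then have "D X *v x \<in> S" if "x \<in> S" for X x
    using that by (metis add.right_neutral dop_def fst_conv linear_0[OF D_linear] matrix_vector_mult_0 snd_conv vec.scale_zero_right)
  then have "\<sigma> g *v x \<in> S" if "g \<in> carrier G" "x \<in> S" for g x
    using D_invariant_imp_invariant[OF conn S _ that] by blast
  then have "S = UNIV" using irreducibleD[OF S _ v0S v0_nonzero] by blast
  then show ?thesis by (simp add: S_def)
qed

lemma symbol_injective: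
  assumes conn: "connected (carrier G)"
    and B: "\<And>y. y \<in> carrier G \<Longrightarrow> cinner (B *v (\<sigma> y *v v0)) (\<sigma> y *v v0) = 0"
  shows "B = 0"
proof -
  define N where "N = {B. \<forall>y\<in>carrier G. cinner (B *v (\<sigma> y *v v0)) (\<sigma> y *v v0) = 0}"
  have N_sub: "subspace N"
    by (rule subspaceI)
       (auto simp: N_def matrix_vector_mult_add_rdistrib cinner_add_left matrix_scaleR_vector cinner_scale_left simp flip: smult_scaleR)
  have N_conj: "\<sigma> g ** A ** \<sigma> (inv g) \<in> N" if g: "g \<in> carrier G" and A: "A \<in> N" for g A
  proof -
    have "cinner ((\<sigma> g ** A ** \<sigma> (inv g)) *v (\<sigma> y *v v0)) (\<sigma> y *v v0) = 0" if y: "y \<in> carrier G" for y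
    proof -
      have "cinner ((\<sigma> g ** A ** \<sigma> (inv g)) *v (\<sigma> y *v v0)) (\<sigma> y *v v0) =
          cinner (\<sigma> g *v (A *v (\<sigma> (inv g \<otimes> y) *v v0))) (\<sigma> g *v (\<sigma> (inv g \<otimes> y) *v v0))"
        using g y by (simp add: \<sigma>_mult_v \<sigma>_inv_v flip: matrix_vector_mul_assoc)
      also have "\<dots> = 0" using A g y by (simp add: \<sigma>_unitary N_def)
      finally show ?thesis .
    qed
    then show ?thesis by (simp add: N_def)
  qed
  \<comment> \<open>Stability under conjugation by the group, differentiated.\<close>
  have N_D: "D X ** A - A ** D X \<in> N" if A: "A \<in> N" for X A
  proof -
    have "(\<lambda>h. D h ** A - A ** D h) X \<in> N"
    proof (rule derivative_in_subspace[OF conj_deriv _ N_sub closed_subspace[OF N_sub]])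
      show "\<forall>\<^sub>F x in nhds c0. \<sigma> (p x) ** A ** \<sigma> (inv (p x)) \<in> N"
        using eventually_p_carrier by eventually_elim (rule N_conj[OF _ A])
    qed
    then show ?thesis .
  qed
  define V where "V = {x. \<forall>A\<in>N. cinner (A *v x) v0 = 0}"
  have V: "vec.subspace V"
    by (rule vec.subspaceI) (auto simp: V_def vec.add vec.scale cinner_add_left cinner_scale_left)
  have "foldr dop Zs v0 \<in> V" if "\<forall>Z\<in>set Zs. cj Z \<in> stab_alg" for Zs
    using that
  proof (induction Zs)
    case Nil
    have "cinner (A *v v0) v0 = 0" if "A \<in> N" for A
      using that one_closed by (auto simp: N_def \<sigma>_one dest: bspec[of _ _ "\<one>"])
    then show ?case by (simp add: V_def)
  next
    case (Cons Z Zs)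
    define x where "x = foldr dop Zs v0"
    have x: "x \<in> V" using Cons by (simp add: x_def)
    obtain k where k: "dop (cj Z) v0 = k *s v0" using Cons.prems by (auto simp: stab_alg_def)
    have "cinner (A *v dop Z x) v0 = 0" if A: "A \<in> N" for A
    proof -
      \<comment> \<open>The commutator with \<open>D X\<close> lies in \<open>N\<close>, and
        \<open>x \<in> V\<close> makes its pairing vanish. So the operator may pass from the right
        of \<open>A\<close> to the left, where its adjoint acts on \<open>v0\<close>.\<close>
      have *: "cinner (A *v (D X *v x)) v0 = cinner (D X *v (A *v x)) v0" for X
      proof -
        have "cinner ((D X ** A - A ** D X) *v x) v0 = 0" using x N_D[OF A] by (simp add: V_def)
        then show ?thesis by (simp add: matrix_vector_mult_diff_rdistrib cinner_diff_left flip: matrix_vector_mul_assoc)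
      qed
      have "cinner (A *v dop Z x) v0 = cinner (dop Z (A *v x)) v0"
        by (simp add: dop_def vec.add vec.scale cinner_add_left cinner_scale_left *)
      also have "\<dots> = - (cnj k * cinner (A *v x) v0)"
        by (simp add: cinner_dop k cinner_scale_right)
      also have "\<dots> = 0" using x A by (simp add: V_def)
      finally show ?thesis .
    qed
    then show ?case by (simp add: V_def x_def)
  qed
  then have "{foldr dop Zs v0 |Zs. \<forall>Z\<in>set Zs. cj Z \<in> stab_alg} \<subseteq> V" by blast
  then have V_all: "x \<in> V" for x using words_span[OF conn] vec.span_minimal[OF _ V] by blast
  \<comment> \<open>The common orthogonal complement of the ranges of \<open>N\<close>. It contains
    \<open>v0\<close>, and it is invariant because \<open>N\<close> is stable under conjugation;
    irreducibility makes it everything, which leaves only the zero matrix in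
    \<open>N\<close>.\<close>
  define W where "W = {w. \<forall>A\<in>N. \<forall>z. cinner (A *v z) w = 0}"
  have W: "vec.subspace W"
    by (rule vec.subspaceI) (auto simp: W_def cinner_add_right cinner_scale_right)
  have v0W: "v0 \<in> W" using V_all by (auto simp: W_def V_def)
  have "\<sigma> g *v w \<in> W" if g: "g \<in> carrier G" and w: "w \<in> W" for g w
  proof -
    have "cinner (A *v z) (\<sigma> g *v w) = 0" if A: "A \<in> N" for A z
    proof -
      have "cinner (A *v z) (\<sigma> g *v w) = cinner (\<sigma> g *v (\<sigma> (inv g) *v (A *v (\<sigma> g *v (\<sigma> (inv g) *v z))))) (\<sigma> g *v w)"
        using g by (simp add: \<sigma>_inv_v)
      also have "\<dots> = cinner ((\<sigma> (inv g) ** A ** \<sigma> (inv (inv g))) *v (\<sigma> (inv g) *v z)) w"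
        using g by (simp add: \<sigma>_unitary flip: matrix_vector_mul_assoc)
      also have "\<dots> = 0" using w N_conj[OF inv_closed[OF g] A] by (simp add: W_def)
      finally show ?thesis .
    qed
    then show ?thesis by (simp add: W_def)
  qed
  then have "W = UNIV" using irreducibleD[OF W _ v0W v0_nonzero] by blast
  moreover have "B \<in> N" using B by (simp add: N_def)
  ultimately have "cinner (B *v z) (B *v z) = 0" for z
    using UNIV_I[of "B *v z"] unfolding W_def by blast
  then have "B *v z = 0 *v z" for z by simp
  then show ?thesis by (simp add: matrix_eq)
qed

end


section \<open>Commutants and multiplicities\<close>

lemma (in lie_rep) inner_form_cvec: "inner_form ((\<bullet>) :: complex ^ 'n \<Rightarrow> complex ^ 'n \<Rightarrow> real)"
  by (rule inner_form.intro) (auto simp: inner_commute bounded_bilinear_inner)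

lemma matrix_eq_on_spanning:
  assumes "vec.span S = UNIV" "\<And>x. x \<in> S \<Longrightarrow> A *v x = B *v x"
  shows "A = (B :: complex ^ 'n ^ 'm)"
proof -
  have "vec.subspace {x. A *v x = B *v x}"
    by (rule vec.subspaceI) (auto simp: vec.add vec.scale)
  then have "vec.span S \<subseteq> {x. A *v x = B *v x}" using assms(2) by (intro vec.span_minimal) auto
  then show ?thesis using assms(1) by (auto simp: matrix_eq)
qed

context lie_rep
begin

definition commutant :: "'g set \<Rightarrow> (complex ^ 'n ^ 'n) set" where
  "commutant H = {A. \<forall>h\<in>H. A ** \<sigma> h = \<sigma> h ** A}"

context
  fixes H assumes H: "subgroup H G"
begin

lemma H_carrier: "h \<in> H \<Longrightarrow> h \<in> carrier G"
  using subgroup.mem_carrier[OF H] .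

lemma H_inv: "h \<in> H \<Longrightarrow> inv h \<in> H"
  using subgroup.m_inv_closed[OF H] .

lemma commutant_v: "A \<in> commutant H \<longleftrightarrow> (\<forall>h\<in>H. \<forall>x. A *v (\<sigma> h *v x) = \<sigma> h *v (A *v x))"
  by (simp add: commutant_def matrix_eq flip: matrix_vector_mul_assoc)

lemma commutantD: "A \<in> commutant H \<Longrightarrow> h \<in> H \<Longrightarrow> A *v (\<sigma> h *v x) = \<sigma> h *v (A *v x)"
  by (simp add: commutant_v)

lemma commutant_adj:
  assumes A: "A \<in> commutant H" shows "adj A \<in> commutant H"
  unfolding commutant_def
proof (intro CollectI ballI)
  fix h assume h: "h \<in> H"
  have "A ** \<sigma> (inv h) = \<sigma> (inv h) ** A" using A H_inv[OF h] by (simp add: commutant_def)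
  from arg_cong[OF this, of adj] show "adj A ** \<sigma> h = \<sigma> h ** adj A"
    using H_carrier[OF h] by (simp add: adj_mult \<sigma>_adj)
qed

lemma commutant_mult: "A \<in> commutant H \<Longrightarrow> B \<in> commutant H \<Longrightarrow> A ** B \<in> commutant H"
  by (simp add: commutant_v flip: matrix_vector_mul_assoc)

lemma proj_commutant:
  assumes V: "invariant_subspace H \<sigma> V" and P: "is_proj P V"
  shows "P \<in> commutant H"
  unfolding commutant_def
proof (intro CollectI ballI)
  fix h assume h: "h \<in> H"
  show "P ** \<sigma> h = \<sigma> h ** P"
    by (rule proj_commute[OF P])
       (use V h H_inv[OF h] in \<open>auto simp: invariant_subspace_def \<sigma>_adj[OF H_carrier[OF h]]\<close>)
qed

lemma invariant_subspace_D:
  "invariant_subspace H \<sigma> V \<Longrightarrow> vec.subspace V"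
  "invariant_subspace H \<sigma> V \<Longrightarrow> h \<in> H \<Longrightarrow> x \<in> V \<Longrightarrow> \<sigma> h *v x \<in> V"
  by (auto simp: invariant_subspace_def)

lemma irreducible_on_D:
  assumes "irreducible_on H \<sigma> V"
  shows "invariant_subspace H \<sigma> V" "V \<noteq> {0}" "vec.subspace V"
    "invariant_subspace H \<sigma> W \<Longrightarrow> W \<subseteq> V \<Longrightarrow> W = {0} \<or> W = V"
  using assms by (auto simp: irreducible_on_def invariant_subspace_def)

section \<open>Schur's lemma\<close>

text \<open>Kernel and image of \<open>C\<close> on \<open>V\<close> are invariant, so a nonzero
  \<open>C\<close> would be an equivalence.\<close>

lemma schur_inequivalent:
  assumes V: "irreducible_on H \<sigma> V" and W: "irreducible_on H \<sigma> W" and VW: "\<not> equivalent_on H \<sigma> V W"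
    and C: "C \<in> commutant H" "\<And>x. x \<in> V \<Longrightarrow> C *v x \<in> W" and x: "x \<in> V"
  shows "C *v x = 0"
proof (rule ccontr)
  assume nz: "C *v x \<noteq> 0"
  note V' = irreducible_on_D[OF V] and W' = irreducible_on_D[OF W]
  define K where "K = {x \<in> V. C *v x = 0}"
  have "vec.subspace K"
    using V'(3) by (auto simp: K_def vec.subspace_def vec.add vec.scale)
  then have "invariant_subspace H \<sigma> K"
    using invariant_subspace_D(2)[OF V'(1)] commutantD[OF C(1)]
    by (auto simp: invariant_subspace_def K_def)
  then have "K = {0} \<or> K = V" by (rule V'(4)) (auto simp: K_def)
  then have K: "K = {0}" using nz x by (auto simp: K_def)
  have "vec.subspace ((*v) C ` V)"
    by (rule vec.subspace_image[OF V'(3)])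
  then have "invariant_subspace H \<sigma> ((*v) C ` V)"
    using invariant_subspace_D(2)[OF V'(1)]
    by (auto simp: invariant_subspace_def simp flip: commutantD[OF C(1)])
  then have "(*v) C ` V = {0} \<or> (*v) C ` V = W" by (rule W'(4)) (use C(2) in auto)
  then have img: "(*v) C ` V = W" using nz x by auto
  have "inj_on ((*v) C) V"
  proof (rule inj_onI)
    fix a b assume ab: "a \<in> V" "b \<in> V" "C *v a = C *v b"
    then have "a - b \<in> K" using V'(3) by (simp add: K_def vec.diff vec.subspace_diff)
    then show "a = b" using K by simp
  qed
  then have "bij_betw ((*v) C) V W" using img by (simp add: bij_betw_def)
  then have "equivalent_on H \<sigma> V W"
    unfolding equivalent_on_def using commutantD[OF C(1)] by blast
  then show False using VW by simp
qed

text \<open>A self-adjoint operator has a real eigenvalue on \<open>V\<close>, and the eigenspace is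
  invariant. \<open>S\<close> is a plain function because it will be \<open>A + adj A\<close> or
  \<open>\<i>\<close> times \<open>A - adj A\<close>.\<close>

lemma schur_symmetric:
  assumes V: "irreducible_on H \<sigma> V"
    and S: "\<And>x y. S (x + y) = S x + S y" "\<And>k x. S (k *s x) = k *s S x" "\<And>x. x \<in> V \<Longrightarrow> S x \<in> V"
      "\<And>h x. h \<in> H \<Longrightarrow> S (\<sigma> h *v x) = \<sigma> h *v S x" "\<And>x y. cinner (S x) y = cinner x (S y)"
  shows "\<exists>m :: real. \<forall>x\<in>V. S x = of_real m *s x"
proof -
  note V' = irreducible_on_D[OF V]
  interpret i: inner_form "(\<bullet>) :: complex ^ 'n \<Rightarrow> complex ^ 'n \<Rightarrow> real" by (rule inner_form_cvec)
  have rs: "subspace V" using V'(3) by (rule complex_subspace_real)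
  have "linear S" by (rule linearI) (simp_all add: S(1) S(2) flip: smult_scaleR)
  then have bl: "bounded_linear S" by (rule linear_conv_bounded_linear[THEN iffD1])
  have sym: "S u \<bullet> w = u \<bullet> S w" for u w using S(5)[of u w] by (simp flip: Re_cinner)
  obtain u m where u: "u \<in> V" "u \<noteq> 0" "S u = m *\<^sub>R u"
    using i.symmetric_eigenvector[OF closed_subspace[OF rs] rs V'(2) bl S(3) sym] by blast
  define K where "K = {x \<in> V. S x = of_real m *s x}"
  have S0: "S 0 = 0" using S(2)[of 0 0] by simp
  have "vec.subspace K"
    using V'(3) by (auto simp: K_def vec.subspace_def S0 S(1) S(2) vec.scale_right_distrib mult.commute)
  then have "invariant_subspace H \<sigma> K"
    using invariant_subspace_D(2)[OF V'(1)] S(4) by (auto simp: invariant_subspace_def K_def vec.scale)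
  then have "K = {0} \<or> K = V" by (rule V'(4)) (auto simp: K_def)
  moreover have "u \<in> K" using u by (simp add: K_def smult_scaleR)
  ultimately have "K = V" using u(2) by auto
  then have "\<forall>x\<in>V. S x = of_real m *s x" unfolding K_def by blast
  then show ?thesis ..
qed

text \<open>The self-adjoint and the skew-adjoint part of \<open>A\<close> are both real scalars on
  \<open>V\<close>, the latter after multiplication by i.\<close>

lemma schur_scalar:
  assumes V: "irreducible_on H \<sigma> V" and A: "A \<in> commutant H"
    and AV: "\<And>x. x \<in> V \<Longrightarrow> A *v x \<in> V" "\<And>x. x \<in> V \<Longrightarrow> adj A *v x \<in> V"
  obtains k where "\<And>x. x \<in> V \<Longrightarrow> A *v x = k *s x"
proof -
  note V' = irreducible_on_D[OF V]
  note com = commutantD[OF A] commutantD[OF commutant_adj[OF A]]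
  have "\<exists>m :: real. \<forall>x\<in>V. A *v x + adj A *v x = of_real m *s x"
  proof (rule schur_symmetric[OF V, of "\<lambda>x. A *v x + adj A *v x"])
    show "A *v x + adj A *v x \<in> V" if "x \<in> V" for x using AV that V'(3) by (simp add: vec.subspace_add)
    show "cinner (A *v x + adj A *v x) y = cinner x (A *v y + adj A *v y)" for x y
      by (simp add: cinner_add_left cinner_add_right cinner_adj)
    show "A *v (k *s x) + adj A *v (k *s x) = k *s (A *v x + adj A *v x)" for k x
      by (simp add: vec.scale vec.scale_right_distrib)
    show "A *v (x + y) + adj A *v (x + y) = (A *v x + adj A *v x) + (A *v y + adj A *v y)" for x y
      by (simp add: vec.add)
    show "A *v (\<sigma> h *v x) + adj A *v (\<sigma> h *v x) = \<sigma> h *v (A *v x + adj A *v x)" if "h \<in> H" for h x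
      by (simp add: com[OF that] vec.add)
  qed
  then obtain m1 :: real where m1: "\<And>x. x \<in> V \<Longrightarrow> A *v x + adj A *v x = of_real m1 *s x" by blast
  have "\<exists>m :: real. \<forall>x\<in>V. \<i> *s (A *v x - adj A *v x) = of_real m *s x"
  proof (rule schur_symmetric[OF V, of "\<lambda>x. \<i> *s (A *v x - adj A *v x)"])
    show "\<i> *s (A *v x - adj A *v x) \<in> V" if "x \<in> V" for x
      using AV that V'(3) by (intro vec.subspace_scale vec.subspace_diff)
    show "cinner (\<i> *s (A *v x - adj A *v x)) y = cinner x (\<i> *s (A *v y - adj A *v y))" for x y
      by (simp add: cinner_diff_left cinner_diff_right cinner_scale_left cinner_scale_right cinner_adj algebra_simps)
    show "\<i> *s (A *v (k *s x) - adj A *v (k *s x)) = k *s (\<i> *s (A *v x - adj A *v x))" for k x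
      by (simp add: vec.scale vec.scale_right_diff_distrib mult.commute)
    show "\<i> *s (A *v (x + y) - adj A *v (x + y)) = \<i> *s (A *v x - adj A *v x) + \<i> *s (A *v y - adj A *v y)" for x y
      by (simp add: vec.add vec_eq_iff algebra_simps)
    show "\<i> *s (A *v (\<sigma> h *v x) - adj A *v (\<sigma> h *v x)) = \<sigma> h *v (\<i> *s (A *v x - adj A *v x))" if "h \<in> H" for h x
      by (simp add: com[OF that] vec.scale vec.diff)
  qed
  then obtain m2 :: real where m2: "\<And>x. x \<in> V \<Longrightarrow> \<i> *s (A *v x - adj A *v x) = of_real m2 *s x" by blast
  have "A *v x = ((of_real m1 - \<i> * of_real m2) / 2) *s x" if x: "x \<in> V" for x
  proof -
    have "(- \<i>) *s (\<i> *s (A *v x - adj A *v x)) = (- \<i>) *s (of_real m2 *s x)" using m2[OF x] by simp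
    then have "A *v x - adj A *v x = (- \<i> * of_real m2) *s x" by simp
    then have "(A *v x + adj A *v x) + (A *v x - adj A *v x) = (of_real m1 - \<i> * of_real m2) *s x"
      using m1[OF x] by (simp add: vec.scale_left_diff_distrib)
    moreover have "(A *v x + adj A *v x) + (A *v x - adj A *v x) = 2 *s (A *v x)" by (simp add: vec_eq_iff)
    ultimately have "2 *s (A *v x) = (of_real m1 - \<i> * of_real m2) *s x" by simp
    then have "(1 / 2) *s (2 *s (A *v x)) = (1 / 2) *s ((of_real m1 - \<i> * of_real m2) *s x)" by simp
    then show ?thesis by (simp add: diff_divide_distrib vec.scale_left_diff_distrib)
  qed
  then show ?thesis using that by blast
qed

section \<open>Multiplicities and commutativity of the commutant\<close>

text \<open>The given decomposition is merely direct. Schur's lemma makes its summands orthogonal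
  and stable under the commutant, which then acts on each of them by scalars.\<close>

lemma multiplicity_free_imp_commute:
  assumes "multiplicity_free H \<sigma>" and A: "A \<in> commutant H" and A': "A' \<in> commutant H"
  shows "A ** A' = A' ** A"
proof -
  obtain \<V> where "\<forall>V\<in>\<V>. irreducible_on H \<sigma> V" and span: "vec.span (\<Union>\<V>) = UNIV"
    and "\<forall>V\<in>\<V>. \<forall>W\<in>\<V>. V \<noteq> W \<longrightarrow> \<not> equivalent_on H \<sigma> V W"
    using assms(1) unfolding multiplicity_free_def by (elim exE conjE) (rule that, assumption+)
  then have \<V>: "\<And>V. V \<in> \<V> \<Longrightarrow> irreducible_on H \<sigma> V" "vec.span (\<Union>\<V>) = UNIV"
    "\<And>V W. V \<in> \<V> \<Longrightarrow> W \<in> \<V> \<Longrightarrow> V \<noteq> W \<Longrightarrow> \<not> equivalent_on H \<sigma> V W"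
    by (simp_all add: span)
  \<comment> \<open>\<open>C\<close> followed by the projection onto \<open>W\<close> intertwines
    \<open>V\<close> with an inequivalent \<open>W\<close>, so it is zero on
    \<open>V\<close>.\<close>
  have orth: "cinner (C *v x) w = 0"
    if C: "C \<in> commutant H" and VW: "V \<in> \<V>" "W \<in> \<V>" "V \<noteq> W" and x: "x \<in> V" and w: "w \<in> W" for C V W x w
  proof -
    obtain P where P: "is_proj P W" using proj_exists irreducible_on_D(3)[OF \<V>(1)[OF VW(2)]] by blast
    have "P ** C \<in> commutant H"
      using proj_commutant[OF irreducible_on_D(1)[OF \<V>(1)[OF VW(2)]] P] C by (rule commutant_mult)
    then have "(P ** C) *v x = 0"
      using is_proj_in[OF P] x
      by (intro schur_inequivalent[OF \<V>(1)[OF VW(1)] \<V>(1)[OF VW(2)] \<V>(3)[OF VW]])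
         (auto simp flip: matrix_vector_mul_assoc)
    then have "cinner (P *v (C *v x)) w = 0" by (simp add: matrix_vector_mul_assoc)
    then show ?thesis using is_proj_fix[OF P w] by (simp add: is_proj_adj[OF P])
  qed
  have one: "mat 1 \<in> commutant H" by (simp add: commutant_def)
  have stable: "C *v x \<in> V" if C: "C \<in> commutant H" and V: "V \<in> \<V>" and x: "x \<in> V" for C V x
  proof -
    obtain P where P: "is_proj P V" using proj_exists irreducible_on_D(3)[OF \<V>(1)[OF V]] by blast
    \<comment> \<open>The part of \<open>C *v x\<close> outside \<open>V\<close> is orthogonal to
      every summand: to \<open>V\<close> by construction, to the others by \<open>orth\<close> for
      \<open>C\<close> and for the unit matrix.\<close>
    define y where "y = C *v x - P *v (C *v x)"
    have "cinner w y = 0" if "w \<in> \<Union>\<V>" for w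
    proof -
      obtain W where W: "W \<in> \<V>" "w \<in> W" using \<open>w \<in> \<Union>\<V>\<close> by blast
      have "cinner y w = 0"
      proof (cases "W = V")
        case True
        then show ?thesis using is_proj_orth[OF P] W by (simp add: y_def)
      next
        case False
        then show ?thesis
          using orth[OF C V W(1) _ x W(2)] orth[OF one V W(1) _ is_proj_in[OF P] W(2), of "C *v x"]
          by (simp add: y_def cinner_diff_left)
      qed
      then show ?thesis using cinner_commute[of y w] by simp
    qed
    then have "\<Union>\<V> \<subseteq> {w. cinner w y = 0}" by blast
    moreover have "vec.subspace {w. cinner w y = 0}"
      by (rule vec.subspaceI) (auto simp: cinner_add_left cinner_scale_left)
    ultimately have "vec.span (\<Union>\<V>) \<subseteq> {w. cinner w y = 0}" by (rule vec.span_minimal)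
    then have "cinner y y = 0" using \<V>(2) by blast
    then have "P *v (C *v x) = C *v x" by (simp add: y_def)
    then show ?thesis using is_proj_in[OF P] by metis
  qed
  show ?thesis
  proof (rule matrix_eq_on_spanning[OF \<V>(2)])
    fix x assume "x \<in> \<Union>\<V>"
    then obtain V where V: "V \<in> \<V>" "x \<in> V" by blast
    obtain k where k: "\<And>x. x \<in> V \<Longrightarrow> A *v x = k *s x"
      using schur_scalar[OF \<V>(1)[OF V(1)] A stable[OF A V(1)] stable[OF commutant_adj[OF A] V(1)]] by blast
    show "(A ** A') *v x = (A' ** A) *v x"
      using k[OF stable[OF A' V]] k[OF V(2)] by (simp add: vec.scale flip: matrix_vector_mul_assoc)
  qed
qed

text \<open>Complete reducibility. A minimal invariant subspace is irreducible, and unitarity makes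
  its orthogonal complement in \<open>U\<close> invariant, of smaller dimension.\<close>

lemma orthogonal_decomposition:
  "invariant_subspace H \<sigma> U \<Longrightarrow> \<exists>\<V>. finite \<V> \<and> (\<forall>V\<in>\<V>. irreducible_on H \<sigma> V) \<and> vec.span (\<Union>\<V>) = U \<and>
     (\<forall>V\<in>\<V>. \<forall>W\<in>\<V>. V \<noteq> W \<longrightarrow> (\<forall>x\<in>V. \<forall>y\<in>W. cinner x y = 0))"
proof (induction "vec.dim U" arbitrary: U rule: less_induct)
  case less
  note U = less.prems
  show ?case
  proof (cases "U = {0}")
    case True
    then show ?thesis by (intro exI[of _ "{}"]) simp
  next
    case False
    obtain V where V: "V \<subseteq> U" "invariant_subspace H \<sigma> V \<and> V \<noteq> {0}"
      "\<And>W. invariant_subspace H \<sigma> W \<and> W \<noteq> {0} \<Longrightarrow> W \<subseteq> V \<Longrightarrow> W = V"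
    proof (rule fd_minimal_subspace[of "Basis :: (complex ^ 'n) set" "\<lambda>V. invariant_subspace H \<sigma> V \<and> V \<noteq> {0}" U])
      show "subspace W" if "invariant_subspace H \<sigma> W \<and> W \<noteq> {0}" for W
        using that complex_subspace_real by (auto simp: invariant_subspace_def)
    qed (use U False in auto)
    have Vi: "irreducible_on H \<sigma> V" using V by (auto simp: irreducible_on_def)
    have Vs: "vec.subspace V" using irreducible_on_D(3)[OF Vi] .
    have Us: "vec.subspace U" using invariant_subspace_D(1)[OF U] .
    obtain P where P: "is_proj P V" using proj_exists[OF Vs] .
    define U' where "U' = {x \<in> U. \<forall>v\<in>V. cinner x v = 0}"
    have U's: "vec.subspace U'"
      using Us by (auto simp: U'_def vec.subspace_def cinner_add_left cinner_scale_left)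
    have U'i: "invariant_subspace H \<sigma> U'"
      unfolding invariant_subspace_def
    proof (intro conjI ballI U's)
      fix h x assume h: "h \<in> H" and x: "x \<in> U'"
      have "cinner (\<sigma> h *v x) v = 0" if v: "v \<in> V" for v
      proof -
        have "cinner (\<sigma> h *v x) v = cinner x (\<sigma> (inv h) *v v)"
          by (simp add: cinner_adj \<sigma>_adj[OF H_carrier[OF h]])
        then show ?thesis
          using x invariant_subspace_D(2)[OF irreducible_on_D(1)[OF Vi] H_inv[OF h] v] by (simp add: U'_def)
      qed
      then show "\<sigma> h *v x \<in> U'" using invariant_subspace_D(2)[OF U h] x by (simp add: U'_def)
    qed
    obtain v where v: "v \<in> V" "v \<noteq> 0" using V(2) vec.subspace_0[OF Vs] by blast
    have "v \<notin> U'"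
    proof
      assume "v \<in> U'"
      then have "cinner v v = 0" using v(1) unfolding U'_def by blast
      then show False using v(2) by simp
    qed
    then have "U' \<subset> U" using v V(1) by (auto simp: U'_def)
    then have "vec.span U' \<subset> vec.span U" using U's Us by (simp add: vec.span_eq_iff[THEN iffD2])
    then have "vec.dim U' < vec.dim U" by (rule vec.dim_psubset)
    from less.hyps[OF this U'i] obtain \<V> where "finite \<V>" "\<forall>V\<in>\<V>. irreducible_on H \<sigma> V" "vec.span (\<Union>\<V>) = U'"
      "\<forall>V\<in>\<V>. \<forall>W\<in>\<V>. V \<noteq> W \<longrightarrow> (\<forall>x\<in>V. \<forall>y\<in>W. cinner x y = 0)"
      by (elim exE conjE) (rule that, assumption+)
    then have \<V>: "finite \<V>" "\<And>W. W \<in> \<V> \<Longrightarrow> irreducible_on H \<sigma> W"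
      "vec.span (\<Union>\<V>) = U'" "\<And>W W' x y. W \<in> \<V> \<Longrightarrow> W' \<in> \<V> \<Longrightarrow> W \<noteq> W' \<Longrightarrow> x \<in> W \<Longrightarrow> y \<in> W' \<Longrightarrow> cinner x y = 0"
      by simp_all
    have sub: "\<Union>\<V> \<subseteq> U'" using \<V>(3) vec.span_superset by blast
    have orth: "cinner x y = 0" "cinner y x = 0" if "x \<in> V" "W \<in> \<V>" "y \<in> W" for x y W
    proof -
      show "cinner y x = 0" using that sub by (auto simp: U'_def)
      then show "cinner x y = 0" using cinner_commute[of y x] by simp
    qed
    have "vec.span (\<Union>(insert V \<V>)) = U"
    proof
      have "\<Union>(insert V \<V>) \<subseteq> U" using V(1) sub by (auto simp: U'_def)
      then show "vec.span (\<Union>(insert V \<V>)) \<subseteq> U" using Us by (rule vec.span_minimal)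
      show "U \<subseteq> vec.span (\<Union>(insert V \<V>))"
      proof
        fix x assume x: "x \<in> U"
        have "x - P *v x \<in> U'"
          using x is_proj_in[OF P, of x] V(1) Us is_proj_orth[OF P] by (auto simp: U'_def vec.subspace_diff)
        then have "x - P *v x \<in> vec.span (\<Union>\<V>)" using \<V>(3) by simp
        then have "x - P *v x \<in> vec.span (\<Union>(insert V \<V>))"
          using vec.span_mono[of "\<Union>\<V>" "\<Union>(insert V \<V>)"] by auto
        moreover have "P *v x \<in> vec.span (\<Union>(insert V \<V>))"
          using is_proj_in[OF P, of x] by (intro vec.span_base) simp
        ultimately have "(x - P *v x) + P *v x \<in> vec.span (\<Union>(insert V \<V>))" by (rule vec.span_add)
        then show "x \<in> vec.span (\<Union>(insert V \<V>))" by simp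
      qed
    qed
    moreover have "\<forall>W\<in>insert V \<V>. \<forall>W'\<in>insert V \<V>. W \<noteq> W' \<longrightarrow> (\<forall>x\<in>W. \<forall>y\<in>W'. cinner x y = 0)"
    proof (intro ballI impI)
      fix W W' x y assume *: "W \<in> insert V \<V>" "W' \<in> insert V \<V>" "W \<noteq> W'" "x \<in> W" "y \<in> W'"
      consider "W = V" "W' \<in> \<V>" | "W' = V" "W \<in> \<V>" | "W \<in> \<V>" "W' \<in> \<V>" using * by blast
      then show "cinner x y = 0"
      proof cases
        case 1 then show ?thesis using orth(1) * by blast
      next
        case 2 then show ?thesis using orth(2) * by blast
      next
        case 3 then show ?thesis using \<V>(4) * by blast
      qed
    qed
    ultimately show ?thesis using \<V>(1,2) Vi by (intro exI[of _ "insert V \<V>"]) auto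
  qed
qed

text \<open>An equivalence \<open>A\<close> between two orthogonal summands \<open>V\<close> and
  \<open>W\<close> would give two members of the commutant, \<open>P\<close> and
  \<open>A ** P\<close>, that do not commute: on \<open>V\<close> one product is \<open>A\<close>
  and the other is zero.\<close>

lemma commute_imp_multiplicity_free:
  assumes comm: "\<And>A A'. A \<in> commutant H \<Longrightarrow> A' \<in> commutant H \<Longrightarrow> A ** A' = A' ** A"
  shows "multiplicity_free H \<sigma>"
proof -
  have "invariant_subspace H \<sigma> UNIV" by (simp add: invariant_subspace_def)
  from orthogonal_decomposition[OF this] obtain \<V> where *: "finite \<V>" "\<forall>V\<in>\<V>. irreducible_on H \<sigma> V"
    "vec.span (\<Union>\<V>) = UNIV" "\<forall>V\<in>\<V>. \<forall>W\<in>\<V>. V \<noteq> W \<longrightarrow> (\<forall>x\<in>V. \<forall>y\<in>W. cinner x y = 0)"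
    by (elim exE conjE) (rule that, assumption+)
  then have \<V>: "finite \<V>" "\<And>V. V \<in> \<V> \<Longrightarrow> irreducible_on H \<sigma> V"
    "vec.span (\<Union>\<V>) = UNIV" "\<And>V W x y. V \<in> \<V> \<Longrightarrow> W \<in> \<V> \<Longrightarrow> V \<noteq> W \<Longrightarrow> x \<in> V \<Longrightarrow> y \<in> W \<Longrightarrow> cinner x y = 0"
    by simp_all
  have indep: "V \<inter> vec.span (\<Union>(\<V> - {V})) = {0}" if V: "V \<in> \<V>" for V
  proof -
    have "x = 0" if x: "x \<in> V" "x \<in> vec.span (\<Union>(\<V> - {V}))" for x
    proof -
      have "vec.subspace {w. cinner w x = 0}"
        by (rule vec.subspaceI) (auto simp: cinner_add_left cinner_scale_left)
      moreover have "\<Union>(\<V> - {V}) \<subseteq> {w. cinner w x = 0}" using \<V>(4)[OF _ V _ _ x(1)] by blast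
      ultimately have "vec.span (\<Union>(\<V> - {V})) \<subseteq> {w. cinner w x = 0}" by (intro vec.span_minimal)
      then have "cinner x x = 0" using x(2) by blast
      then show ?thesis by simp
    qed
    moreover have "0 \<in> V" using vec.subspace_0[OF irreducible_on_D(3)[OF \<V>(2)[OF V]]] .
    ultimately show ?thesis using vec.span_zero by blast
  qed
  have inequiv: "\<not> equivalent_on H \<sigma> V W" if VW: "V \<in> \<V>" "W \<in> \<V>" "V \<noteq> W" for V W
  proof
    assume "equivalent_on H \<sigma> V W"
    then obtain A :: "complex ^ 'n ^ 'n" where A: "bij_betw ((*v) A) V W"
      "\<And>h x. h \<in> H \<Longrightarrow> x \<in> V \<Longrightarrow> A *v (\<sigma> h *v x) = \<sigma> h *v (A *v x)"
      unfolding equivalent_on_def by blast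
    obtain P where P: "is_proj P V" using proj_exists[OF irreducible_on_D(3)[OF \<V>(2)[OF VW(1)]]] .
    have PC: "P \<in> commutant H" using proj_commutant[OF irreducible_on_D(1)[OF \<V>(2)[OF VW(1)]] P] .
    \<comment> \<open>Composing with the projection extends the intertwiner by zero from
      \<open>V\<close> to the whole space.\<close>
    have "A ** P \<in> commutant H"
      unfolding commutant_v
      by (simp add: commutantD[OF PC] A(2) is_proj_in[OF P] flip: matrix_vector_mul_assoc)
    from comm[OF this PC] have eq: "(A ** P) ** P = P ** (A ** P)" .
    have "A *v x = 0" if x: "x \<in> V" for x
    proof -
      have Px: "P *v x = x" using is_proj_fix[OF P x] .
      have "A *v x \<in> W" using A(1) x by (auto simp: bij_betw_def)
      then have "P *v (A *v x) = 0"
        using \<V>(4)[OF VW(2,1)] VW(3) by (intro is_proj_zero[OF P]) auto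
      moreover have "((A ** P) ** P) *v x = (P ** (A ** P)) *v x" using eq by simp
      ultimately show ?thesis by (simp add: Px flip: matrix_vector_mul_assoc)
    qed
    then have "(*v) A ` V \<subseteq> {0}" by auto
    then have "W \<subseteq> {0}" using A(1) by (simp add: bij_betw_def)
    moreover have "0 \<in> W" using vec.subspace_0[OF irreducible_on_D(3)[OF \<V>(2)[OF VW(2)]]] .
    ultimately show False using irreducible_on_D(2)[OF \<V>(2)[OF VW(2)]] by blast
  qed
  show ?thesis
    unfolding multiplicity_free_def
    by (intro exI[of _ \<V>] conjI ballI impI *(1-3) indep inequiv) assumption+
qed

end

end


section \<open>Toeplitz operators\<close>

context lie_rep
begin

text \<open>Substitute \<open>h \<otimes> y\<close> for \<open>y\<close> in the defining integral;
  changing \<open>f\<close> on a null set does not affect it, so invariance almost everywhere is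
  enough.\<close>

lemma toeplitz_commutant:
  assumes H: "subgroup H G" and f: "integrable \<mu> f" and inv: "left_invariant G \<mu> H f"
  shows "toeplitz \<mu> \<sigma> v f \<in> commutant H"
  unfolding commutant_v[OF H]
proof (intro ballI allI)
  fix h x assume h: "h \<in> H"
  note hc = H_carrier[OF H h]
  let ?T = "toeplitz \<mu> \<sigma> v f"
  note tc = toeplitz_cinner[OF rep haar f, where v\<^sub>0 = v]
  have fm: "f \<in> borel_measurable \<mu>" using f by (rule borel_measurable_integrable)
  have cont: "continuous_on (carrier G) (\<lambda>y. cinner a (\<sigma> y *v v))" for a
    unfolding cinner_def by (intro continuous_intros orbit_cont)
  \<comment> \<open>Invariance is phrased with \<open>inv h\<close>, so it is applied to the element
    \<open>inv h\<close>.\<close>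
  have ae: "AE y in \<mu>. f (h \<otimes> y) = f y"
    using inv H_inv[OF H h] hc unfolding left_invariant_def by force
  have fhm: "(\<lambda>y. f (h \<otimes> y)) \<in> borel_measurable \<mu>"
    using measurable_compose[OF left_mult_measurable[OF hc] fm] .
  \<comment> \<open>With \<open>\<sigma> h\<close> in both slots, unitarity removes it from the
    integrand after the substitution. No vector is missed because \<open>\<sigma> h\<close> is
    invertible.\<close>
  have "cinner (?T *v (\<sigma> h *v x)) (\<sigma> h *v z) = cinner (\<sigma> h *v (?T *v x)) (\<sigma> h *v z)" for z
  proof -
    let ?F = "\<lambda>y. f y * cinner (\<sigma> h *v x) (\<sigma> y *v v) * cnj (cinner (\<sigma> h *v z) (\<sigma> y *v v))"
    have Fm: "?F \<in> borel_measurable \<mu>"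
      by (intro borel_measurable_times fm measurable_cont cont continuous_on_cnj)
    have "(LINT y|\<mu>. ?F y) = (LINT y|\<mu>. ?F (h \<otimes> y))"
      by (rule haar_integral_left[OF hc Fm, symmetric])
    also have "\<dots> = (LINT y|\<mu>. f (h \<otimes> y) * cinner x (\<sigma> y *v v) * cnj (cinner z (\<sigma> y *v v)))"
      by (rule Bochner_Integration.integral_cong[OF refl]) (simp add: space_\<mu> \<sigma>_mult_v[OF hc] \<sigma>_unitary[OF hc])
    also have "\<dots> = (LINT y|\<mu>. f y * cinner x (\<sigma> y *v v) * cnj (cinner z (\<sigma> y *v v)))"
    proof (rule integral_cong_AE)
      show "AE y in \<mu>. f (h \<otimes> y) * cinner x (\<sigma> y *v v) * cnj (cinner z (\<sigma> y *v v)) =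
          f y * cinner x (\<sigma> y *v v) * cnj (cinner z (\<sigma> y *v v))"
        using ae by eventually_elim simp
    qed (intro borel_measurable_times fm fhm measurable_cont cont continuous_on_cnj)+
    finally show ?thesis by (simp add: tc \<sigma>_unitary[OF hc])
  qed
  from this[of "\<sigma> (inv h) *v _"]
  have "cinner (?T *v (\<sigma> h *v x)) z = cinner (\<sigma> h *v (?T *v x)) z" for z
    by (simp only: \<sigma>_inv_v(2)[OF hc])
  then show "?T *v (\<sigma> h *v x) = \<sigma> h *v (?T *v x)" by (rule cinner_eqI)
qed

definition symbol where "symbol B v y = cinner (B *v (\<sigma> y *v v)) (\<sigma> y *v v)"

lemma symbol_cont: "continuous_on (carrier G) (symbol B v)"
proof -
  have "continuous_on (carrier G) (\<lambda>y. \<sigma> y *v v)" by (rule orbit_cont)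
  moreover have "continuous_on (carrier G) (\<lambda>y. B *v (\<sigma> y *v v))"
    by (rule bounded_linear.continuous_on[OF bounded_linear_matrix_vector' orbit_cont])
  ultimately show ?thesis unfolding symbol_def cinner_def by (intro continuous_intros)
qed

text \<open>An element of the stabilizer multiplies \<open>v\<close> by a scalar of modulus 1, which
  cancels in the sesquilinear expression.\<close>

lemma symbol_L1:
  assumes "v \<noteq> 0"
  shows "symbol B v \<in> L1_quotient G \<mu> (line_stabilizer G \<sigma> v)"
  unfolding L1_quotient_def
proof (intro CollectI conjI ballI integrable_cont symbol_cont)
  fix y l assume y: "y \<in> carrier G" and l: "l \<in> line_stabilizer G \<sigma> v"
  then obtain z where lc: "l \<in> carrier G" and z: "\<sigma> l *v v = z *s v" by (auto simp: line_stabilizer_def)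
  have "z * cnj z * cinner v v = cinner v v"
    using \<sigma>_unitary[OF lc, of v v] unfolding z cinner_scale_left cinner_scale_right by (simp only: mult_ac)
  then have "cnj z * z = 1" using assms by (simp add: mult.commute)
  then show "symbol B v (y \<otimes> l) = symbol B v y"
    using y lc by (simp add: symbol_def \<sigma>_mult_v z vec.scale cinner_scale_left cinner_scale_right flip: mult.assoc)
qed

lemma symbol_left_invariant:
  assumes H: "subgroup H G" and B: "B \<in> commutant H"
  shows "left_invariant G \<mu> H (symbol B v)"
  unfolding left_invariant_def
proof (intro ballI AE_I2)
  fix h x assume h: "h \<in> H" and x: "x \<in> space \<mu>"
  note ih = H_inv[OF H h] and ihc = H_carrier[OF H H_inv[OF H h]]
  show "symbol B v (inv h \<otimes> x) = symbol B v x"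
    using x ihc by (simp add: space_\<mu> symbol_def \<sigma>_mult_v commutantD[OF H B ih] \<sigma>_unitary)
qed

text \<open>Links the Euclidean structure of the matrix space, in which orthogonal decompositions
  are taken, with the Hilbert-Schmidt product.\<close>

lemma matrix_inner: "A \<bullet> B = Re (\<Sum>j\<in>UNIV. cinner (A *v axis j 1) (B *v axis j 1))" for A B :: "complex ^ 'n ^ 'n"
proof -
  have "(A *v axis j 1) $ i = A $ i $ j" for A :: "complex ^ 'n ^ 'n" and i j
    by (simp add: matrix_vector_mult_def axis_def if_distrib cong: if_cong)
  then have "Re (\<Sum>j\<in>UNIV. cinner (A *v axis j 1) (B *v axis j 1)) = (\<Sum>j\<in>UNIV. \<Sum>i\<in>UNIV. A $ i $ j \<bullet> B $ i $ j)"
    by (simp add: cinner_def inner_complex_def)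
  also have "\<dots> = A \<bullet> B" unfolding inner_vec_def by (rule sum.swap)
  finally show ?thesis by simp
qed

text \<open>Up to the factor \<open>CARD('n)\<close>, the Toeplitz map is the adjoint of the symbol
  map: pairing the operator of \<open>f\<close> with \<open>B\<close> integrates \<open>f\<close>
  against the conjugate symbol of \<open>B\<close>. Here \<open>f\<close> is that symbol
  itself.\<close>

lemma toeplitz_symbol_inner:
  "toeplitz \<mu> \<sigma> v (symbol B v) \<bullet> B = CARD('n) * (LINT y|\<mu>. (cmod (symbol B v y))\<^sup>2)"
proof -
  let ?f = "symbol B v"
  note tc = toeplitz_cinner[OF rep haar integrable_cont[OF symbol_cont], where v\<^sub>0 = v]
  let ?G = "\<lambda>j y. ?f y * cinner (axis j 1) (\<sigma> y *v v) * cnj (cinner (B *v axis j 1) (\<sigma> y *v v))"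
  have cont: "continuous_on (carrier G) (\<lambda>y. cinner a (\<sigma> y *v v))" for a
    unfolding cinner_def by (intro continuous_intros orbit_cont)
  have int: "integrable \<mu> (?G j)" for j
    by (intro integrable_cont continuous_on_mult continuous_on_cnj cont symbol_cont)
  have "(\<Sum>j\<in>UNIV. cinner (toeplitz \<mu> \<sigma> v ?f *v axis j 1) (B *v axis j 1)) =
      of_nat CARD('n) * (LINT y|\<mu>. (\<Sum>j\<in>UNIV. ?G j y))"
    by (simp add: tc sum_distrib_left Bochner_Integration.integral_sum[OF int])
  also have "(LINT y|\<mu>. (\<Sum>j\<in>UNIV. ?G j y)) = (LINT y|\<mu>. of_real ((cmod (?f y))\<^sup>2))"
  proof (rule Bochner_Integration.integral_cong[OF refl])
    fix y
    define u where "u = \<sigma> y *v v"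
    \<comment> \<open>Expanding the orbit vector in the standard basis turns the sum over basis
      vectors into the conjugate symbol.\<close>
    have "u = (\<Sum>j\<in>UNIV. (u $ j) *s axis j 1)" by (simp add: basis_expansion)
    then have "B *v u = (\<Sum>j\<in>UNIV. (u $ j) *s (B *v axis j 1))"
      by (metis (no_types, lifting) vec.scale vec.sum sum.cong)
    moreover have "cinner (\<Sum>j\<in>S. w j) u = (\<Sum>j\<in>S. cinner (w j) u)" if "finite S" for S :: "'n set" and w
      using that by (induction S rule: finite_induct) (auto simp: cinner_add_left)
    ultimately have "cinner (B *v u) u = (\<Sum>j\<in>UNIV. u $ j * cinner (B *v axis j 1) u)"
      by (simp add: cinner_scale_left)
    then have "cnj (?f y) = (\<Sum>j\<in>UNIV. cinner (axis j 1) u * cnj (cinner (B *v axis j 1) u))"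
      by (simp add: symbol_def u_def[symmetric] cinner_axis_left)
    then have "?f y * cnj (?f y) = (\<Sum>j\<in>UNIV. ?G j y)"
      by (simp add: u_def sum_distrib_left mult.assoc)
    then show "(\<Sum>j\<in>UNIV. ?G j y) = of_real ((cmod (?f y))\<^sup>2)"
      unfolding complex_norm_square by (rule sym)
  qed
  also have "\<dots> = of_real (LINT y|\<mu>. (cmod (?f y))\<^sup>2)" by (rule integral_complex_of_real)
  finally show ?thesis unfolding matrix_inner by simp
qed

lemma commutant_subspace: "subspace (commutant H)"
  by (rule subspaceI)
     (auto simp: commutant_def matrix_scaleR_left matrix_scaleR_right
        bounded_bilinear.add_left[OF bounded_bilinear_matrix_mult] bounded_bilinear.add_right[OF bounded_bilinear_matrix_mult]
        bounded_bilinear.zero_left[OF bounded_bilinear_matrix_mult] bounded_bilinear.zero_right[OF bounded_bilinear_matrix_mult])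

text \<open>The matrices commuting with a given one form a subspace; this is used for each factor in
  turn.\<close>

lemma commuting_span:
  assumes "\<And>A B. A \<in> S \<Longrightarrow> B \<in> S \<Longrightarrow> A ** B = B ** A" and A: "A \<in> span S" and B: "B \<in> span S"
  shows "A ** B = B ** (A :: complex ^ 'n ^ 'n)"
proof -
  have sub: "subspace {A. A ** B = B ** A}" for B :: "complex ^ 'n ^ 'n"
    by (rule subspaceI)
     (auto simp: matrix_scaleR_left matrix_scaleR_right
        bounded_bilinear.add_left[OF bounded_bilinear_matrix_mult] bounded_bilinear.add_right[OF bounded_bilinear_matrix_mult]
        bounded_bilinear.zero_left[OF bounded_bilinear_matrix_mult] bounded_bilinear.zero_right[OF bounded_bilinear_matrix_mult])
  have 1: "A ** B = B ** A" if "A \<in> span S" "B \<in> S" for A B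
  proof -
    have "S \<subseteq> {A. A ** B = B ** A}" using assms(1) that(2) by blast
    then have "span S \<subseteq> {A. A ** B = B ** A}" using sub by (rule span_minimal)
    then show ?thesis using that(1) by blast
  qed
  have "S \<subseteq> {B. B ** A = A ** B}" using 1[OF A] by (auto simp: eq_commute)
  then have "span S \<subseteq> {B. B ** A = A ** B}" using sub by (rule span_minimal)
  then show ?thesis using B by auto
qed

end

text \<open>Orthogonally to all Toeplitz operators with invariant symbols, an element of the commutant of
  \<open>H\<close> has an invariant Berezin symbol, which may be used as a Toeplitz symbol and so has norm 0.\<close>

lemma (in weight_rep) commutant_subset_span_toeplitz:
  assumes conn: "connected (carrier G)" and H: "subgroup H G"
  shows "commutant H \<subseteq> span {toeplitz \<mu> \<sigma> v0 f |f. f \<in> L1_quotient G \<mu> (line_stabilizer G \<sigma> v0) \<and> left_invariant G \<mu> H f}"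
    (is "_ \<subseteq> span ?T")
proof
  fix C assume C: "C \<in> commutant H"
  obtain A B where A: "A \<in> span ?T" and B: "\<And>M. M \<in> span ?T \<Longrightarrow> orthogonal B M" and CAB: "C = A + B"
    using orthogonal_subspace_decomp_exists[of ?T C] by blast
  have "?T \<subseteq> commutant H" using toeplitz_commutant[OF H] by (auto simp: L1_quotient_def)
  then have "A \<in> commutant H" using A span_minimal[OF _ commutant_subspace] by blast
  then have "B \<in> commutant H" using C CAB subspace_diff[OF commutant_subspace, of C H A] by simp
  then have "toeplitz \<mu> \<sigma> v0 (symbol B v0) \<in> ?T"
    using symbol_L1[OF v0_nonzero] symbol_left_invariant[OF H] by blast
  from B[OF span_base[OF this]] have "toeplitz \<mu> \<sigma> v0 (symbol B v0) \<bullet> B = 0"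
    unfolding orthogonal_def by (subst inner_commute)
  then have "(LINT y|\<mu>. (cmod (symbol B v0 y))\<^sup>2) = 0" by (simp add: toeplitz_symbol_inner)
  \<comment> \<open>Injectivity of the symbol needs zeros at every point of the group, and
    continuity excludes an exceptional null set.\<close>
  then have "(cmod (symbol B v0 y))\<^sup>2 = 0" if "y \<in> carrier G" for y
    using that by (intro continuous_nonneg_integral_zero[of "\<lambda>y. (cmod (symbol B v0 y))\<^sup>2"] continuous_intros symbol_cont) auto
  then have "B = 0" by (intro symbol_injective[OF conn]) (simp add: symbol_def)
  then show "C \<in> span ?T" using A CAB by simp
qed

theorem theorem4p5:
  fixes G :: "('g::t2_space, 'm) monoid_scheme"
    and \<A> :: "('g, 'e::{real_normed_vector,heine_borel}) chart set"
    and c :: "('g, 'e) chart"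
    and T :: "'g set" and P :: "('e \<Rightarrow> complex) set"
    and \<mu> :: "'g measure"
    and lam :: "'e \<Rightarrow> complex"
    and \<sigma> :: "'g \<Rightarrow> complex ^ 'n::finite ^ 'n" and v\<^sub>0 :: "complex ^ 'n"
    and L H :: "'g set"
  assumes "lie_group G \<A>" and "compact (carrier G)" and "connected (carrier G)"
    and "c \<in> \<A>" and "\<one>\<^bsub>G\<^esub> \<in> fst c"
    and "normalized_haar G \<mu>"
    and "maximal_torus G T" and "positive_root_system G c T P"
    and "analytically_integral G c T lam" and "dominant G c T P lam"
    and "unitary_rep G \<sigma>" and "irreducible_on (carrier G) \<sigma> UNIV"
    and "highest_weight_vector G c T P \<sigma> lam v\<^sub>0" and "norm v\<^sub>0 = 1"
    and "L = line_stabilizer G \<sigma> v\<^sub>0"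
    and "subgroup H G" and "closedin (top_of_set (carrier G)) H"
  shows "(\<forall>f\<in>L1_quotient G \<mu> L. \<forall>f'\<in>L1_quotient G \<mu> L.
            left_invariant G \<mu> H f \<longrightarrow> left_invariant G \<mu> H f' \<longrightarrow>
            toeplitz \<mu> \<sigma> v\<^sub>0 f ** toeplitz \<mu> \<sigma> v\<^sub>0 f' = toeplitz \<mu> \<sigma> v\<^sub>0 f' ** toeplitz \<mu> \<sigma> v\<^sub>0 f)
         \<longleftrightarrow> multiplicity_free H \<sigma>"
proof -
  \<comment> \<open>Dominance supplies the Ad-invariant inner product.\<close>
  obtain \<beta> where \<beta>: "Ad_invariant_inner G c \<beta>"
    using \<open>dominant G c T P lam\<close> unfolding dominant_def by blast
  have "group G" using \<open>lie_group G \<A>\<close> by (simp add: lie_group_def)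
  then interpret weight_rep G \<A> c \<mu> \<sigma> \<beta> T P lam v\<^sub>0
    using assms \<beta>
    by (intro weight_rep.intro lie_rep_form.intro lie_rep.intro lie_group_chart.intro weight_rep_axioms.intro
          lie_rep_form_axioms.intro lie_rep_axioms.intro lie_group_chart_axioms.intro)
  note H = \<open>subgroup H G\<close> and conn = \<open>connected (carrier G)\<close>
  let ?T = "{toeplitz \<mu> \<sigma> v\<^sub>0 f |f. f \<in> L1_quotient G \<mu> (line_stabilizer G \<sigma> v\<^sub>0) \<and> left_invariant G \<mu> H f}"
  show ?thesis
  proof
    assume comm: "\<forall>f\<in>L1_quotient G \<mu> L. \<forall>f'\<in>L1_quotient G \<mu> L.
            left_invariant G \<mu> H f \<longrightarrow> left_invariant G \<mu> H f' \<longrightarrow>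
            toeplitz \<mu> \<sigma> v\<^sub>0 f ** toeplitz \<mu> \<sigma> v\<^sub>0 f' = toeplitz \<mu> \<sigma> v\<^sub>0 f' ** toeplitz \<mu> \<sigma> v\<^sub>0 f"
    then have "A ** B = B ** A" if "A \<in> ?T" "B \<in> ?T" for A B
      using that unfolding \<open>L = line_stabilizer G \<sigma> v\<^sub>0\<close> by blast
    \<comment> \<open>Commutation spreads from the Toeplitz operators to their span, which contains
      the commutant of \<open>H\<close>.\<close>
    from commuting_span[of ?T, OF this] show "multiplicity_free H \<sigma>"
      using commutant_subset_span_toeplitz[OF conn H] by (intro commute_imp_multiplicity_free[OF H]) blast
  next
    assume mf: "multiplicity_free H \<sigma>"
    show "\<forall>f\<in>L1_quotient G \<mu> L. \<forall>f'\<in>L1_quotient G \<mu> L.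
            left_invariant G \<mu> H f \<longrightarrow> left_invariant G \<mu> H f' \<longrightarrow>
            toeplitz \<mu> \<sigma> v\<^sub>0 f ** toeplitz \<mu> \<sigma> v\<^sub>0 f' = toeplitz \<mu> \<sigma> v\<^sub>0 f' ** toeplitz \<mu> \<sigma> v\<^sub>0 f"
      by (intro ballI impI multiplicity_free_imp_commute[OF H mf] toeplitz_commutant[OF H])
         (auto simp: L1_quotient_def)
  qed
qed

end
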